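(* Let $S\subset\mathbb{R}^3$ be a rational surface, not a plane, properly parameterized by $\boldsymbol{x}(t,s)=(x(t,s),y(t,s),z(t,s))$ with $x,y,z$ real rational functions, and let $\mu(t,s)$ and $\eta(t,s)$ be the polynomials associated with $\boldsymbol{x}$ by the construction described in the context. Then $S$ is a ruled surface if and only if at least one of the polynomials $\mu(t,s)$, $\eta(t,s)$ is identically zero.
   Context: Proper means that $(t,s)\mapsto\boldsymbol{x}(t,s)$ is birational from $\mathbb{C}^2$ onto (the Zariski closure of) $S$. $S$ is ruled if through every point $P\in S$ there passes a (real or complex) straight line contained in $S$ (for complex lines, containment is in the complex Zariski closure of $S$). Subscripts $t,s$ denote partial derivatives; $\langle\,,\rangle$ is the usual dot product; $\|\boldsymbol{v}\|^2=\langle \boldsymbol{v},\boldsymbol{v}\rangle$; $\mathrm{num}(\cdot)$ denotes the numerator of a rational function. **Basic quantities.** $e^\star=\langle\boldsymbol{x}_{tt},\boldsymbol{x}_t\times\boldsymbol{x}_s\rangle$, $f^\star=\langle\boldsymbol{x}_{ts},\boldsymbol{x}_t\times\boldsymbol{x}_s\rangle$, $g^\star=\langle\boldsymbol{x}_{ss},\boldsymbol{x}_t\times\boldsymbol{x}_s\rangle$; $E=\langle\boldsymbol{x}_t,\boldsymbol{x}_t\rangle$, $F=\langle\boldsymbol{x}_t,\boldsymbol{x}_s\rangle$, $G=\langle\boldsymbol{x}_s,\boldsymbol{x}_s\rangle$, $\boldsymbol{I}=EG-F^2$; $\widehat{\Gamma}^i_{jk}=\boldsymbol{I}\,\Gamma^i_{jk}$,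 where $\Gamma^i_{jk}$ are the Christoffel symbols of $\boldsymbol{x}$ (index 1 for $t$, 2 for $s$), i.e. $\widehat\Gamma^1_{11}=\tfrac12(GE_t-2FF_t+FE_s)$, $\widehat\Gamma^2_{11}=\tfrac12(2EF_t-EE_s-FE_t)$, $\widehat\Gamma^1_{12}=\tfrac12(GE_s-FG_t)$, $\widehat\Gamma^2_{12}=\tfrac12(EG_t-FE_s)$, $\widehat\Gamma^1_{22}=\tfrac12(2GF_s-GG_t-FG_s)$, $\widehat\Gamma^2_{22}=\tfrac12(EG_s-2FF_s+FG_t)$. **Definition of $\eta$.** $\eta(t,s)=\gcd\big(\mathrm{num}(g^\star),\mathrm{num}(\widehat\Gamma^1_{22})\big)$ (so $\eta\equiv0$ iff both are identically zero). **Definition of $\mu$.** Let $\omega,\gamma$ be new variables. (i) $\tilde M(t,s,\omega)$ is the numerator of $e^\star+2f^\star\omega+g^\star\omega^2$. (ii) If $f^\star,g^\star$ are not both identically zero, put $A=2(f^\star+g^\star\omega)$ and $B=g^\star_s\omega^3+(2f^\star_s+g^\star_t)\omega^2+(2f^\star_t+e^\star_s)\omega+e^\star_t$. If $f^\star\equiv g^\star\equiv 0$, put $A=e^\star_s$ and $B=e^\star_{ss}\omega^2+2e^\star_{ts}\omega+e^\star_{tt}$. (iii) $\tilde N(t,s,\omega)$ is the polynomial obtained by substituting $\gamma=-B/A$ into $$\boldsymbol{I}\gamma=\widehat\Gamma^1_{22}\omega^3+(2\widehat\Gamma^1_{12}-\widehat\Gamma^2_{22})\omega^2+(\widehat\Gamma^1_{11}-2\widehat\Gamma^2_{12})\omega-\widehat\Gamma^2_{11},$$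 moving everything to one side and clearing denominators. (iv) $M,N$ are the primitive parts of $\tilde M,\tilde N$ with respect to $\omega$ (content and primitive part of $0$ are $0$), $\tilde\xi(t,s)=\mathrm{Res}_\omega(M,N)$ (taken to be $0$ if $N=0$), and $\xi(t,s)$ is the result of removing from $\tilde\xi$ the factors coming from denominators of the components of $\boldsymbol{x}$ and of the rational functions (coefficients) in the expressions in (i), (ii), (iii). (v) $\delta_1$ is the gcd of the coefficients of $\mathrm{num}(A)$ viewed as a polynomial in $\omega$; $\delta_2$ is the product of the contents of $\tilde M$ and $\tilde N$ with respect to $\omega$; $\delta_3$ is (the numerator of) $e^\star g^\star-(f^\star)^2$ if $f^\star,g^\star$ are not both identically zero, and $\delta_3=1$ otherwise; $\delta_4=\mathrm{num}(\|\boldsymbol{x}_t\times\boldsymbol{x}_s\|^2)$. (vi) $\mu(t,s)$ is the square-free part of $\xi\,\delta_1\delta_2\delta_3\delta_4$ (and $\mu\equiv 0$ if this product is identically zero). In the remaining case $f^\star\equiv g^\star\equiv0$ and $e^\star_s\equiv0$ (so $A\equiv0$), steps (iii)–(vi) are skipped and one sets $\mu=1$; only $\eta$ is used. *)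

theory Defs
  imports
    Complex_Main
    "HOL-Computational_Algebra.Computational_Algebra"
    "HOL-Computational_Algebra.Field_as_Ring"
    "Subresultants.Resultant_Prelim"
begin

text \<open>
  An element of \<open>'a poly poly\<close> is a polynomial in \<open>t, s\<close>, with \<open>s\<close> the outer and \<open>t\<close> the inner
  variable; in \<open>'a poly poly poly\<close> a third, outermost variable is added.  The field
  of rational functions \<open>\<real>(t,s)\<close> is the fraction field.
\<close>

type_synonym ratfun = "real poly poly fract"
type_synonym ratfun3 = "real poly poly poly fract"

definition numer :: "'a :: {ring_gcd,idom_divide,semiring_gcd_mult_normalize} fract \<Rightarrow> 'a" where
  "numer r = fst (quot_of_fract r)"

definition denom :: "'a :: {ring_gcd,idom_divide,semiring_gcd_mult_normalize} fract \<Rightarrow> 'a" where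
  "denom r = snd (quot_of_fract r)"

definition fract_deriv :: "(real poly poly \<Rightarrow> real poly poly) \<Rightarrow> ratfun \<Rightarrow> ratfun" where
  "fract_deriv D r = Fract (D (numer r) * denom r - numer r * D (denom r)) (denom r ^ 2)"

definition D_t :: "ratfun \<Rightarrow> ratfun" where
  "D_t = fract_deriv (map_poly pderiv)"

definition D_s :: "ratfun \<Rightarrow> ratfun" where
  "D_s = fract_deriv pderiv"

definition poly2 :: "'a :: comm_ring_1 poly poly \<Rightarrow> 'a \<Rightarrow> 'a \<Rightarrow> 'a" where
  "poly2 p t s = poly (poly p [:s:]) t"

text \<open>
  Evaluation of a real rational function (in lowest terms) at a real (\<open>'a = real\<close>) or complex
  (\<open>'a = complex\<close>) parameter value.
\<close>

definition ev_num :: "ratfun \<Rightarrow> 'a :: real_field \<Rightarrow> 'a \<Rightarrow> 'a" where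
  "ev_num r t s = poly2 (map_poly (map_poly of_real) (numer r)) t s"

definition ev_den :: "ratfun \<Rightarrow> 'a :: real_field \<Rightarrow> 'a \<Rightarrow> 'a" where
  "ev_den r t s = poly2 (map_poly (map_poly of_real) (denom r)) t s"

type_synonym 'a triple = "'a \<times> 'a \<times> 'a"

definition map3 :: "('a \<Rightarrow> 'b) \<Rightarrow> 'a triple \<Rightarrow> 'b triple" where
  "map3 h = (\<lambda>(a, b, c). (h a, h b, h c))"

definition set3 :: "'a triple \<Rightarrow> 'a set" where
  "set3 = (\<lambda>(a, b, c). {a, b, c})"

definition param_dom :: "ratfun triple \<Rightarrow> ('a :: real_field \<times> 'a) set" where
  "param_dom x = {(t, s). \<forall>r \<in> set3 x. ev_den r t s \<noteq> 0}"

definition param_map :: "ratfun triple \<Rightarrow> 'a :: real_field \<times> 'a \<Rightarrow> 'a triple" where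
  "param_map x = (\<lambda>(t, s). map3 (\<lambda>r. ev_num r t s / ev_den r t s) x)"

definition poly3 :: "'a :: comm_ring_1 poly poly poly \<Rightarrow> 'a triple \<Rightarrow> 'a" where
  "poly3 F = (\<lambda>(a, b, c). poly2 (poly F [:[:c:]:]) a b)"

definition zariski_closure :: "'a :: comm_ring_1 triple set \<Rightarrow> 'a triple set" where
  "zariski_closure V = {P. \<forall>F. (\<forall>Q \<in> V. poly3 F Q = 0) \<longrightarrow> poly3 F P = 0}"

definition complex_closure :: "real triple set \<Rightarrow> complex triple set" where
  "complex_closure S = zariski_closure (map3 complex_of_real ` S)"

text \<open>
  The rational map \<open>\<complex>\<^sup>2 \<rightarrow> V\<close> given by \<open>x\<close> is birational: it has a rational inverse
  \<open>(p1/q1, p2/q2)\<close>, whose denominators do not vanish identically on the (irreducible) variety \<open>V\<close>,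
  and both composites are the identity wherever they are defined.
\<close>

definition birational_onto :: "ratfun triple \<Rightarrow> complex triple set \<Rightarrow> bool" where
  "birational_onto x V \<longleftrightarrow>
     (\<forall>u \<in> param_dom x. param_map x u \<in> V) \<and>
     (\<exists>p1 q1 p2 q2 :: complex poly poly poly.
        (\<exists>P \<in> V. poly3 q1 P \<noteq> 0) \<and> (\<exists>P \<in> V. poly3 q2 P \<noteq> 0) \<and>
        (let dom = {P \<in> V. poly3 q1 P \<noteq> 0 \<and> poly3 q2 P \<noteq> 0};
             inv_map = (\<lambda>P. (poly3 p1 P / poly3 q1 P, poly3 p2 P / poly3 q2 P))
         in (\<forall>u \<in> param_dom x. param_map x u \<in> dom \<longrightarrow> inv_map (param_map x u) = u) \<and>
            (\<forall>P \<in> dom. inv_map P \<in> param_dom x \<longrightarrow> param_map x (inv_map P) = P)))"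

definition properly_parametrizes :: "ratfun triple \<Rightarrow> real triple set \<Rightarrow> bool" where
  "properly_parametrizes x S \<longleftrightarrow>
     S = zariski_closure (param_map x ` param_dom x) \<and> birational_onto x (complex_closure S)"

definition is_plane :: "real triple set \<Rightarrow> bool" where
  "is_plane S \<longleftrightarrow>
     (\<exists>a b c d. (a, b, c) \<noteq> (0, 0, 0) \<and> S = {(X, Y, Z). a * X + b * Y + c * Z + d = 0})"

definition is_line :: "'a :: field triple set \<Rightarrow> bool" where
  "is_line L \<longleftrightarrow>
     (\<exists>a b c u v w. (u, v, w) \<noteq> (0, 0, 0) \<and> L = {(a + l * u, b + l * v, c + l * w) | l. True})"

definition is_ruled :: "real triple set \<Rightarrow> bool" where
  "is_ruled S \<longleftrightarrow>
     (\<forall>P \<in> S. (\<exists>L. is_line L \<and> P \<in> L \<and> L \<subseteq> S) \<or>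
              (\<exists>L. is_line L \<and> map3 complex_of_real P \<in> L \<and> L \<subseteq> complex_closure S))"

definition dot :: "'a :: comm_ring_1 triple \<Rightarrow> 'a triple \<Rightarrow> 'a" where
  "dot = (\<lambda>(a1, a2, a3) (b1, b2, b3). a1 * b1 + a2 * b2 + a3 * b3)"

definition cross :: "'a :: comm_ring_1 triple \<Rightarrow> 'a triple \<Rightarrow> 'a triple" where
  "cross = (\<lambda>(a1, a2, a3) (b1, b2, b3).
     (a2 * b3 - a3 * b2, a3 * b1 - a1 * b3, a1 * b2 - a2 * b1))"

abbreviation "x_t x \<equiv> map3 D_t x"
abbreviation "x_s x \<equiv> map3 D_s x"

definition normal_vec :: "ratfun triple \<Rightarrow> ratfun triple" where
  "normal_vec x = cross (x_t x) (x_s x)"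

definition e_star :: "ratfun triple \<Rightarrow> ratfun" where
  "e_star x = dot (x_t (x_t x)) (normal_vec x)"

definition f_star :: "ratfun triple \<Rightarrow> ratfun" where
  "f_star x = dot (x_s (x_t x)) (normal_vec x)"

definition g_star :: "ratfun triple \<Rightarrow> ratfun" where
  "g_star x = dot (x_s (x_s x)) (normal_vec x)"

definition E_coef :: "ratfun triple \<Rightarrow> ratfun" where
  "E_coef x = dot (x_t x) (x_t x)"

definition F_coef :: "ratfun triple \<Rightarrow> ratfun" where
  "F_coef x = dot (x_t x) (x_s x)"

definition G_coef :: "ratfun triple \<Rightarrow> ratfun" where
  "G_coef x = dot (x_s x) (x_s x)"

definition I_det :: "ratfun triple \<Rightarrow> ratfun" where
  "I_det x = E_coef x * G_coef x - F_coef x ^ 2"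

text \<open>\<open>Gam_jk_i\<close> is the Christoffel symbol with lower indices \<open>j, k\<close> and upper index \<open>i\<close>,
  multiplied by \<open>E G - F\<^sup>2\<close>.\<close>

definition Gam_11_1 :: "ratfun triple \<Rightarrow> ratfun" where
  "Gam_11_1 x = (let E = E_coef x; F = F_coef x; G = G_coef x in
     (G * D_t E - 2 * F * D_t F + F * D_s E) / 2)"

definition Gam_11_2 :: "ratfun triple \<Rightarrow> ratfun" where
  "Gam_11_2 x = (let E = E_coef x; F = F_coef x; G = G_coef x in
     (2 * E * D_t F - E * D_s E - F * D_t E) / 2)"

definition Gam_12_1 :: "ratfun triple \<Rightarrow> ratfun" where
  "Gam_12_1 x = (let E = E_coef x; F = F_coef x; G = G_coef x in
     (G * D_s E - F * D_t G) / 2)"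

definition Gam_12_2 :: "ratfun triple \<Rightarrow> ratfun" where
  "Gam_12_2 x = (let E = E_coef x; F = F_coef x; G = G_coef x in
     (E * D_t G - F * D_s E) / 2)"

definition Gam_22_1 :: "ratfun triple \<Rightarrow> ratfun" where
  "Gam_22_1 x = (let E = E_coef x; F = F_coef x; G = G_coef x in
     (2 * G * D_s F - G * D_t G - F * D_s G) / 2)"

definition Gam_22_2 :: "ratfun triple \<Rightarrow> ratfun" where
  "Gam_22_2 x = (let E = E_coef x; F = F_coef x; G = G_coef x in
     (E * D_s G - 2 * F * D_s F + F * D_t G) / 2)"

definition eta :: "ratfun triple \<Rightarrow> real poly poly" where
  "eta x = gcd (numer (g_star x)) (numer (Gam_22_1 x))"

text \<open>Expressions in the new variable \<open>\<omega>\<close> are kept as polynomials over \<open>\<real>(t,s)\<close>;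
  \<open>to_ratfun3\<close> embeds them into the field \<open>\<real>(t,s,\<omega>)\<close>, with \<open>\<omega>\<close> the outermost variable.\<close>

definition to_ratfun3 :: "ratfun poly \<Rightarrow> ratfun3" where
  "to_ratfun3 p = poly (map_poly (\<lambda>r. Fract [:numer r:] [:denom r:]) p) (to_fract [:0, 1:])"

definition fg_zero :: "ratfun triple \<Rightarrow> bool" where
  "fg_zero x \<longleftrightarrow> f_star x = 0 \<and> g_star x = 0"

definition M_expr :: "ratfun triple \<Rightarrow> ratfun poly" where
  "M_expr x = [:e_star x, 2 * f_star x, g_star x:]"

definition A_expr :: "ratfun triple \<Rightarrow> ratfun poly" where
  "A_expr x = (if fg_zero x then [:D_s (e_star x):] else [:2 * f_star x, 2 * g_star x:])"

definition B_expr :: "ratfun triple \<Rightarrow> ratfun poly" where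
  "B_expr x = (let e = e_star x; f = f_star x; g = g_star x in
     if fg_zero x then [:D_t (D_t e), 2 * D_s (D_t e), D_s (D_s e):]
     else [:D_t e, 2 * D_t f + D_s e, 2 * D_s f + D_t g, D_s g:])"

definition geodesic_rhs :: "ratfun triple \<Rightarrow> ratfun poly" where
  "geodesic_rhs x =
     [:- Gam_11_2 x, Gam_11_1 x - 2 * Gam_12_2 x, 2 * Gam_12_1 x - Gam_22_2 x, Gam_22_1 x:]"

definition M_tilde :: "ratfun triple \<Rightarrow> real poly poly poly" where
  "M_tilde x = numer (to_ratfun3 (M_expr x))"

definition N_tilde :: "ratfun triple \<Rightarrow> real poly poly poly" where
  "N_tilde x = (let \<gamma> = - (to_ratfun3 (B_expr x) / to_ratfun3 (A_expr x)) in
     numer (to_ratfun3 [:I_det x:] * \<gamma> - to_ratfun3 (geodesic_rhs x)))"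

definition xi_tilde :: "ratfun triple \<Rightarrow> real poly poly" where
  "xi_tilde x = (let M = primitive_part (M_tilde x); N = primitive_part (N_tilde x) in
     if N = 0 then 0 else resultant M N)"

definition denominators :: "ratfun triple \<Rightarrow> real poly poly set" where
  "denominators x =
     denom ` (set3 x \<union>
       (\<Union>p \<in> {M_expr x, A_expr x, B_expr x, [:I_det x:], geodesic_rhs x}. set (coeffs p)))"

definition remove_factors :: "real poly poly set \<Rightarrow> real poly poly \<Rightarrow> real poly poly" where
  "remove_factors D p =
     unit_factor p * prod_mset (filter_mset (\<lambda>q. \<not> (\<exists>d \<in> D. q dvd d)) (prime_factorization p))"

definition xi :: "ratfun triple \<Rightarrow> real poly poly" where
  "xi x = remove_factors (denominators x) (xi_tilde x)"

definition delta1 :: "ratfun triple \<Rightarrow> real poly poly" where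
  "delta1 x = content (numer (to_ratfun3 (A_expr x)))"

definition delta2 :: "ratfun triple \<Rightarrow> real poly poly" where
  "delta2 x = content (M_tilde x) * content (N_tilde x)"

definition delta3 :: "ratfun triple \<Rightarrow> real poly poly" where
  "delta3 x = (if fg_zero x then 1 else numer (e_star x * g_star x - f_star x ^ 2))"

definition delta4 :: "ratfun triple \<Rightarrow> real poly poly" where
  "delta4 x = numer (dot (normal_vec x) (normal_vec x))"

text \<open>The product of the distinct irreducible factors.  The constant \<open>squarefree_part\<close> of the
  library is a different notion: it drops factors of even multiplicity.\<close>

definition sqfree_part :: "real poly poly \<Rightarrow> real poly poly" where
  "sqfree_part p = (if p = 0 then 0 else \<Prod>(prime_factors p))"

definition mu :: "ratfun triple \<Rightarrow> real poly poly" where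
  "mu x = (if fg_zero x \<and> D_s (e_star x) = 0 then 1
           else sqfree_part (xi x * delta1 x * delta2 x * delta3 x * delta4 x))"

end

theory Submission
  imports Defs
    "HOL-Complex_Analysis.Complex_Analysis"
    "HOL-Algebra.Algebraic_Closure_Type"
    "Subresultants.Subresultant_Gcd"
begin

text \<open>
  The \<^emph>\<open>if\<close> direction rests on an algebraic form of the statement that a curve on the surface with acceleration
  parallel to its velocity is a straight line (theorem \<open>osculating_line\<close>): if \<open>d\<close> is a derivation along the
  curve, \<open>w = d x\<close> and \<open>d w\<close> is a multiple of \<open>w\<close>, then the equation of the surface, restricted to the tangent
  line \<open>x + l w\<close>, has vanishing Taylor coefficients.  Such a direction \<open>w\<close> exists in three cases.  If \<open>\<eta> = 0\<close>,
  then \<open>x_ss\<close> is a multiple of \<open>x_s\<close> (\<open>ruled_if_eta_eq_0\<close>).  If the second fundamental form is degenerate but not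
  zero, its null direction is straight (\<open>ruled_if_parabolic\<close>); if moreover \<open>f = g = 0\<close>, then this is the
  direction of \<open>s\<close>, so \<open>\<eta> = 0\<close> and the surface is ruled (\<open>eta_eq_0_if_fg_zero\<close>).  If finally the polynomials \<open>M\<close> and \<open>N\<close> have a common root \<open>\<omega>\<close>, then \<open>x_t + \<omega> x_s\<close> is the direction of
  an asymptotic curve that is a geodesic, hence straight (\<open>ruled_if_common_root\<close>).

  This gives a line through the generic point of the surface, over an algebraic closure of \<open>\<real>(t,s)\<close>.  Lines
  through all points are obtained from it by specialisation: the homomorphism that sends the
  generic point to a given point \<open>P\<close> extends to a place of the algebraically closed field, and a place sends a direction,
  suitably normalised, to a direction (\<open>specialise_direction\<close>).

  Except in the case \<open>f = g = 0\<close>, the polynomial \<open>\<mu>\<close> vanishes if and only if \<open>e g - f\<^sup>2 = 0\<close> or \<open>M\<close> and \<open>N\<close> have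
  a common root in the algebraic closure; all other factors in its definition are nonzero (\<open>mu_eq_0_iff\<close>).

  For the \<^emph>\<open>only if\<close> direction, let a line pass through a generic real point.  The birational inverse lifts it to a
  holomorphic curve in the parameter plane (\<open>curve_over_line\<close>).  Differentiating the line twice, and the resulting
  equation of asymptotic directions once more, shows that the slope of this curve is a common root of \<open>M\<close> and \<open>N\<close> at the point,
  unless the curve is tangent to the \<open>s\<close>-direction (\<open>line_through_point\<close>).  If \<open>M\<close> and \<open>N\<close> have no common root
  over the function field, a Bezout identity excludes the first possibility at generic points, and the second one
  yields \<open>\<eta> = 0\<close> (\<open>eta_eq_0_if_ruled\<close>).

  Properness enters in two ways: through the lifted curve, and through the fact that the normal vector is not
  zero (\<open>normal_vec_nonzero\<close>).  That the surface is not a plane ensures that its second fundamental form is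
  not zero (\<open>plane_if_second_form_zero\<close>).
\<close>

(* In the proofs below, degree, coeff, smult, monom and content refer to univariate polynomials. *)
hide_const (open) Henstock_Kurzweil_Integration.content Polynomials.degree Polynomials.lead_coeff up_ring.coeff module.smult up_ring.monom
(* The variables are written as [:0, 1:] and must not be rewritten to pCons 0 1. *)
declare one_poly_eq_simps [simp del] pCons_one [simp del]

section \<open>Evaluation of polynomials in two and three variables\<close>

text \<open>
  Transporting the coefficients along a ring homomorphism lets one and the same real polynomial be
  evaluated at real points, at complex points, in \<open>\<real>(t,s)\<close>, and in the algebraic closure of
  \<open>\<real>(t,s)\<close>.
\<close>

definition ev2 :: "('c::comm_ring_1 \<Rightarrow> 'b::comm_ring_1) \<Rightarrow> 'c poly poly \<Rightarrow> 'b \<Rightarrow> 'b \<Rightarrow> 'b" where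
  "ev2 h p a b = poly2 (map_poly (map_poly h) p) a b"

definition ev3 :: "('c::comm_ring_1 \<Rightarrow> 'b::comm_ring_1) \<Rightarrow> 'c poly poly poly \<Rightarrow> 'b triple \<Rightarrow> 'b" where
  "ev3 h F P = poly3 (map_poly (map_poly (map_poly h)) F) P"

text \<open>
  Constants and variables generate the polynomial ring, so every identity that is compatible with sums
  and products only has to be verified on them; this replaces all coefficient calculus below.
\<close>

lemma poly2_induct [case_names const X Y add mult]:
  fixes p :: "'a::comm_ring_1 poly poly"
  assumes c: "\<And>c. Q [:[:c:]:]" and x: "Q [:[:0, 1:]:]" and y: "Q [:0, 1:]"
    and a: "\<And>p q. Q p \<Longrightarrow> Q q \<Longrightarrow> Q (p + q)" and m: "\<And>p q. Q p \<Longrightarrow> Q q \<Longrightarrow> Q (p * q)"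
  shows "Q p"
proof (induction p)
  case 0
  show ?case using c[of 0] by simp
next
  case (pCons r p)
  have "Q [:r:]"
  proof (induction r)
    case 0
    show ?case using c[of 0] by simp
  next
    case (pCons u r)
    have "[:pCons u r:] = [:[:u:]:] + [:[:0, 1:]:] * [:r:]" by simp
    then show ?case using a m x c pCons.IH by metis
  qed
  moreover have "pCons r p = [:r:] + [:0, 1:] * p" by simp
  ultimately show ?case using a m y pCons.IH by metis
qed

lemma poly3_induct [case_names const X Y Z add mult]:
  fixes F :: "'a::comm_ring_1 poly poly poly"
  assumes c: "\<And>c. Q [:[:[:c:]:]:]" and x: "Q [:[:[:0, 1:]:]:]" and y: "Q [:[:0, 1:]:]"
    and z: "Q [:0, 1:]"
    and a: "\<And>F G. Q F \<Longrightarrow> Q G \<Longrightarrow> Q (F + G)" and m: "\<And>F G. Q F \<Longrightarrow> Q G \<Longrightarrow> Q (F * G)"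
  shows "Q F"
proof (induction F)
  case 0
  show ?case using c[of 0] by simp
next
  case (pCons r F)
  have "Q [:r:]"
  proof (induction r rule: poly2_induct)
    case (add p q)
    then show ?case using a[of "[:p:]" "[:q:]"] by simp
  next
    case (mult p q)
    then show ?case using m[of "[:p:]" "[:q:]"] by (simp add: mult.commute)
  qed (use c x y in auto)
  moreover have "pCons r F = [:r:] + [:0, 1:] * F" by simp
  ultimately show ?case using a m z pCons.IH by metis
qed

lemma poly2_simps [simp]:
  "poly2 (p + q) a b = poly2 p a b + poly2 q a b" "poly2 (p * q) a b = poly2 p a b * poly2 q a b"
  "poly2 [:[:c:]:] a b = c" "poly2 [:[:0, 1:]:] a b = a" "poly2 [:0, 1:] a b = b"
  "poly2 (p - q) a b = poly2 p a b - poly2 q a b" "poly2 (- p) a b = - poly2 p a b"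
  "poly2 0 a b = 0" "poly2 1 a b = 1"
  by (simp_all add: poly2_def)

lemma poly3_simps [simp]:
  "poly3 (F + G) P = poly3 F P + poly3 G P" "poly3 (F * G) P = poly3 F P * poly3 G P"
  "poly3 [:[:[:c:]:]:] P = c"
  "poly3 (F - G) P = poly3 F P - poly3 G P" "poly3 (- F) P = - poly3 F P"
  "poly3 0 P = 0" "poly3 1 P = 1"
  by (cases P, simp add: poly3_def)+

lemma poly3_gens [simp]:
  "poly3 [:[:[:0, 1:]:]:] (a, b, c) = a" "poly3 [:[:0, 1:]:] (a, b, c) = b" "poly3 [:0, 1:] (a, b, c) = c"
  by (simp_all add: poly3_def)

lemma map_poly_pCons0: "h 0 = 0 \<Longrightarrow> map_poly h (pCons a p) = pCons (h a) (map_poly h p)"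
  by (rule poly_eqI) (simp add: coeff_map_poly coeff_pCons split: nat.splits)

lemma comm_ring_hom_map_poly: "comm_ring_hom h \<Longrightarrow> comm_ring_hom (map_poly h)"
proof -
  assume "comm_ring_hom h"
  then interpret map_poly_comm_ring_hom h by (simp add: map_poly_comm_ring_hom_def)
  show ?thesis by unfold_locales
qed

lemma comm_ring_hom_o: "comm_ring_hom f \<Longrightarrow> comm_ring_hom g \<Longrightarrow> comm_ring_hom (\<lambda>x. g (f x))"
proof -
  assume "comm_ring_hom f" "comm_ring_hom g"
  then interpret f: comm_ring_hom f + g: comm_ring_hom g .
  show ?thesis by unfold_locales (simp_all add: f.hom_add g.hom_add f.hom_mult g.hom_mult)
qed

lemma hom_props:
  assumes "comm_ring_hom h"
  shows "h 0 = 0" "h 1 = 1" "h (a + b) = h a + h b" "h (a * b) = h a * h b" "h (a - b) = h a - h b"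
    "h (- a) = - h a" "h (a ^ n) = h a ^ n" "h (numeral m) = numeral m" "h (of_nat k) = of_nat k"
proof -
  interpret comm_ring_hom h by fact
  show "h 0 = 0" "h 1 = 1" "h (a + b) = h a + h b" "h (a * b) = h a * h b" "h (a - b) = h a - h b"
    "h (- a) = - h a" "h (a ^ n) = h a ^ n" "h (of_nat k) = of_nat k" "h (numeral m) = numeral m"
    by (simp_all add: hom_distribs)
qed

lemma comm_ring_homI:
  assumes "f 1 = 1" "\<And>a b. f (a + b) = f a + f b" "\<And>a b. f (a * b) = f a * f b"
  shows "comm_ring_hom f"
proof unfold_locales
  have "f 0 + f 0 = f 0 + 0" using assms(2)[of 0 0] by simp
  then show "f 0 = 0" by (simp only: add_left_cancel)
qed (use assms in auto)

context
  fixes h :: "'c::comm_ring_1 \<Rightarrow> 'b::comm_ring_1"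
  assumes h: "comm_ring_hom h"
begin

private lemmas h1 = hom_props[OF h]
private lemmas h2 = hom_props[OF comm_ring_hom_map_poly[OF h]]
private lemmas h3 = hom_props[OF comm_ring_hom_map_poly[OF comm_ring_hom_map_poly[OF h]]]
private lemmas h4 = hom_props[OF comm_ring_hom_map_poly[OF comm_ring_hom_map_poly[OF comm_ring_hom_map_poly[OF h]]]]

lemma ev2_simps:
  "ev2 h (p + q) a b = ev2 h p a b + ev2 h q a b" "ev2 h (p * q) a b = ev2 h p a b * ev2 h q a b"
  "ev2 h [:[:c:]:] a b = h c" "ev2 h [:[:0, 1:]:] a b = a" "ev2 h [:0, 1:] a b = b"
  "ev2 h (p - q) a b = ev2 h p a b - ev2 h q a b" "ev2 h (- p) a b = - ev2 h p a b"
  "ev2 h 0 a b = 0" "ev2 h 1 a b = 1"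
  by (simp_all add: ev2_def h3 map_poly_pCons0 h1 h2)

lemma ev3_simps:
  "ev3 h (F + G) P = ev3 h F P + ev3 h G P" "ev3 h (F * G) P = ev3 h F P * ev3 h G P"
  "ev3 h [:[:[:c:]:]:] P = h c" "ev3 h (F - G) P = ev3 h F P - ev3 h G P" "ev3 h (- F) P = - ev3 h F P"
  "ev3 h 0 P = 0" "ev3 h 1 P = 1"
  "ev3 h [:[:[:0, 1:]:]:] (a, b, c') = a" "ev3 h [:[:0, 1:]:] (a, b, c') = b" "ev3 h [:0, 1:] (a, b, c') = c'"
  by (simp_all add: ev3_def h4 map_poly_pCons0 h1 h2 h3)

end

lemma comm_ring_hom_ev2: "comm_ring_hom h \<Longrightarrow> comm_ring_hom (\<lambda>p. ev2 h p a b)"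
  by (rule comm_ring_homI) (simp_all add: ev2_simps)

lemma hom_ev2:
  assumes h: "comm_ring_hom h" and g: "comm_ring_hom g"
  shows "g (ev2 h p a b) = ev2 (\<lambda>c. g (h c)) p (g a) (g b)"
  by (induction p rule: poly2_induct)
     (simp_all add: ev2_simps[OF h] ev2_simps[OF comm_ring_hom_o[OF h g]] hom_props[OF g])

lemma hom_ev3:
  assumes h: "comm_ring_hom h" and g: "comm_ring_hom g"
  shows "g (ev3 h F (a, b, c)) = ev3 (\<lambda>c. g (h c)) F (g a, g b, g c)"
  by (induction F rule: poly3_induct)
     (simp_all add: ev3_simps[OF h] ev3_simps[OF comm_ring_hom_o[OF h g]] hom_props[OF g])

lemma ev3_id: "ev3 (\<lambda>c. c) F P = poly3 F P"
  by (simp add: ev3_def map_poly_idI)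

section \<open>Ideals of polynomials over a field\<close>

text \<open>
  An element of least degree generates: remainders modulo it stay in the ideal and have smaller degree.
\<close>

lemma field_poly_ideal_principal:
  fixes J :: "'a::field poly set"
  assumes zero: "0 \<in> J"
    and add: "\<And>f g. f \<in> J \<Longrightarrow> g \<in> J \<Longrightarrow> f + g \<in> J"
    and mult: "\<And>f g. g \<in> J \<Longrightarrow> f * g \<in> J"
  obtains p where "p \<in> J" "\<And>f. f \<in> J \<Longrightarrow> p dvd f"
proof (cases "J = {0}")
  case True
  then show ?thesis using that[of 0] by simp
next
  case False
  then obtain f0 where f0: "f0 \<in> J" "f0 \<noteq> 0" using zero by blast
  define d where "d = (ARG_MIN degree f. f \<in> J \<and> f \<noteq> 0)"
  have d: "d \<in> J" "d \<noteq> 0" and dmin: "\<And>f. f \<in> J \<Longrightarrow> f \<noteq> 0 \<Longrightarrow> degree d \<le> degree f"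
    using arg_min_nat_lemma[of "\<lambda>f. f \<in> J \<and> f \<noteq> 0" f0 degree] f0 unfolding d_def by auto
  have "d dvd f" if f: "f \<in> J" for f
  proof (rule ccontr)
    assume "\<not> d dvd f"
    then have nz: "f mod d \<noteq> 0" by (simp add: mod_eq_0_iff_dvd)
    have "f mod d = f + (- (f div d)) * d" by (simp add: minus_div_mult_eq_mod[symmetric])
    then have "f mod d \<in> J" using add[OF f mult[OF d(1), of "- (f div d)"]] by simp
    then have "degree d \<le> degree (f mod d)" using nz by (rule dmin)
    then show False using degree_mod_less'[OF d(2) nz] by simp
  qed
  then show ?thesis using that d(1) by blast
qed

section \<open>Derivations\<close>

text \<open>
  The values may live in another ring than the arguments: the composite of a derivation with the
  evaluation \<open>e\<close> at an algebraic element is of this kind, although it need not extend to a derivation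
  of the ring generated by that element.
\<close>

definition derivation_along :: "('a::comm_ring_1 \<Rightarrow> 'b::comm_ring_1) \<Rightarrow> ('a \<Rightarrow> 'b) \<Rightarrow> bool" where
  "derivation_along e d \<longleftrightarrow>
     (\<forall>a b. d (a + b) = d a + d b) \<and> (\<forall>a b. d (a * b) = e a * d b + d a * e b)"

abbreviation derivation :: "('a::comm_ring_1 \<Rightarrow> 'a) \<Rightarrow> bool" where
  "derivation \<equiv> derivation_along (\<lambda>a. a)"

lemma derivation_along_props:
  assumes e: "comm_ring_hom e" and d: "derivation_along e d"
  shows "d (a + b) = d a + d b" "d (a * b) = e a * d b + d a * e b" "d 0 = 0" "d 1 = 0"
    "d (- a) = - d a" "d (a - b) = d a - d b" "d (numeral m) = 0" "d (of_nat n) = 0"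
proof -
  show A: "\<And>a b. d (a + b) = d a + d b" and M: "\<And>a b. d (a * b) = e a * d b + d a * e b"
    using d by (auto simp: derivation_along_def)
  have "d 0 + d 0 = d 0 + 0" using A[of 0 0] by simp
  then show Z: "d 0 = 0" by (simp only: add_left_cancel)
  have "d 1 + d 1 = d 1 + 0" using M[of 1 1] hom_props(2)[OF e] by simp
  then show O: "d 1 = 0" by (simp only: add_left_cancel)
  have U: "d (- a) = - d a" for a
    using A[of a "- a"] Z by (simp add: eq_neg_iff_add_eq_0 add.commute)
  then show "d (- a) = - d a" .
  show "d (a - b) = d a - d b" using A[of a "- b"] U by simp
  have N: "d (of_nat n) = 0" for n by (induction n) (simp_all add: A Z O)
  then show "d (of_nat n) = 0" .
  show "d (numeral m) = 0" using N[of "numeral m"] by simp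
qed

lemma comm_ring_hom_id: "comm_ring_hom (\<lambda>a. a)"
  by (rule comm_ring_homI) auto

lemmas derivation_props = derivation_along_props[OF comm_ring_hom_id]

lemma derivation_along_o:
  assumes "comm_ring_hom e" "derivation d"
  shows "derivation_along e (\<lambda>a. e (d a))"
  using assms by (simp add: derivation_along_def hom_props)

lemma derivation_along_map_poly:
  assumes e: "comm_ring_hom e" and d: "derivation_along e d"
  shows "derivation_along (map_poly e) (map_poly d)"
proof -
  note [simp] = derivation_along_props[OF e d]
  have s: "d (sum f A) = (\<Sum>i\<in>A. d (f i))" for f :: "nat \<Rightarrow> 'a" and A
    by (induction A rule: infinite_finite_induct) simp_all
  have e0: "e 0 = 0" by (simp add: hom_props[OF e])
  show ?thesis
    unfolding derivation_along_def
  proof (intro conjI allI poly_eqI)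
    fix a b n
    show "coeff (map_poly d (a + b)) n = coeff (map_poly d a + map_poly d b) n"
      by (simp add: coeff_map_poly)
    show "coeff (map_poly d (a * b)) n = coeff (map_poly e a * map_poly d b + map_poly d a * map_poly e b) n"
      by (simp add: coeff_map_poly coeff_mult s e0 sum.distrib)
  qed
qed

lemma derivation_map_poly: "derivation d \<Longrightarrow> derivation (map_poly d)"
  using derivation_along_map_poly[OF comm_ring_hom_id, of d] by (simp add: map_poly_idI derivation_along_def)

lemma derivation_pderiv: "derivation (pderiv :: 'a::{comm_ring_1,semiring_no_zero_divisors} poly \<Rightarrow> _)"
  by (simp add: derivation_along_def pderiv_add pderiv_mult)

section \<open>Specialising a direction along a place\<close>

text \<open>
  A homomorphism to \<open>\<complex>\<close> from a subring of the field is represented by its graph, which is a subring of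
  the product; it is single-valued as soon as \<open>0\<close> has no other partner than \<open>0\<close>.  The unions of
  chains needed for Zorn's lemma are then plain unions of sets.
\<close>

definition partial_homs :: "(real \<Rightarrow> 'k::field) \<Rightarrow> ('k \<times> complex) set set" where
  "partial_homs h = {M.
     (\<forall>r. (h r, of_real r) \<in> M) \<and>
     (\<forall>a c b d. (a, c) \<in> M \<longrightarrow> (b, d) \<in> M \<longrightarrow> (a + b, c + d) \<in> M \<and> (a * b, c * d) \<in> M) \<and>
     (\<forall>c. (0, c) \<in> M \<longrightarrow> c = 0)}"

text \<open>
  A polynomial over the graph: its two components carry the coefficients before and after
  specialisation.
\<close>

definition poly_pairs :: "('k::field \<times> complex) set \<Rightarrow> ('k poly \<times> complex poly) set" where
  "poly_pairs M = {(p, q). \<forall>i. (coeff p i, coeff q i) \<in> M}"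

text \<open>
  The Nullstellensatz in one variable: a nonconstant generator would have a root.
\<close>

lemma ideal_without_common_root_contains_1:
  fixes J :: "complex poly set"
  assumes zero: "0 \<in> J"
    and add: "\<And>f g. f \<in> J \<Longrightarrow> g \<in> J \<Longrightarrow> f + g \<in> J"
    and mult: "\<And>f g. g \<in> J \<Longrightarrow> f * g \<in> J"
    and no_root: "\<And>c. \<exists>f \<in> J. poly f c \<noteq> 0"
  shows "1 \<in> J"
proof -
  obtain d where d: "d \<in> J" and dvd: "\<And>f. f \<in> J \<Longrightarrow> d dvd f"
    by (rule field_poly_ideal_principal[of J]) (use zero add mult in auto)
  have "degree d = 0"
  proof (rule ccontr)
    assume "degree d \<noteq> 0"
    then obtain c where "poly d c = 0" using alg_closed_imp_poly_has_root by blast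
    moreover obtain f where "f \<in> J" "poly f c \<noteq> 0" using no_root by blast
    ultimately show False using dvd by (metis poly_eq_0_iff_dvd dvd_trans)
  qed
  then obtain k where k: "d = [:k:]" by (rule degree_eq_zeroE)
  obtain f where "f \<in> J" "poly f 0 \<noteq> 0" using no_root by blast
  then have "d \<noteq> 0" using dvd[of f] by auto
  then have "k \<noteq> 0" using k by simp
  then have "[:1 / k:] * d = 1" by (simp add: k one_pCons)
  then show ?thesis using mult[OF d] by metis
qed

lemma poly_as_sum_upto:
  fixes p :: "'a::comm_ring_1 poly"
  assumes "degree p \<le> n"
  shows "poly p x = (\<Sum>i\<le>n. coeff p i * x ^ i)"
  unfolding poly_altdef using assms by (intro sum.mono_neutral_left) (auto simp: coeff_eq_0)

context
  fixes h :: "real \<Rightarrow> 'k::field" and M :: "('k \<times> complex) set"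
  assumes h: "comm_ring_hom h" and M: "M \<in> partial_homs h"
begin

private lemma Mr: "(h r, of_real r) \<in> M"
  and Madd: "(a, c) \<in> M \<Longrightarrow> (b, d) \<in> M \<Longrightarrow> (a + b, c + d) \<in> M"
  and Mmult: "(a, c) \<in> M \<Longrightarrow> (b, d) \<in> M \<Longrightarrow> (a * b, c * d) \<in> M"
  and Mfun: "(0, c) \<in> M \<Longrightarrow> c = 0"
  using M by (auto simp: partial_homs_def)

private lemma M0: "(0, 0) \<in> M" and M1: "(1, 1) \<in> M"
  using Mr[of 0] Mr[of 1] by (simp_all add: hom_props[OF h])

private lemma Mneg: "(a, c) \<in> M \<Longrightarrow> (- a, - c) \<in> M"
  using Mmult[OF _ Mr[of "-1"], of a c] by (simp add: hom_props[OF h])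

private lemma Mdiff: "(a, c) \<in> M \<Longrightarrow> (b, d) \<in> M \<Longrightarrow> (a - b, c - d) \<in> M"
  using Madd[OF _ Mneg, of a c b d] by simp

private lemma Msum: "(\<And>i. i \<in> A \<Longrightarrow> (f i, g i) \<in> M) \<Longrightarrow> (sum f A, sum g A) \<in> M" for A :: "nat set"
  by (induction A rule: infinite_finite_induct) (auto intro: Madd M0)

lemma partial_hom_ev3:
  assumes "(a, a') \<in> M" "(b, b') \<in> M" "(c, c') \<in> M"
  shows "(ev3 h F (a, b, c), ev3 of_real F (a', b', c')) \<in> M"
proof -
  have r: "comm_ring_hom (of_real :: real \<Rightarrow> complex)" by (rule comm_ring_homI) auto
  show ?thesis
    by (induction F rule: poly3_induct)
       (auto simp: ev3_simps[OF h] ev3_simps[OF r] intro: Mr Madd Mmult assms)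
qed

private lemma pairs_mult:
  assumes "(p, q) \<in> poly_pairs M" "(p', q') \<in> poly_pairs M"
  shows "(p * p', q * q') \<in> poly_pairs M"
  using assms by (auto simp: poly_pairs_def coeff_mult intro!: Msum Mmult)

private lemma pairs_add:
  assumes "(p, q) \<in> poly_pairs M" "(p', q') \<in> poly_pairs M"
  shows "(p + p', q + q') \<in> poly_pairs M"
  using assms by (auto simp: poly_pairs_def intro!: Madd)

private lemma pairs_const: "(a, c) \<in> M \<Longrightarrow> ([:a:], [:c:]) \<in> poly_pairs M"
  by (auto simp: poly_pairs_def coeff_pCons M0 split: nat.splits)

private lemma pairs_X: "([:0, 1:], [:0, 1:]) \<in> poly_pairs M"
  by (auto simp: poly_pairs_def coeff_pCons M0 M1 split: nat.splits)

text \<open>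
  Maximality says that \<open>y\<close> cannot be given any value \<open>c\<close>, hence for every \<open>c\<close> some polynomial relation of
  \<open>y\<close> specialises to a polynomial that does not vanish at \<open>c\<close>.  The specialised relations form an ideal
  over the residue ring, and by the Nullstellensatz its complexification contains \<open>1\<close>.  The residue ring
  lies between \<open>\<real>\<close> and \<open>\<complex>\<close>, so it is one of the two, and in both cases \<open>1\<close> already is a specialised
  relation.
\<close>

lemma maximal_partial_hom_relation:
  assumes max: "\<And>M'. M' \<in> partial_homs h \<Longrightarrow> M \<subseteq> M' \<Longrightarrow> M' = M"
    and y: "y \<notin> Domain M"
  shows "\<exists>p. (p, 1) \<in> poly_pairs M \<and> poly p y = 0"
proof -
  define J where "J = {q. \<exists>p. (p, q) \<in> poly_pairs M \<and> poly p y = 0}"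
  have no_root: "\<exists>q \<in> J. poly q c \<noteq> 0" for c
  proof (rule ccontr)
    assume "\<not> ?thesis"
    then have root: "\<And>p q. (p, q) \<in> poly_pairs M \<Longrightarrow> poly p y = 0 \<Longrightarrow> poly q c = 0"
      by (auto simp: J_def)
    define M' where "M' = {(poly p y, poly q c) |p q. (p, q) \<in> poly_pairs M}"
    have MM': "(a, d) \<in> M'" if "(a, d) \<in> M" for a d
      unfolding M'_def using pairs_const[OF that] by force
    have "M' \<in> partial_homs h"
      unfolding partial_homs_def
    proof (intro CollectI conjI allI impI)
      fix r show "(h r, of_real r) \<in> M'" by (rule MM'[OF Mr])
    next
      fix a d b e assume "(a, d) \<in> M'" "(b, e) \<in> M'"
      then obtain p q p' q' where pq: "(p, q) \<in> poly_pairs M" "(p', q') \<in> poly_pairs M"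
        and "a = poly p y" "d = poly q c" "b = poly p' y" "e = poly q' c"
        unfolding M'_def by auto
      then have "a + b = poly (p + p') y" "d + e = poly (q + q') c" "a * b = poly (p * p') y" "d * e = poly (q * q') c"
        by auto
      then show "(a + b, d + e) \<in> M'" "(a * b, d * e) \<in> M'"
        unfolding M'_def using pairs_add[OF pq] pairs_mult[OF pq] by blast+
    next
      fix d assume "(0, d) \<in> M'"
      then show "d = 0" unfolding M'_def using root by auto
    qed
    moreover have "M \<subseteq> M'" using MM' by auto
    ultimately have "M' = M" by (rule max)
    moreover have "(y, c) \<in> M'"
      unfolding M'_def using pairs_X by force
    ultimately show False using y by auto
  qed
  have J0: "0 \<in> J"
    unfolding J_def using pairs_const[OF M0] by force
  have Jadd: "f + g \<in> J" if "f \<in> J" "g \<in> J" for f g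
    using that unfolding J_def by (force dest: pairs_add)
  have Jmult: "q' * g \<in> J" if "(p', q') \<in> poly_pairs M" "g \<in> J" for p' q' g
    using that unfolding J_def by (force dest: pairs_mult)
  have JX: "[:0, 1:] * g \<in> J" if "g \<in> J" for g
    using Jmult[OF pairs_X that] .
  have Jreal: "smult (of_real r) g \<in> J" if "g \<in> J" for g r
    using Jmult[OF pairs_const[OF Mr] that, of r] by simp
  define J' where "J' = {f + smult \<i> g |f g. f \<in> J \<and> g \<in> J}"
  have J'add: "f + g \<in> J'" if fg: "f \<in> J'" "g \<in> J'" for f g
  proof -
    obtain f1 f2 g1 g2 where "f = f1 + smult \<i> f2" "g = g1 + smult \<i> g2" "f1 \<in> J" "f2 \<in> J" "g1 \<in> J" "g2 \<in> J"
      using fg unfolding J'_def by auto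
    then have "f + g = (f1 + g1) + smult \<i> (f2 + g2)" "f1 + g1 \<in> J" "f2 + g2 \<in> J"
      by (auto simp: smult_add_right intro: Jadd)
    then show ?thesis unfolding J'_def by blast
  qed
  have J'smult: "smult z g \<in> J'" if g: "g \<in> J'" for z g
  proof -
    obtain g1 g2 where g12: "g = g1 + smult \<i> g2" "g1 \<in> J" "g2 \<in> J"
      using g unfolding J'_def by auto
    have z: "z = of_real (Re z) + \<i> * of_real (Im z)" by (simp add: complex_eq)
    have "smult z g = (smult (of_real (Re z)) g1 + smult (of_real (- Im z)) g2)
        + smult \<i> (smult (of_real (Im z)) g1 + smult (of_real (Re z)) g2)"
      by (rule poly_eqI, subst z) (simp add: g12 algebra_simps)
    moreover have "smult (of_real (Re z)) g1 + smult (of_real (- Im z)) g2 \<in> J"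
      "smult (of_real (Im z)) g1 + smult (of_real (Re z)) g2 \<in> J"
      using g12 by (auto intro!: Jadd Jreal simp del: of_real_minus)
    ultimately show ?thesis unfolding J'_def by blast
  qed
  have J'X: "[:0, 1:] * g \<in> J'" if g: "g \<in> J'" for g
  proof -
    obtain g1 g2 where g12: "g = g1 + smult \<i> g2" "g1 \<in> J" "g2 \<in> J"
      using g unfolding J'_def by auto
    then have "[:0, 1:] * g = [:0, 1:] * g1 + smult \<i> ([:0, 1:] * g2)"
      by (simp add: smult_add_right)
    then show ?thesis unfolding J'_def using JX g12 by blast
  qed
  have J'0: "0 \<in> J'" unfolding J'_def using J0 by force
  have "1 \<in> J'"
  proof (rule ideal_without_common_root_contains_1[OF J'0 J'add])
    fix f g assume g: "g \<in> J'"
    show "f * g \<in> J'"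
    proof (induction f)
      case 0
      show ?case using J'0 by simp
    next
      case (pCons a f)
      have "pCons a f * g = smult a g + [:0, 1:] * (f * g)" by simp
      then show ?case using J'add J'smult[OF g] J'X pCons.IH by metis
    qed
  next
    fix c
    obtain q where "q \<in> J" "poly q c \<noteq> 0" using no_root by blast
    moreover have "q = q + smult \<i> 0" by simp
    ultimately show "\<exists>f \<in> J'. poly f c \<noteq> 0" unfolding J'_def using J0 by blast
  qed
  then obtain f g where fg: "1 = f + smult \<i> g" "f \<in> J" "g \<in> J" unfolding J'_def by auto
  have "1 \<in> J"
  proof (cases "\<exists>a c. (a, c) \<in> M \<and> Im c \<noteq> 0")
    case True
    then obtain a c where ac: "(a, c) \<in> M" "Im c \<noteq> 0" by blast
    have "((a - h (Re c)) * h (1 / Im c), (c - of_real (Re c)) * of_real (1 / Im c)) \<in> M"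
      by (intro Mmult Mdiff ac Mr)
    moreover have "(c - of_real (Re c)) * of_real (1 / Im c) = \<i>"
      using ac(2) by (simp add: complex_eq_iff)
    ultimately have "((a - h (Re c)) * h (1 / Im c), \<i>) \<in> M" by simp
    from Jadd[OF fg(2) Jmult[OF pairs_const[OF this] fg(3)]] show ?thesis using fg(1) by simp
  next
    case False
    have im: "Im (coeff q i) = 0" if "q \<in> J" for q i
      using that False unfolding J_def poly_pairs_def by blast
    have "f = 1"
    proof (rule poly_eqI)
      fix i
      have "coeff 1 i = coeff f i + \<i> * coeff g i" by (simp add: fg(1))
      moreover have "Im (coeff (1 :: complex poly) i) = 0" by (simp add: one_pCons coeff_pCons split: nat.splits)
      ultimately show "coeff f i = coeff 1 i" using im fg by (simp add: complex_eq_iff)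
    qed
    then show ?thesis using fg by simp
  qed
  then show ?thesis unfolding J_def by auto
qed

text \<open>
  The key step of Chevalley's extension theorem: relations for \<open>y\<close> and for its inverse that both specialise
  to \<open>1\<close> can be combined to a relation of the same kind and of smaller degree, until the constant
  \<open>0\<close> would specialise to \<open>1\<close>.
\<close>

lemma no_two_sided_relation:
  assumes "y \<noteq> 0" "degree p \<le> n" "degree q \<le> m" "(p, 1) \<in> poly_pairs M" "(q, 1) \<in> poly_pairs M"
    and "poly p y = 0" "poly q (inverse y) = 0"
  shows False
  using assms
proof (induction "n + m" arbitrary: y p q n m rule: less_induct)
  case less
  \<comment> \<open>the situation is symmetric under exchanging \<open>y\<close> and its inverse\<close>
  have *: False if nm: "m \<le> n" and y: "y \<noteq> 0" and deg: "degree p \<le> n" "degree q \<le> m"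
      and pq: "(p, 1) \<in> poly_pairs M" "(q, 1) \<in> poly_pairs M"
      and root: "poly p y = 0" "poly q (inverse y) = 0"
      and IH: "\<And>p q n' m'. n' + m' < n + m \<Longrightarrow> degree p \<le> n' \<Longrightarrow> degree q \<le> m' \<Longrightarrow>
        (p, 1) \<in> poly_pairs M \<Longrightarrow> (q, 1) \<in> poly_pairs M \<Longrightarrow> poly p y = 0 \<Longrightarrow> poly q (inverse y) = 0 \<Longrightarrow> False"
      for y p q n m
  proof (cases n)
    case 0
    then obtain b where "p = [:b:]" using deg(1) by (auto elim: degree_eq_zeroE)
    then have "p = 0" using root(1) by simp
    then have "(0, 1) \<in> M" using pq(1) by (auto simp: poly_pairs_def dest: spec[of _ 0])
    then show False using Mfun by fastforce
  next
    case (Suc n')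
    define Q where "Q = (\<Sum>k\<le>n. monom (coeff q (n - k)) k)"
    define p' where "p' = smult (coeff q 0) p - smult (coeff p n) Q"
    have cQ: "coeff Q k = (if k \<le> n then coeff q (n - k) else 0)" for k
      by (simp add: Q_def coeff_sum)
    have "poly Q y = (\<Sum>k\<le>n. coeff q (n - k) * y ^ k)"
      by (simp add: Q_def poly_sum poly_monom)
    also have "\<dots> = (\<Sum>k\<le>n. coeff q k * y ^ (n - k))"
      by (rule sum.reindex_bij_witness[of _ "\<lambda>k. n - k" "\<lambda>k. n - k"]) auto
    also have "\<dots> = y ^ n * (\<Sum>k\<le>n. coeff q k * inverse y ^ k)"
      unfolding sum_distrib_left
      by (rule sum.cong) (auto simp: y power_diff field_simps)
    also have "\<dots> = 0"
      using poly_as_sum_upto[of q n "inverse y"] deg nm root(2) by simp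
    finally have "poly p' y = 0" using root by (simp add: p'_def)
    moreover have "degree p' \<le> n'"
    proof (rule degree_le, intro allI impI)
      fix i assume "n' < i"
      show "coeff p' i = 0"
      proof (cases "i = n")
        case True
        then show ?thesis by (simp add: p'_def cQ)
      next
        case False
        then have "i > n" using \<open>n' < i\<close> Suc by simp
        then show ?thesis using deg by (simp add: p'_def cQ coeff_eq_0)
      qed
    qed
    moreover have "(p', 1) \<in> poly_pairs M"
      unfolding poly_pairs_def
    proof (intro CollectI case_prodI allI)
      fix i
      have pi: "(coeff p i, coeff 1 i) \<in> M" and q0: "(coeff q 0, 1) \<in> M"
        using pq by (auto simp: poly_pairs_def dest: spec[of _ 0])
      have pn: "(coeff p n, 0) \<in> M"
        using pq Suc by (auto simp: poly_pairs_def one_pCons coeff_pCons dest: spec[of _ n])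
      obtain c where c: "(coeff Q i, c) \<in> M"
        using pq M0 by (cases "i \<le> n") (auto simp: poly_pairs_def cQ)
      from Mdiff[OF Mmult[OF q0 pi] Mmult[OF pn c]]
      show "(coeff p' i, coeff 1 i) \<in> M" by (simp add: p'_def)
    qed
    ultimately show False using IH[of n' m p' q] Suc deg pq root by simp
  qed
  show False
  proof (cases "m \<le> n")
    case True
    show False
      by (rule *[OF True less.prems]) (use less.hyps less.prems(1) in blast)
  next
    case False
    show False
    proof (rule *[of n m "inverse y" q p])
      fix p q n' m'
      assume "n' + m' < m + n" "degree p \<le> n'" "degree q \<le> m'"
        "(p, 1) \<in> poly_pairs M" "(q, 1) \<in> poly_pairs M" "poly p (inverse y) = 0" "poly q (inverse (inverse y)) = 0"
      then show False using less.hyps[of m' n' y q p] less.prems(1) by (simp add: add.commute)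
    qed (use False less.prems in auto)
  qed
qed

text \<open>
  The domain of a maximal partial homomorphism is a valuation ring.
\<close>

lemma maximal_partial_hom_valuation:
  assumes max: "\<And>M'. M' \<in> partial_homs h \<Longrightarrow> M \<subseteq> M' \<Longrightarrow> M' = M"
  shows "y \<in> Domain M \<or> inverse y \<in> Domain M"
proof (rule ccontr)
  assume "\<not> ?thesis"
  then have y: "y \<notin> Domain M" "inverse y \<notin> Domain M" by auto
  have "y \<noteq> 0" using y M0 by auto
  moreover obtain p where "(p, 1) \<in> poly_pairs M \<and> poly p y = 0"
    using maximal_partial_hom_relation[OF max y(1)] by blast
  moreover obtain q where "(q, 1) \<in> poly_pairs M \<and> poly q (inverse y) = 0"
    using maximal_partial_hom_relation[OF max y(2)] by blast
  ultimately show False using no_two_sided_relation[of y p "degree p" q "degree q"] by blast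
qed

text \<open>
  Divisibility in a valuation ring is a total preorder, so one of three elements divides the others; dividing
  by it normalises a direction before it is specialised.
\<close>

lemma maximal_partial_hom_quotients:
  assumes max: "\<And>M'. M' \<in> partial_homs h \<Longrightarrow> M \<subseteq> M' \<Longrightarrow> M' = M"
    and w: "(w1, w2, w3) \<noteq> (0, 0, 0)"
  obtains u where "u \<in> {w1, w2, w3}" "u \<noteq> 0" "w1 / u \<in> Domain M" "w2 / u \<in> Domain M" "w3 / u \<in> Domain M"
proof -
  define le where "le a b \<longleftrightarrow> b \<noteq> 0 \<and> a / b \<in> Domain M" for a b
  have tot: "le a b \<or> le b a" if "a \<noteq> 0 \<or> b \<noteq> 0" for a b
    using that maximal_partial_hom_valuation[OF max, of "a / b"] M0 by (auto simp: le_def)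
  have trans: "le a c" if ab: "le a b" and bc: "le b c" for a b c
  proof -
    obtain r s where "(a / b, r) \<in> M" "(b / c, s) \<in> M" using ab bc by (auto simp: le_def)
    from Mmult[OF this] show ?thesis using ab bc by (auto simp: le_def)
  qed
  have refl: "le a a" if "a \<noteq> 0" for a using that M1 by (auto simp: le_def)
  have z: "le 0 a" if "a \<noteq> 0" for a using that M0 by (auto simp: le_def)
  have two: "\<exists>u \<in> {a, b}. le a u \<and> le b u" if ab: "a \<noteq> 0 \<or> b \<noteq> 0" for a b
    using tot[OF ab] refl[of a] refl[of b] by (auto simp: le_def)
  have "\<exists>u \<in> {w1, w2, w3}. le w1 u \<and> le w2 u \<and> le w3 u"
  proof (cases "w1 \<noteq> 0 \<or> w2 \<noteq> 0")
    case True
    from two[OF this] obtain u where u: "u \<in> {w1, w2}" "le w1 u" "le w2 u" by blast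
    then have "u \<noteq> 0 \<or> w3 \<noteq> 0" by (auto simp: le_def)
    from two[OF this] obtain v where "v \<in> {u, w3}" "le u v" "le w3 v" by blast
    then show ?thesis using u trans by blast
  next
    case False
    then show ?thesis using w z refl[of w3] by auto
  qed
  then show ?thesis using that unfolding le_def by blast
qed

end

lemma maximal_partial_hom_exists:
  assumes "M0 \<in> partial_homs h"
  obtains M where "M \<in> partial_homs h" "M0 \<subseteq> M" "\<And>M'. M' \<in> partial_homs h \<Longrightarrow> M \<subseteq> M' \<Longrightarrow> M' = M"
proof -
  define A where "A = {M. M \<in> partial_homs h \<and> M0 \<subseteq> M}"
  have "\<exists>M\<in>A. \<forall>N\<in>A. M \<subseteq> N \<longrightarrow> N = M"
  proof (rule subset_Zorn_nonempty)
    show "A \<noteq> {}" using assms by (auto simp: A_def)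
    fix C assume C: "C \<noteq> {}" "subset.chain A C"
    then have el: "\<And>M. M \<in> C \<Longrightarrow> M \<in> partial_homs h \<and> M0 \<subseteq> M"
      and ch: "\<And>M N. M \<in> C \<Longrightarrow> N \<in> C \<Longrightarrow> M \<subseteq> N \<or> N \<subseteq> M"
      by (auto simp: subset_chain_def A_def)
    obtain N where N: "N \<in> C" using C by auto
    have "\<Union> C \<in> partial_homs h"
      unfolding partial_homs_def
    proof (intro CollectI conjI allI impI)
      fix r show "(h r, of_real r) \<in> \<Union> C" using N el[OF N] by (auto simp: partial_homs_def)
    next
      fix a c b d assume "(a, c) \<in> \<Union> C" "(b, d) \<in> \<Union> C"
      then obtain B1 B2 where "B1 \<in> C" "(a, c) \<in> B1" "B2 \<in> C" "(b, d) \<in> B2" by blast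
      then obtain B where B: "B \<in> C" "(a, c) \<in> B" "(b, d) \<in> B" using ch[of B1 B2] by blast
      then have "(a + b, c + d) \<in> B" "(a * b, c * d) \<in> B" using el[OF B(1)] by (auto simp: partial_homs_def)
      then show "(a + b, c + d) \<in> \<Union> C" "(a * b, c * d) \<in> \<Union> C" using B by auto
    next
      fix c assume "(0, c) \<in> \<Union> C"
      then show "c = 0" using el by (auto simp: partial_homs_def)
    qed
    then show "\<Union> C \<in> A" using N el[OF N] by (auto simp: A_def)
  qed
  then show ?thesis using that by (auto simp: A_def)
qed

text \<open>
  The set of lines through a point is projective, hence complete: if the generic point \<open>x\<close> of the surface
  specialises to \<open>P\<close>, then a direction of a line through the generic point specialises along, to a
  nonzero direction at \<open>P\<close>.  The place that extends the specialisation makes this precise, and spares any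
  argument about points of the closure that are not in the image of the parametrization.
\<close>

theorem specialise_direction:
  fixes h :: "real \<Rightarrow> 'k::field" and x1 x2 x3 w1 w2 w3 :: 'k and P1 P2 P3 :: complex
  assumes h: "comm_ring_hom h"
    and spec: "\<And>F. ev3 h F (x1, x2, x3) = 0 \<Longrightarrow> ev3 of_real F (P1, P2, P3) = 0"
    and w: "(w1, w2, w3) \<noteq> (0, 0, 0)"
  obtains v1 v2 v3 :: complex where "(v1, v2, v3) \<noteq> (0, 0, 0)"
    "\<And>F l. (\<And>l. ev3 h F (x1 + l * w1, x2 + l * w2, x3 + l * w3) = 0) \<Longrightarrow>
       ev3 of_real F (P1 + of_real l * v1, P2 + of_real l * v2, P3 + of_real l * v3) = 0"
proof -
  have r: "comm_ring_hom (of_real :: real \<Rightarrow> complex)" by (rule comm_ring_homI) auto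
  define M0 where "M0 = {(ev3 h F (x1, x2, x3), ev3 of_real F (P1, P2, P3)) |F. True}"
  have "M0 \<in> partial_homs h"
    unfolding partial_homs_def
  proof (intro CollectI conjI allI impI)
    fix c
    show "(h c, of_real c) \<in> M0" unfolding M0_def
      using ev3_simps(3)[OF h, symmetric, of c] ev3_simps(3)[OF r, symmetric, of c] by fast
  next
    fix a c b d assume "(a, c) \<in> M0" "(b, d) \<in> M0"
    then obtain F G where "a = ev3 h F (x1, x2, x3)" "c = ev3 of_real F (P1, P2, P3)"
      "b = ev3 h G (x1, x2, x3)" "d = ev3 of_real G (P1, P2, P3)"
      unfolding M0_def by auto
    then show "(a + b, c + d) \<in> M0" "(a * b, c * d) \<in> M0"
      unfolding M0_def by (auto simp: ev3_simps(1,2)[OF h, symmetric] ev3_simps(1,2)[OF r, symmetric])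
  qed (auto simp: M0_def intro: spec)
  then obtain M where M: "M \<in> partial_homs h" "M0 \<subseteq> M" "\<And>M'. M' \<in> partial_homs h \<Longrightarrow> M \<subseteq> M' \<Longrightarrow> M' = M"
    using maximal_partial_hom_exists by blast
  obtain u where u: "u \<in> {w1, w2, w3}" "u \<noteq> 0" "w1 / u \<in> Domain M" "w2 / u \<in> Domain M" "w3 / u \<in> Domain M"
    using maximal_partial_hom_quotients[OF h M(1) M(3) w] by blast
  then obtain v1 v2 v3 where v: "(w1 / u, v1) \<in> M" "(w2 / u, v2) \<in> M" "(w3 / u, v3) \<in> M" by auto
  have Mr: "\<And>r. (h r, of_real r) \<in> M" and Mfun: "\<And>c. (0, c) \<in> M \<Longrightarrow> c = 0"
    and Madd: "\<And>a b c d. (a, c) \<in> M \<Longrightarrow> (b, d) \<in> M \<Longrightarrow> (a + b, c + d) \<in> M"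
    and Mmult: "\<And>a b c d. (a, c) \<in> M \<Longrightarrow> (b, d) \<in> M \<Longrightarrow> (a * b, c * d) \<in> M"
    using M(1) by (auto simp: partial_homs_def)
  have one: "(1, 0) \<notin> M"
    using Madd[of 1 0 "-1" "-1"] Mr[of "-1"] Mfun by (force simp: hom_props[OF h])
  have "(v1, v2, v3) \<noteq> (0, 0, 0)" using u v one by auto
  moreover have "ev3 of_real F (P1 + of_real l * v1, P2 + of_real l * v2, P3 + of_real l * v3) = 0"
    if F: "\<And>l. ev3 h F (x1 + l * w1, x2 + l * w2, x3 + l * w3) = 0" for F l
  proof -
    have "(x1, P1) \<in> M0" "(x2, P2) \<in> M0" "(x3, P3) \<in> M0"
      unfolding M0_def
      by (intro CollectI exI[of _ "[:[:[:0, 1:]:]:]"] exI[of _ "[:[:0, 1:]:]"] exI[of _ "[:0, 1:]"],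
          simp add: ev3_simps[OF h] ev3_simps[OF r])+
    then have x: "(x1, P1) \<in> M" "(x2, P2) \<in> M" "(x3, P3) \<in> M" using M(2) by auto
    have "(ev3 h F (x1 + h l * (w1 / u), x2 + h l * (w2 / u), x3 + h l * (w3 / u)),
       ev3 of_real F (P1 + of_real l * v1, P2 + of_real l * v2, P3 + of_real l * v3)) \<in> M"
      by (intro partial_hom_ev3[OF h M(1)] Madd Mmult x v Mr)
    then show ?thesis using F[of "h l / u"] Mfun by simp
  qed
  ultimately show ?thesis using that by blast
qed

section \<open>Lines osculating a surface to infinite order\<close>

text \<open>
  Let \<open>d\<close> differentiate along a curve with tangent \<open>w\<close>, and suppose that \<open>d w\<close> is proportional to
  \<open>w\<close>, which says that the curve is straight.  Let \<open>\<Phi>\<close> be the polynomial \<open>F (x + l w)\<close> in \<open>l\<close>.  Then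
  \<open>d \<Phi> = (A + lam l) \<Phi>'\<close>: both sides are derivations in \<open>F\<close> and they agree on the coordinates.
  Comparing coefficients, the vanishing of one coefficient forces that of the next one; the lowest one is
  \<open>F x = 0\<close>.  So the whole tangent line lies in the surface, and no differential equation has to be
  solved.  The homomorphism \<open>e\<close> allows \<open>w\<close> to involve an algebraic element, at which \<open>e\<close> evaluates.
\<close>

theorem osculating_line:
  fixes e :: "'a::comm_ring_1 \<Rightarrow> 'k::field_char_0" and d :: "'a \<Rightarrow> 'a"
    and h :: "real \<Rightarrow> 'a"
  assumes e: "comm_ring_hom e" and d: "derivation d" and h: "comm_ring_hom h"
    and ker: "\<And>a. e a = 0 \<Longrightarrow> e (d a) = 0" and const: "\<And>r. d (h r) = 0"
    and x: "e (d x1) = A * e w1" "e (d x2) = A * e w2" "e (d x3) = A * e w3"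
    and w: "e (d w1) = lam * e w1" "e (d w2) = lam * e w2" "e (d w3) = lam * e w3"
    and A: "A \<noteq> 0" and F: "e (ev3 h F (x1, x2, x3)) = 0"
  shows "ev3 (\<lambda>r. e (h r)) F (e x1 + l * e w1, e x2 + l * e w2, e x3 + l * e w3) = 0"
proof -
  define \<Phi> where "\<Phi> = (\<lambda>F. ev3 (\<lambda>r. [:h r:]) F ([:x1, w1:], [:x2, w2:], [:x3, w3:]))"
  define d' where "d' = (\<lambda>a. e (d a))"
  note [simp] = hom_props[OF e] hom_props[OF h] const
  have d': "derivation_along e d'" unfolding d'_def by (rule derivation_along_o[OF e d])
  have d'0: "d' 0 = 0" using derivation_along_props(3)[OF e d'] .
  have H: "comm_ring_hom (\<lambda>r. [:h r:])" by (rule comm_ring_homI) (auto simp: one_pCons)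
  have e': "comm_ring_hom (map_poly e)" by (rule comm_ring_hom_map_poly[OF e])
  note dm = derivation_along_props(1,2)[OF e' derivation_along_map_poly[OF e d']]
  have gen: "map_poly d' [:a, b:] = [:A, lam:] * pderiv (map_poly e [:a, b:])"
    if "e (d a) = A * e b" "e (d b) = lam * e b" for a b
  proof -
    have "d' a = A * e b" "d' b = lam * e b" using that by (simp_all add: d'_def)
    then show ?thesis by (simp add: map_poly_pCons0 d'0 pderiv_pCons)
  qed
  have key: "map_poly d' (\<Phi> F) = [:A, lam:] * pderiv (map_poly e (\<Phi> F))" for F
    unfolding \<Phi>_def
  proof (induction F rule: poly3_induct)
    case (const c)
    show ?case by (simp add: ev3_simps[OF H] map_poly_pCons0 d'0 pderiv_pCons)
        (simp add: d'_def)
  next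
    case X
    show ?case by (simp add: ev3_simps[OF H] gen x w)
  next
    case Y
    show ?case by (simp add: ev3_simps[OF H] gen x w)
  next
    case Z
    show ?case by (simp add: ev3_simps[OF H] gen x w)
  next
    case (add F G)
    then show ?case
      by (simp only: ev3_simps[OF H] dm hom_props[OF e'] pderiv_add ring_distribs)
  next
    case (mult F G)
    then show ?case
      by (simp only: ev3_simps[OF H] dm hom_props[OF e'] pderiv_mult ring_distribs mult.left_commute ac_simps)
  qed
  have ev0: "comm_ring_hom (\<lambda>p::'a poly. poly p 0)" by (rule comm_ring_homI) auto
  have coeffs: "e (coeff (\<Phi> F) k) = 0" for k
  proof (induction k)
    case 0
    have "coeff (\<Phi> F) 0 = poly (\<Phi> F) 0" by (simp add: poly_0_coeff_0)
    also have "\<dots> = ev3 h F (x1, x2, x3)" unfolding \<Phi>_def by (simp add: hom_ev3[OF H ev0])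
    finally show ?case using F by simp
  next
    case (Suc k)
    have "d' (coeff (\<Phi> F) k) = coeff (map_poly d' (\<Phi> F)) k"
      by (simp add: coeff_map_poly d'0)
    also have "\<dots> = A * (of_nat (Suc k) * e (coeff (\<Phi> F) (Suc k))) + lam * (of_nat k * e (coeff (\<Phi> F) k))"
      unfolding key by (cases k) (simp_all add: coeff_pderiv coeff_map_poly coeff_pCons)
    finally show ?case using ker[OF Suc] A Suc by (simp add: d'_def del: of_nat_Suc)
  qed
  then have "map_poly e (\<Phi> F) = 0" by (intro poly_eqI) (simp add: coeff_map_poly)
  moreover have ev: "comm_ring_hom (\<lambda>p. poly (map_poly e p) l)"
    by (rule comm_ring_homI) (auto simp: hom_props[OF e'])
  have "poly (map_poly e (\<Phi> F)) l = ev3 (\<lambda>r. e (h r)) F (e x1 + l * e w1, e x2 + l * e w2, e x3 + l * e w3)"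
    unfolding \<Phi>_def by (simp add: hom_ev3[OF H ev] map_poly_pCons0)
  ultimately show ?thesis by simp
qed

section \<open>The differential field of rational functions\<close>

lemma Fract_numer_denom: "Fract (numer r) (denom r) = r" and denom_nonzero [simp]: "denom r \<noteq> 0"
  and coprime_numer_denom: "coprime (numer r) (denom r)" and numer_eq_0_iff [simp]: "numer r = 0 \<longleftrightarrow> r = 0"
  by (simp_all add: numer_def denom_def coprime_quot_of_fract)

lemma numer_denom_Fract:
  assumes "q \<noteq> 0"
  shows "numer (Fract p q) * q = p * denom (Fract p q)"
proof -
  have "Fract (numer (Fract p q)) (denom (Fract p q)) = Fract p q" by (rule Fract_numer_denom)
  then show ?thesis using assms by (simp add: eq_fract)
qed

lemma denom_Fract_dvd:
  assumes "q \<noteq> 0"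
  shows "denom (Fract p q) dvd q"
proof -
  have "denom (Fract p q) dvd numer (Fract p q) * q"
    using numer_denom_Fract[OF assms, of p] by simp
  then show ?thesis
    using coprime_numer_denom[of "Fract p q"] by (simp add: coprime_commute coprime_dvd_mult_right_iff)
qed

lemma ratfun_quotient: "r = to_fract (numer r) / to_fract (denom r)"
  by (metis Fract_conv_to_fract Fract_numer_denom)

context
  fixes D :: "real poly poly \<Rightarrow> real poly poly"
  assumes D: "derivation D"
begin

private lemmas Dp [simp] = derivation_props[OF D]

lemma fract_deriv_Fract:
  assumes q: "q \<noteq> 0"
  shows "fract_deriv D (Fract p q) = Fract (D p * q - p * D q) (q ^ 2)"
proof -
  define n m where "n = numer (Fract p q)" and "m = denom (Fract p q)"
  have m: "m \<noteq> 0" by (simp add: m_def)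
  have nm: "n * q = p * m" unfolding n_def m_def by (rule numer_denom_Fract[OF q])
  have "D (n * q) = D (p * m)" by (simp only: nm)
  then have Dnm: "D p * m = n * D q + D n * q - p * D m" by (simp add: algebra_simps)
  have "(D p * q - p * D q) * m ^ 2 = (D p * m) * q * m - (p * m) * D q * m" by (simp add: algebra_simps power2_eq_square)
  also have "\<dots> = (n * D q + D n * q - p * D m) * q * m - (n * q) * D q * m" by (simp only: Dnm nm)
  also have "\<dots> = D n * q * q * m - (p * m) * D m * q" by (simp add: algebra_simps)
  also have "\<dots> = D n * q * q * m - (n * q) * D m * q" by (simp only: nm)
  also have "\<dots> = (D n * m - n * D m) * q ^ 2" by (simp add: algebra_simps power2_eq_square)
  finally show ?thesis
    unfolding fract_deriv_def n_def[symmetric] m_def[symmetric] using q m by (simp add: eq_fract)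
qed

lemma fract_deriv_to_fract: "fract_deriv D (to_fract p) = to_fract (D p)"
  unfolding to_fract_def by (simp add: fract_deriv_Fract)

lemma derivation_fract_deriv: "derivation (fract_deriv D)"
  unfolding derivation_along_def
proof (intro conjI allI)
  fix a b :: ratfun
  obtain p q where a: "a = Fract p q" "q \<noteq> 0" by (cases a)
  obtain r s where b: "b = Fract r s" "s \<noteq> 0" by (cases b)
  show "fract_deriv D (a + b) = fract_deriv D a + fract_deriv D b"
    using a b by (simp add: fract_deriv_Fract eq_fract) (simp add: algebra_simps power2_eq_square)
  show "fract_deriv D (a * b) = a * fract_deriv D b + fract_deriv D a * b"
    using a b by (simp add: fract_deriv_Fract eq_fract) (simp add: algebra_simps power2_eq_square)
qed

end

lemma derivation_D_t: "derivation D_t" and derivation_D_s: "derivation D_s"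
  and D_t_to_fract: "D_t (to_fract p) = to_fract (map_poly pderiv p)"
  and D_s_to_fract: "D_s (to_fract p) = to_fract (pderiv p)"
  unfolding D_t_def D_s_def
  by (simp_all add: derivation_fract_deriv fract_deriv_to_fract derivation_pderiv derivation_map_poly)

lemmas D_simps = derivation_props[OF derivation_D_t] derivation_props[OF derivation_D_s]

lemma derivation_quotient_eq_0:
  fixes d :: "ratfun \<Rightarrow> ratfun"
  assumes d: "derivation d" and z: "\<And>p. d (to_fract p) = 0"
  shows "d r = 0"
proof -
  have "to_fract (denom r) * r = to_fract (numer r)"
    by (subst (2) ratfun_quotient) simp
  then have "d (to_fract (denom r) * r) = 0" using z by simp
  then show ?thesis by (simp add: derivation_props[OF d] z)
qed

definition const_fun :: "real \<Rightarrow> ratfun" where "const_fun r = to_fract [:[:r:]:]"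
definition t_fun :: ratfun where "t_fun = to_fract [:[:0, 1:]:]"
definition s_fun :: ratfun where "s_fun = to_fract [:0, 1:]"

lemma hom_to_fract: "comm_ring_hom to_fract"
  by (rule comm_ring_homI) auto

lemma hom_const_fun: "comm_ring_hom const_fun"
  by (rule comm_ring_homI) (auto simp: const_fun_def one_pCons[symmetric] to_fract_add[symmetric] to_fract_mult[symmetric] simp del: to_fract_add to_fract_mult)

lemma D_consts [simp]:
  "D_t (const_fun r) = 0" "D_s (const_fun r) = 0" "D_t t_fun = 1" "D_s t_fun = 0" "D_t s_fun = 0" "D_s s_fun = 1"
  by (simp_all add: const_fun_def t_fun_def s_fun_def D_t_to_fract D_s_to_fract map_poly_pCons0 pderiv_pCons one_pCons[symmetric]
      derivation_props(4)[OF derivation_map_poly[OF derivation_pderiv]])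

lemma const_fun_eq_0_iff [simp]: "const_fun c = 0 \<longleftrightarrow> c = 0"
  by (simp add: const_fun_def)

lemma derivation_eq_0:
  fixes d :: "ratfun \<Rightarrow> ratfun"
  assumes d: "derivation d" and "\<And>c. d (const_fun c) = 0" "d t_fun = 0" "d s_fun = 0"
  shows "d r = 0"
proof (rule derivation_quotient_eq_0[OF d])
  fix p show "d (to_fract p) = 0"
    by (induction p rule: poly2_induct)
       (use assms(2-4) in \<open>simp_all add: derivation_props[OF d] const_fun_def t_fun_def s_fun_def\<close>)
qed

lemma D_t_D_s: "D_t (D_s r) = D_s (D_t r)"
proof -
  have "derivation (\<lambda>r. D_t (D_s r) - D_s (D_t r))"
    unfolding derivation_along_def by (simp add: D_simps algebra_simps)
  from derivation_eq_0[OF this, of r] show ?thesis by (simp add: D_simps)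
qed

lemma chain_rule:
  fixes d :: "ratfun \<Rightarrow> ratfun"
  assumes d: "derivation d" and c: "\<And>c. d (const_fun c) = 0"
  shows "d (ev2 const_fun G a b) = ev2 const_fun (map_poly pderiv G) a b * d a + ev2 const_fun (pderiv G) a b * d b"
proof -
  note h = hom_const_fun
  note dp = derivation_props[OF derivation_pderiv] derivation_props[OF derivation_map_poly[OF derivation_pderiv]]
  have e1: "ev2 const_fun [:1:] a b = 1" by (simp add: one_pCons[symmetric] ev2_simps[OF h])
  show ?thesis
  proof (induction G rule: poly2_induct)
    case (const r)
    show ?case by (simp add: ev2_simps[OF h] c map_poly_pCons0 pderiv_pCons)
  next
    case X
    show ?case by (simp add: ev2_simps[OF h] c map_poly_pCons0 pderiv_pCons hom_props[OF h])
  next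
    case Y
    show ?case by (simp add: ev2_simps[OF h] c map_poly_pCons0 pderiv_pCons e1)
  next
    case (add p q)
    then show ?case by (simp add: ev2_simps[OF h] derivation_props[OF d] dp algebra_simps)
  next
    case (mult p q)
    then show ?case by (simp add: ev2_simps[OF h] derivation_props[OF d] dp algebra_simps)
  qed
qed

lemma derivation_ev3_eq_0:
  fixes d :: "ratfun \<Rightarrow> ratfun"
  assumes d: "derivation d" and c: "\<And>c. d (const_fun c) = 0" and x: "d x1 = 0" "d x2 = 0" "d x3 = 0"
  shows "d (ev3 const_fun F (x1, x2, x3)) = 0"
  by (induction F rule: poly3_induct)
     (simp_all add: ev3_simps[OF hom_const_fun] derivation_props[OF d] c x)

text \<open>
  The chain rule and the invertible Jacobian show that both partial derivatives of a relation are again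
  relations; they have smaller total degree.
\<close>

lemma algebraically_independent_if_jacobian:
  fixes a b :: ratfun
  assumes jac: "D_t a * D_s b - D_t b * D_s a \<noteq> 0" and G: "ev2 const_fun G a b = 0"
  shows "G = 0"
proof -
  have key: "G = 0" if "\<And>i j. coeff (coeff G j) i \<noteq> 0 \<Longrightarrow> i + j \<le> n" "ev2 const_fun G a b = 0" for n G
    using that
  proof (induction n arbitrary: G)
    case 0
    have "G = [:[:coeff (coeff G 0) 0:]:]"
    proof (intro poly_eqI)
      fix j i
      show "coeff (coeff G j) i = coeff (coeff [:[:coeff (coeff G 0) 0:]:] j) i"
        using 0(1)[of j i] by (cases i; cases j) (auto simp: coeff_pCons)
    qed
    then obtain c where c: "G = [:[:c:]:]" by blast
    then show ?case using 0(2) by (simp add: ev2_simps[OF hom_const_fun])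
  next
    case (Suc n)
    let ?p = "ev2 const_fun (map_poly pderiv G) a b" and ?q = "ev2 const_fun (pderiv G) a b"
    have "?p * D_t a + ?q * D_t b = 0" "?p * D_s a + ?q * D_s b = 0"
      using chain_rule[OF derivation_D_t, of G a b] chain_rule[OF derivation_D_s, of G a b] Suc.prems(2)
      by (simp_all add: D_simps)
    moreover have "?p * (D_t a * D_s b - D_t b * D_s a)
        = (?p * D_t a + ?q * D_t b) * D_s b - (?p * D_s a + ?q * D_s b) * D_t b"
      "?q * (D_t a * D_s b - D_t b * D_s a)
        = (?p * D_s a + ?q * D_s b) * D_t a - (?p * D_t a + ?q * D_t b) * D_s a"
      by (simp_all add: algebra_simps)
    ultimately have "?p * (D_t a * D_s b - D_t b * D_s a) = 0" "?q * (D_t a * D_s b - D_t b * D_s a) = 0"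
      by simp_all
    then have pq: "?p = 0" "?q = 0" using jac by auto
    have p0: "map_poly pderiv G = 0"
    proof (rule Suc.IH[OF _ pq(1)])
      fix i j assume "coeff (coeff (map_poly pderiv G) j) i \<noteq> 0"
      then have "coeff (coeff G j) (Suc i) \<noteq> 0" by (auto simp: coeff_map_poly coeff_pderiv)
      then show "i + j \<le> n" using Suc.prems(1)[of j "Suc i"] by simp
    qed
    have q0: "pderiv G = 0"
    proof (rule Suc.IH[OF _ pq(2)])
      fix i j assume "coeff (coeff (pderiv G) j) i \<noteq> 0"
      then have "coeff (coeff G (Suc j)) i \<noteq> 0" by (auto simp: coeff_pderiv of_nat_poly simp del: of_nat_Suc)
      then show "i + j \<le> n" using Suc.prems(1)[of "Suc j" i] by simp
    qed
    have low: "coeff (coeff G j) i = 0" if "i + j > 0" for i j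
    proof (cases j)
      case 0
      then obtain i' where i: "i = Suc i'" using \<open>i + j > 0\<close> by (cases i) auto
      have "coeff (coeff (map_poly pderiv G) j) i' = 0" by (simp add: p0)
      then show ?thesis by (simp add: i coeff_map_poly coeff_pderiv del: of_nat_Suc)
    next
      case (Suc j')
      have "coeff (pderiv G) j' = 0" by (simp add: q0)
      then show ?thesis by (simp add: Suc coeff_pderiv del: of_nat_Suc)
    qed
    show ?case
    proof (rule Suc.IH[OF _ Suc.prems(2)])
      fix i j assume "coeff (coeff G j) i \<noteq> 0"
      then have "\<not> i + j > 0" using low[of i j] by blast
      then show "i + j \<le> n" by simp
    qed
  qed
  obtain n where n: "\<And>i j. coeff (coeff G j) i \<noteq> 0 \<Longrightarrow> i + j \<le> n"
  proof (rule that)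
    fix i j assume nz: "coeff (coeff G j) i \<noteq> 0"
    then have "coeff G j \<noteq> 0" by (metis coeff_0)
    then have j: "j \<le> degree G" by (rule le_degree)
    have "i \<le> degree (coeff G j)" using nz by (rule le_degree)
    also have "\<dots> \<le> (MAX j\<in>{..degree G}. degree (coeff G j))" by (rule Max_ge) (simp_all add: j)
    finally show "i + j \<le> (MAX j\<in>{..degree G}. degree (coeff G j)) + degree G" using j by simp
  qed
  show ?thesis by (rule key[OF n G])
qed

lemma dvd_pderiv_imp_zero:
  fixes p :: "'a::{idom,semiring_char_0} poly"
  assumes "p dvd pderiv p"
  shows "pderiv p = 0"
proof (rule ccontr)
  assume nz: "pderiv p \<noteq> 0"
  then have "degree p \<le> degree (pderiv p)" using assms by (rule dvd_imp_degree_le[rotated])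
  then have "degree p = 0" by (simp add: degree_pderiv)
  then show False using nz by (simp add: pderiv_eq_0_iff)
qed

lemma pderiv_zeroE:
  fixes p :: "'a::{idom,semiring_char_0} poly"
  assumes "pderiv p = 0"
  obtains c where "p = [:c:]"
  using assms by (auto simp: pderiv_eq_0_iff elim: degree_eq_zeroE)

text \<open>
  In lowest terms, the denominator divides its own derivatives.  Those have smaller degree, so they vanish,
  and with them the derivatives of the numerator.
\<close>

lemma constant_if_derivatives_vanish:
  assumes t: "D_t r = 0" and s: "D_s r = 0"
  obtains c where "r = const_fun c"
proof -
  define n d where "n = numer r" and "d = denom r"
  have d0: "d \<noteq> 0" and cop: "coprime n d" by (simp_all add: d_def n_def coprime_numer_denom)
  have *: "D d = 0 \<and> D n = 0" if "fract_deriv D r = 0" and D: "d dvd D d \<Longrightarrow> D d = 0" for D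
  proof -
    have "D n * d = n * D d"
      using that(1) d0 by (simp add: fract_deriv_def n_def[symmetric] d_def[symmetric] Fract_conv_to_fract to_fract_mult[symmetric] del: to_fract_mult)
    moreover from this have "d dvd n * D d" by (metis dvd_triv_right)
    then have "d dvd D d" using cop by (simp add: coprime_commute coprime_dvd_mult_right_iff)
    ultimately show ?thesis using D d0 by auto
  qed
  have S: "pderiv d = 0" "pderiv n = 0" using *[of pderiv] s dvd_pderiv_imp_zero[of d] by (auto simp: D_s_def)
  have "map_poly pderiv d = 0" if dv: "d dvd map_poly pderiv d"
  proof -
    obtain d' where d': "d = [:d':]" using S(1) by (rule pderiv_zeroE)
    then have "d' dvd pderiv d'"
      using dv by (simp add: map_poly_pCons0)
    then have "pderiv d' = 0" by (rule dvd_pderiv_imp_zero)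
    then show ?thesis by (simp add: d' map_poly_pCons0)
  qed
  then have T: "map_poly pderiv d = 0" "map_poly pderiv n = 0" using *[of "map_poly pderiv"] t by (auto simp: D_t_def)
  have c: "\<exists>c. p = [:[:c:]:]" if p: "pderiv p = 0" "map_poly pderiv p = 0" for p :: "real poly poly"
  proof -
    obtain q where q: "p = [:q:]" using p(1) by (rule pderiv_zeroE)
    then have "pderiv q = 0" using p(2) by (simp add: map_poly_pCons0)
    then obtain c where "q = [:c:]" by (rule pderiv_zeroE)
    then show ?thesis using q by blast
  qed
  obtain a where a: "n = [:[:a:]:]" using c[OF S(2) T(2)] by blast
  obtain b where b: "d = [:[:b:]:]" using c[OF S(1) T(1)] by blast
  have r: "Fract n d = r" unfolding n_def d_def by (rule Fract_numer_denom)
  have b0: "b \<noteq> 0" using d0 b by simp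
  have "Fract n d = const_fun (a / b)"
    unfolding a b const_fun_def to_fract_def using b0 by (simp add: eq_fract)
  then show ?thesis using r that[of "a / b"] by simp
qed

section \<open>Evaluating rational functions at points\<close>

lemma hom_of_real: "comm_ring_hom (of_real :: real \<Rightarrow> 'a::real_field)"
  by (rule comm_ring_homI) auto

abbreviation regular :: "ratfun \<Rightarrow> 'a::real_field \<Rightarrow> 'a \<Rightarrow> bool" where
  "regular r t s \<equiv> ev_den r t s \<noteq> 0"

definition val :: "ratfun \<Rightarrow> 'a::real_field \<Rightarrow> 'a \<Rightarrow> 'a" where
  "val r t s = ev_num r t s / ev_den r t s"

lemma ev_num_ev2: "ev_num r t s = ev2 of_real (numer r) t s"
  and ev_den_ev2: "ev_den r t s = ev2 of_real (denom r) t s"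
  by (simp_all add: ev_num_def ev_den_def ev2_def)

text \<open>
  Regularity can be read off any representation with nonvanishing denominator, since the reduced denominator
  divides it.  So the functions regular at a point form a ring, on which \<open>val\<close> is a
  homomorphism.
\<close>

lemma regular_val_Fract:
  fixes t s :: "'a::real_field"
  assumes q: "ev2 of_real q t s \<noteq> 0"
  shows "regular (Fract p q) t s \<and> val (Fract p q) t s = ev2 of_real p t s / ev2 of_real q t s"
proof -
  note h = ev2_simps[OF hom_of_real]
  have q0: "q \<noteq> 0" using q by (auto simp: h)
  obtain k where k: "q = denom (Fract p q) * k" using denom_Fract_dvd[OF q0] by (auto elim: dvdE)
  have "ev2 of_real (denom (Fract p q) * k) t s \<noteq> 0" using q k by metis
  then have d: "ev_den (Fract p q) t s \<noteq> 0" by (simp add: ev_den_ev2 h)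
  have "ev2 of_real (numer (Fract p q) * q) t s = ev2 of_real (p * denom (Fract p q)) t s"
    by (simp only: numer_denom_Fract[OF q0])
  then have "ev_num (Fract p q) t s * ev2 of_real q t s = ev2 of_real p t s * ev_den (Fract p q) t s"
    by (simp add: ev_num_ev2 ev_den_ev2 h)
  then show ?thesis using d q by (simp add: val_def field_simps)
qed

lemma val_to_fract:
  fixes t s :: "'a::real_field"
  shows "regular (to_fract p) t s" "val (to_fract p) t s = ev2 of_real p t s"
  using regular_val_Fract[of 1 t s p]
  by (simp_all add: to_fract_def ev2_simps[OF hom_of_real])

context
  fixes t s :: "'a::real_field"
begin

private lemmas h = ev2_simps[OF hom_of_real]

lemma regular_val_add:
  assumes "regular a t s" "regular b t s"
  shows "regular (a + b) t s \<and> val (a + b) t s = val a t s + val b t s"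
proof -
  have "a + b = Fract (numer a * denom b + numer b * denom a) (denom a * denom b)"
    by (metis Fract_numer_denom add_fract denom_nonzero)
  then show ?thesis
    using assms regular_val_Fract[of "denom a * denom b" t s "numer a * denom b + numer b * denom a"]
    by (simp add: h ev_den_ev2[symmetric] ev_num_ev2[symmetric]) (simp add: val_def field_simps)
qed

lemma regular_val_mult:
  assumes "regular a t s" "regular b t s"
  shows "regular (a * b) t s \<and> val (a * b) t s = val a t s * val b t s"
proof -
  have "a * b = Fract (numer a * numer b) (denom a * denom b)"
    by (metis Fract_numer_denom mult_fract)
  then show ?thesis
    using assms regular_val_Fract[of "denom a * denom b" t s "numer a * numer b"]
    by (simp add: h ev_den_ev2[symmetric] ev_num_ev2[symmetric]) (simp add: val_def field_simps)
qed

lemma regular_val_inverse: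
  assumes "regular a t s" "val a t s \<noteq> 0"
  shows "regular (inverse a) t s \<and> val (inverse a) t s = inverse (val a t s)"
proof -
  have "inverse a = Fract (denom a) (numer a)"
    by (metis Fract_numer_denom inverse_fract)
  then show ?thesis
    using assms regular_val_Fract[of "numer a" t s "denom a"]
    by (simp add: ev_den_ev2[symmetric] ev_num_ev2[symmetric] val_def)
qed

lemma regular_val_const_fun: "regular (const_fun c) t s \<and> val (const_fun c) t s = of_real c"
  by (simp add: const_fun_def val_to_fract h)

lemma regular_const_fun [simp]: "regular (const_fun c) t s"
  and val_const_fun [simp]: "val (const_fun c) t s = of_real c"
  using regular_val_const_fun by auto

lemma regular_0 [simp]: "regular 0 t s" and val_0 [simp]: "val 0 t s = 0"
  and regular_1 [simp]: "regular 1 t s" and val_1 [simp]: "val 1 t s = 1"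
  using val_to_fract[of 0 t s] val_to_fract[of 1 t s] by (simp_all add: h)

lemma regular_add [simp]: "regular a t s \<Longrightarrow> regular b t s \<Longrightarrow> regular (a + b) t s"
  and val_add: "regular a t s \<Longrightarrow> regular b t s \<Longrightarrow> val (a + b) t s = val a t s + val b t s"
  using regular_val_add by auto

lemma regular_mult [simp]: "regular a t s \<Longrightarrow> regular b t s \<Longrightarrow> regular (a * b) t s"
  and val_mult: "regular a t s \<Longrightarrow> regular b t s \<Longrightarrow> val (a * b) t s = val a t s * val b t s"
  using regular_val_mult by auto

lemma regular_uminus [simp]: "regular a t s \<Longrightarrow> regular (- a) t s"
  and val_uminus: "regular a t s \<Longrightarrow> val (- a) t s = - val a t s"
proof -
  have m: "- a = const_fun (- 1) * a" by (simp add: hom_props[OF hom_const_fun])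
  show "regular a t s \<Longrightarrow> regular (- a) t s" unfolding m by simp
  show "regular a t s \<Longrightarrow> val (- a) t s = - val a t s" unfolding m by (subst val_mult) simp_all
qed

lemma regular_diff [simp]: "regular a t s \<Longrightarrow> regular b t s \<Longrightarrow> regular (a - b) t s"
  and val_diff: "regular a t s \<Longrightarrow> regular b t s \<Longrightarrow> val (a - b) t s = val a t s - val b t s"
  using regular_add[of a "- b"] val_add[of a "- b"] by (simp_all add: val_uminus)

lemma regular_power [simp]: "regular a t s \<Longrightarrow> regular (a ^ n) t s"
  and val_power: "regular a t s \<Longrightarrow> val (a ^ n) t s = val a t s ^ n"
  by (induction n) (simp_all add: val_mult)

lemma regular_numeral [simp]: "regular (numeral n) t s" and val_numeral [simp]: "val (numeral n) t s = numeral n"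
  using regular_val_const_fun[of "numeral n"] by (simp_all add: hom_props[OF hom_const_fun])

lemma regular_divide: "regular a t s \<Longrightarrow> regular b t s \<Longrightarrow> val b t s \<noteq> 0 \<Longrightarrow> regular (a / b) t s"
  and val_divide: "regular a t s \<Longrightarrow> regular b t s \<Longrightarrow> val b t s \<noteq> 0 \<Longrightarrow> val (a / b) t s = val a t s / val b t s"
  using regular_val_inverse[of b] by (auto simp: divide_inverse val_mult)

lemma regular_half [simp]: "regular a t s \<Longrightarrow> regular (a / numeral n) t s"
  and val_half: "regular a t s \<Longrightarrow> val (a / numeral n) t s = val a t s / numeral n"
  by (simp_all add: regular_divide val_divide)

text \<open>
  The derivative of a quotient needs no new factor in the denominator.  Hence all quantities built from
  the parametrization and its derivatives are regular wherever the parametrization is.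
\<close>

lemma regular_fract_deriv:
  assumes "regular r t s"
  shows "regular (fract_deriv D r) t s"
  using assms unfolding fract_deriv_def
  by (intro conjunct1[OF regular_val_Fract]) (simp add: power2_eq_square h ev_den_ev2)

lemma regular_D [simp]: "regular r t s \<Longrightarrow> regular (D_t r) t s" "regular r t s \<Longrightarrow> regular (D_s r) t s"
  by (simp_all add: D_t_def D_s_def regular_fract_deriv)

lemmas val_simps = val_add val_mult val_uminus val_diff val_power val_half

lemma regular_val_ev3:
  assumes "regular x1 t s" "regular x2 t s" "regular x3 t s"
  shows "regular (ev3 const_fun F (x1, x2, x3)) t s \<and>
    val (ev3 const_fun F (x1, x2, x3)) t s = ev3 of_real F (val x1 t s, val x2 t s, val x3 t s)"
  by (induction F rule: poly3_induct)
     (simp_all add: ev3_simps[OF hom_const_fun] ev3_simps[OF hom_of_real] assms val_simps)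

end

lemma ev2_id: "ev2 (\<lambda>c. c) p a b = poly2 p a b"
  by (simp add: ev2_def map_poly_idI)

lemma ev2_of_real_of_real:
  "ev2 of_real p (of_real t :: 'a::real_field) (of_real s) = of_real (poly2 p t s)"
  using hom_ev2[OF comm_ring_hom_id hom_of_real[where ?'a = 'a], of p t s] by (simp only: ev2_id)

lemma ev3_of_real_of_real:
  "ev3 of_real F (of_real a :: 'a::real_field, of_real b, of_real c) = of_real (poly3 F (a, b, c))"
  using hom_ev3[OF comm_ring_hom_id hom_of_real[where ?'a = 'a], of F a b c] by (simp only: ev3_id)

lemma ev2_id' [simp]: "ev2 id p a b = poly2 p a b" and ev3_id' [simp]: "ev3 id F P = poly3 F P"
  using ev2_id ev3_id by (simp_all add: id_def)

lemma val_of_real: "val r (of_real t :: 'a::real_field) (of_real s) = of_real (val r t s)"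
  and regular_of_real [simp]: "regular r (of_real t :: 'a) (of_real s) \<longleftrightarrow> regular r t s"
  by (simp_all add: val_def ev_num_ev2 ev_den_ev2 ev2_of_real_of_real)

text \<open>
  Outside a curve in the real parameter plane.  The real points are Zariski dense in the complex
  plane, so they also detect complex identities.
\<close>

definition generically :: "(real \<Rightarrow> real \<Rightarrow> bool) \<Rightarrow> bool" where
  "generically Q \<longleftrightarrow> (\<exists>p. p \<noteq> 0 \<and> (\<forall>t s. poly2 p t s \<noteq> 0 \<longrightarrow> Q t s))"

lemma generically_conj: "generically Q \<Longrightarrow> generically R \<Longrightarrow> generically (\<lambda>t s. Q t s \<and> R t s)"
  unfolding generically_def by (metis no_zero_divisors poly2_simps(2) mult_eq_0_iff)

lemma generically_mono: "generically Q \<Longrightarrow> (\<And>t s. Q t s \<Longrightarrow> R t s) \<Longrightarrow> generically R"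
  unfolding generically_def by blast

lemma poly2_nonzero_point:
  fixes p :: "real poly poly"
  assumes "p \<noteq> 0"
  shows "\<exists>t s. poly2 p t s \<noteq> 0"
proof -
  have "infinite (range (\<lambda>s::real. [:s:]))"
    by (simp add: finite_image_iff inj_on_def infinite_UNIV_char_0)
  then have "\<not> range (\<lambda>s::real. [:s:]) \<subseteq> {q. poly p q = 0}"
    using poly_roots_finite[OF assms] finite_subset by blast
  then obtain s where s: "poly p [:s:] \<noteq> 0" by auto
  have "\<not> (UNIV :: real set) \<subseteq> {t. poly (poly p [:s:]) t = 0}"
    using poly_roots_finite[OF s] finite_subset infinite_UNIV_char_0 by blast
  then show ?thesis unfolding poly2_def by auto
qed

lemma generically_ex: "generically Q \<Longrightarrow> \<exists>t s. Q t s"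
  unfolding generically_def using poly2_nonzero_point by blast

lemma generically_regular: "generically (\<lambda>t s. regular r t s)"
  unfolding generically_def
  by (rule exI[of _ "denom r"]) (use ev2_of_real_of_real[where ?'a = real] in \<open>simp add: ev_den_ev2\<close>)

lemma generically_val_nonzero:
  assumes "r \<noteq> 0"
  shows "generically (\<lambda>t s. regular r t s \<and> val r t s \<noteq> 0)"
proof -
  have "generically (\<lambda>t s. ev_num r t s \<noteq> 0)"
    unfolding generically_def
    by (rule exI[of _ "numer r"]) (use assms ev2_of_real_of_real[where ?'a = real] in \<open>simp add: ev_num_ev2\<close>)
  from generically_conj[OF this generically_regular[of r]] show ?thesis
    by (rule generically_mono) (simp add: val_def)
qed

lemma ratfun_eq_0I:
  assumes "generically (\<lambda>t s. regular r t s \<longrightarrow> val r t s = 0)"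
  shows "r = 0"
proof (rule ccontr)
  assume "r \<noteq> 0"
  then show False using generically_ex[OF generically_conj[OF generically_val_nonzero assms]] by blast
qed

text \<open>
  The field \<open>\<real>(t,s)\<close> is formally real.
\<close>

lemma sum_of_squares_eq_0:
  fixes a b c :: ratfun
  assumes "a * a + b * b + c * c = 0"
  shows "a = 0 \<and> b = 0 \<and> c = 0"
proof -
  have "generically (\<lambda>t s. val a t s = 0 \<and> val b t s = 0 \<and> val c t s = 0)"
  proof (rule generically_mono[OF generically_conj[OF generically_regular[of a]
        generically_conj[OF generically_regular[of b] generically_regular[of c]]]])
    fix t s :: real assume *: "regular a t s \<and> regular b t s \<and> regular c t s"
    have "val (a * a + b * b + c * c) t s = 0" by (simp add: assms)
    then have "val a t s * val a t s + val b t s * val b t s + val c t s * val c t s = 0"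
      using * by (simp add: val_simps)
    then show "val a t s = 0 \<and> val b t s = 0 \<and> val c t s = 0"
      using add_nonneg_eq_0_iff[of "val a t s * val a t s + val b t s * val b t s" "val c t s * val c t s"]
        add_nonneg_eq_0_iff[of "val a t s * val a t s" "val b t s * val b t s"] by simp
  qed
  then show ?thesis by (intro conjI ratfun_eq_0I; elim generically_mono; simp)
qed

section \<open>The surface, its complexification and its regular parametrization\<close>

lemma real_imaginary_parts:
  "\<exists>G H. \<forall>P. poly3 (F :: complex poly poly poly) P = ev3 of_real G P + \<i> * ev3 of_real H P"
proof (induction F rule: poly3_induct)
  case (const c)
  have "poly3 [:[:[:c:]:]:] P = ev3 of_real [:[:[:Re c:]:]:] P + \<i> * ev3 of_real [:[:[:Im c:]:]:] P" for P
    by (simp add: ev3_simps[OF hom_of_real] complex_eq)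
  then show ?case by blast
next
  case X
  show ?case
    by (rule exI[of _ "[:[:[:0, 1:]:]:]"], rule exI[of _ 0]) (simp add: ev3_simps[OF hom_of_real] split_paired_All)
next
  case Y
  show ?case
    by (rule exI[of _ "[:[:0, 1:]:]"], rule exI[of _ 0]) (simp add: ev3_simps[OF hom_of_real] split_paired_All)
next
  case Z
  show ?case
    by (rule exI[of _ "[:0, 1:]"], rule exI[of _ 0]) (simp add: ev3_simps[OF hom_of_real] split_paired_All)
next
  case (add F F')
  then obtain G H G' H' where "\<And>P. poly3 F P = ev3 of_real G P + \<i> * ev3 of_real H P"
    "\<And>P. poly3 F' P = ev3 of_real G' P + \<i> * ev3 of_real H' P" by blast
  then have "poly3 (F + F') P = ev3 of_real (G + G') P + \<i> * ev3 of_real (H + H') P" for P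
    by (simp add: ev3_simps[OF hom_of_real] algebra_simps)
  then show ?case by blast
next
  case (mult F F')
  then obtain G H G' H' where "\<And>P. poly3 F P = ev3 of_real G P + \<i> * ev3 of_real H P"
    "\<And>P. poly3 F' P = ev3 of_real G' P + \<i> * ev3 of_real H' P" by blast
  then have "poly3 (F * F') P = ev3 of_real (G * G' - H * H') P + \<i> * ev3 of_real (G * H' + H * G') P" for P
    by (simp add: ev3_simps[OF hom_of_real] algebra_simps)
  then show ?case by blast
qed

lemma param_dom_iff: "(t, s) \<in> param_dom (x1, x2, x3) \<longleftrightarrow> regular x1 t s \<and> regular x2 t s \<and> regular x3 t s"
  by (auto simp: param_dom_def set3_def)

lemma param_map_val: "param_map (x1, x2, x3) (t, s) = (val x1 t s, val x2 t s, val x3 t s)"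
  by (simp add: param_map_def map3_def val_def)

lemma generically_param_dom: "generically (\<lambda>t s. (t, s) \<in> param_dom (x1, x2, x3))"
  unfolding param_dom_iff by (intro generically_conj generically_regular)

text \<open>
  \<open>(x1, x2, x3)\<close>, as a point over the function field, is a generic point of the surface.
\<close>

lemma vanishes_on_image_iff:
  "(\<forall>u \<in> param_dom (x1, x2, x3). poly3 F (param_map (x1, x2, x3) u) = 0) \<longleftrightarrow> ev3 const_fun F (x1, x2, x3) = 0"
proof -
  show ?thesis
  proof
    assume L: "\<forall>u \<in> param_dom (x1, x2, x3). poly3 F (param_map (x1, x2, x3) u) = 0"
    show "ev3 const_fun F (x1, x2, x3) = 0"
    proof (rule ratfun_eq_0I, rule generically_mono[OF generically_param_dom[of x1 x2 x3]])
      fix t s :: real assume ts: "(t, s) \<in> param_dom (x1, x2, x3)"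
      then have "poly3 F (param_map (x1, x2, x3) (t, s)) = 0" using L by blast
      then show "regular (ev3 const_fun F (x1, x2, x3)) t s \<longrightarrow> val (ev3 const_fun F (x1, x2, x3)) t s = 0"
        using ts regular_val_ev3[of x1 t s x2 x3 F] by (simp add: param_dom_iff param_map_val)
    qed
  next
    assume z: "ev3 const_fun F (x1, x2, x3) = 0"
    show "\<forall>u \<in> param_dom (x1, x2, x3). poly3 F (param_map (x1, x2, x3) u) = 0"
    proof
      fix u :: "real \<times> real" assume u: "u \<in> param_dom (x1, x2, x3)"
      obtain t s where "u = (t, s)" by (cases u)
      then show "poly3 F (param_map (x1, x2, x3) u) = 0"
        using u regular_val_ev3[of x1 t s x2 x3 F] by (simp add: param_dom_iff param_map_val z)
    qed
  qed
qed

locale parametrized_surface =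
  fixes S :: "real triple set" and x1 x2 x3 :: ratfun
  assumes S: "S = zariski_closure (param_map (x1, x2, x3) ` param_dom (x1, x2, x3))"
begin

abbreviation "x \<equiv> (x1, x2, x3)"
abbreviation "point t s \<equiv> param_map x (complex_of_real t, complex_of_real s)"

lemma mem_S_iff: "P \<in> S \<longleftrightarrow> (\<forall>F. ev3 const_fun F x = 0 \<longrightarrow> poly3 F P = 0)"
  unfolding S zariski_closure_def by (simp add: vanishes_on_image_iff)

lemma image_subset_S: "u \<in> param_dom x \<Longrightarrow> param_map x u \<in> S"
  unfolding S zariski_closure_def by blast

lemma vanishes_on_S_iff: "(\<forall>P \<in> S. poly3 F P = 0) \<longleftrightarrow> ev3 const_fun F x = 0"
proof
  assume "\<forall>P \<in> S. poly3 F P = 0"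
  then have "\<forall>u \<in> param_dom x. poly3 F (param_map x u) = 0"
    using image_subset_S by blast
  then show "ev3 const_fun F x = 0" unfolding vanishes_on_image_iff .
next
  assume "ev3 const_fun F x = 0"
  then show "\<forall>P \<in> S. poly3 F P = 0" using mem_S_iff by blast
qed

text \<open>
  The real and the imaginary part of a complex equation of the real surface are real equations of it.
\<close>

lemma mem_complex_closure_iff:
  "P \<in> complex_closure S \<longleftrightarrow> (\<forall>F. ev3 const_fun F x = 0 \<longrightarrow> ev3 of_real F P = 0)"
proof
  assume P: "P \<in> complex_closure S"
  show "\<forall>F. ev3 const_fun F x = 0 \<longrightarrow> ev3 of_real F P = 0"
  proof (intro allI impI)
    fix F assume "ev3 const_fun F x = 0"
    then have z: "\<And>Q. Q \<in> S \<Longrightarrow> poly3 F Q = 0" using vanishes_on_S_iff by blast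
    let ?F = "map_poly (map_poly (map_poly complex_of_real)) F"
    have "poly3 ?F Q = 0" if "Q \<in> map3 complex_of_real ` S" for Q
      using that z by (auto simp: map3_def ev3_def[symmetric] ev3_of_real_of_real)
    then show "ev3 of_real F P = 0"
      using P unfolding complex_closure_def zariski_closure_def ev3_def by blast
  qed
next
  assume R: "\<forall>F. ev3 const_fun F x = 0 \<longrightarrow> ev3 of_real F P = 0"
  show "P \<in> complex_closure S"
    unfolding complex_closure_def zariski_closure_def
  proof (intro CollectI allI impI)
    fix F assume F: "\<forall>Q \<in> map3 complex_of_real ` S. poly3 F Q = 0"
    obtain G H where GH: "\<And>P. poly3 F P = ev3 of_real G P + \<i> * ev3 of_real H P"
      using real_imaginary_parts by blast
    have "poly3 G Q = 0 \<and> poly3 H Q = 0" if Q: "Q \<in> S" for Q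
    proof -
      obtain a b c where abc: "Q = (a, b, c)" by (cases Q)
      have "poly3 F (of_real a, of_real b, of_real c) = 0" using F Q by (force simp: map3_def abc)
      then have "complex_of_real (poly3 G Q) + \<i> * of_real (poly3 H Q) = 0"
        by (simp add: GH ev3_of_real_of_real abc)
      then show ?thesis by (simp add: complex_eq_iff)
    qed
    then have "ev3 const_fun G x = 0" "ev3 const_fun H x = 0"
      unfolding vanishes_on_S_iff[symmetric] by blast+
    then show "poly3 F P = 0" using R by (simp add: GH)
  qed
qed

lemma complex_image_subset: "(t, s) \<in> param_dom x \<Longrightarrow> param_map x (t, s) \<in> complex_closure S"
  unfolding mem_complex_closure_iff
proof (intro allI impI)
  fix F assume "(t, s) \<in> param_dom x" "ev3 const_fun F x = 0"
  then show "ev3 of_real F (param_map x (t, s)) = 0"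
    using regular_val_ev3[of x1 t s x2 x3 F] by (simp add: param_dom_iff param_map_val)
qed

lemma generically_nonzero_on_image:
  assumes "\<exists>P \<in> complex_closure S. poly3 q P \<noteq> 0"
  shows "generically (\<lambda>t s. poly3 q (point t s) \<noteq> 0)"
proof -
  obtain G H where GH: "\<And>P. poly3 q P = ev3 of_real G P + \<i> * ev3 of_real H P"
    using real_imaginary_parts by blast
  have "ev3 const_fun G x \<noteq> 0 \<or> ev3 const_fun H x \<noteq> 0"
    using assms mem_complex_closure_iff GH by auto
  then have "generically (\<lambda>t s. val (ev3 const_fun G x) t s \<noteq> 0 \<or> val (ev3 const_fun H x) t s \<noteq> 0)"
  proof
    assume "ev3 const_fun G x \<noteq> 0"
    from generically_val_nonzero[OF this] show ?thesis by (rule generically_mono) simp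
  next
    assume "ev3 const_fun H x \<noteq> 0"
    from generically_val_nonzero[OF this] show ?thesis by (rule generically_mono) simp
  qed
  from generically_conj[OF this generically_param_dom[of x1 x2 x3]] show ?thesis
  proof (rule generically_mono)
    fix t s :: real
    assume *: "(val (ev3 const_fun G x) t s \<noteq> 0 \<or> val (ev3 const_fun H x) t s \<noteq> 0)
      \<and> (t, s) \<in> param_dom x"
    then have "poly3 q (point t s)
       = of_real (val (ev3 const_fun G x) t s) + \<i> * of_real (val (ev3 const_fun H x) t s)"
      using regular_val_ev3[of x1 "complex_of_real t" "complex_of_real s" x2 x3]
      by (simp add: param_dom_iff param_map_val GH val_of_real[symmetric])
    then show "poly3 q (point t s) \<noteq> 0"
      using * by (auto simp: complex_eq_iff)
  qed
qed

end

section \<open>Proper parametrizations are immersions\<close>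

locale proper_surface = parametrized_surface +
  fixes p1 q1 p2 q2 :: "complex poly poly poly"
  assumes q1: "\<exists>P \<in> complex_closure S. poly3 q1 P \<noteq> 0" and q2: "\<exists>P \<in> complex_closure S. poly3 q2 P \<noteq> 0"
    and left_inverse: "\<And>u. u \<in> param_dom x \<Longrightarrow> poly3 q1 (param_map x u) \<noteq> 0 \<Longrightarrow>
      poly3 q2 (param_map x u) \<noteq> 0 \<Longrightarrow>
      (poly3 p1 (param_map x u) / poly3 q1 (param_map x u),
       poly3 p2 (param_map x u) / poly3 q2 (param_map x u)) = u"
    and right_inverse: "\<And>P. P \<in> complex_closure S \<Longrightarrow> poly3 q1 P \<noteq> 0 \<Longrightarrow> poly3 q2 P \<noteq> 0 \<Longrightarrow>
      (poly3 p1 P / poly3 q1 P, poly3 p2 P / poly3 q2 P) \<in> param_dom x \<Longrightarrow>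
      param_map x (poly3 p1 P / poly3 q1 P, poly3 p2 P / poly3 q2 P) = P"

lemma properly_parametrizes_imp_proper_surface:
  assumes "properly_parametrizes (x1, x2, x3) S"
  obtains p1 q1 p2 q2 where "proper_surface S x1 x2 x3 p1 q1 p2 q2"
proof -
  from assms have S: "S = zariski_closure (param_map (x1, x2, x3) ` param_dom (x1, x2, x3))"
    and b: "birational_onto (x1, x2, x3) (complex_closure S)"
    unfolding properly_parametrizes_def by blast+
  then interpret parametrized_surface S x1 x2 x3 by unfold_locales
  from b obtain p1 q1 p2 q2 :: "complex poly poly poly"
    where q: "\<exists>P \<in> complex_closure S. poly3 q1 P \<noteq> 0" "\<exists>P \<in> complex_closure S. poly3 q2 P \<noteq> 0"
      and inv: "let dom = {P \<in> complex_closure S. poly3 q1 P \<noteq> 0 \<and> poly3 q2 P \<noteq> 0};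
             inv_map = (\<lambda>P. (poly3 p1 P / poly3 q1 P, poly3 p2 P / poly3 q2 P))
         in (\<forall>u \<in> param_dom (x1, x2, x3). param_map (x1, x2, x3) u \<in> dom \<longrightarrow> inv_map (param_map (x1, x2, x3) u) = u) \<and>
            (\<forall>P \<in> dom. inv_map P \<in> param_dom (x1, x2, x3) \<longrightarrow> param_map (x1, x2, x3) (inv_map P) = P)"
    unfolding birational_onto_def by blast
  have "proper_surface S x1 x2 x3 p1 q1 p2 q2"
  proof (unfold_locales, goal_cases)
    case 1 show ?case by (rule q)
  next
    case 2 show ?case by (rule q)
  next
    case (3 u)
    moreover obtain t s where "u = (t, s)" by (cases u)
    ultimately show ?case using inv complex_image_subset[of t s] unfolding Let_def by blast
  next
    case (4 P)
    then show ?case using inv unfolding Let_def by blast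
  qed
  then show ?thesis by (rule that)
qed

context parametrized_surface
begin

text \<open>
  A complex rational expression for a real function along the surface can be replaced by a real one: compare
  real and imaginary parts, not both of which have vanishing denominator.
\<close>

lemma coordinate_is_quotient:
  fixes r :: ratfun and p q :: "complex poly poly poly"
  assumes q: "\<exists>P \<in> complex_closure S. poly3 q P \<noteq> 0"
    and eq: "generically (\<lambda>t s. poly3 p (point t s)
      = of_real (val r t s) * poly3 q (point t s))"
  obtains a c where "ev3 const_fun a x \<noteq> 0"
    "ev3 const_fun c x = r * ev3 const_fun a x"
proof -
  obtain G H where GH: "\<And>P. poly3 q P = ev3 of_real G P + \<i> * ev3 of_real H P"
    using real_imaginary_parts by blast
  obtain A B where AB: "\<And>P. poly3 p P = ev3 of_real A P + \<i> * ev3 of_real B P"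
    using real_imaginary_parts by blast
    have "generically (\<lambda>t s. val (ev3 const_fun A x - r * ev3 const_fun G x) t s = 0 \<and>
      val (ev3 const_fun B x - r * ev3 const_fun H x) t s = 0)"
  proof (rule generically_mono[OF generically_conj[OF eq generically_conj[OF generically_param_dom[of x1 x2 x3] generically_regular[of r]]]])
    fix t s :: real
    let ?u = "(complex_of_real t, complex_of_real s)"
    assume *: "poly3 p (param_map x ?u) = of_real (val r t s) * poly3 q (param_map x ?u) \<and>
      (t, s) \<in> param_dom x \<and> regular r t s"
    then have ts: "regular x1 t s" "regular x2 t s" "regular x3 t s" by (auto simp: param_dom_iff)
    have e: "ev3 of_real F (param_map x ?u) = complex_of_real (val (ev3 const_fun F x) t s)" for F
      using regular_val_ev3[of x1 "complex_of_real t" "complex_of_real s" x2 x3 F] ts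
      by (simp add: param_map_val val_of_real)
    have reg: "regular (ev3 const_fun F x) t s" for F
      using regular_val_ev3[OF ts] by blast
    show "val (ev3 const_fun A x - r * ev3 const_fun G x) t s = 0 \<and>
      val (ev3 const_fun B x - r * ev3 const_fun H x) t s = 0"
      using * by (simp add: val_simps reg GH AB e complex_eq_iff)
  qed
  then have "ev3 const_fun A x - r * ev3 const_fun G x = 0" "ev3 const_fun B x - r * ev3 const_fun H x = 0"
    by (rule ratfun_eq_0I[OF generically_mono], simp)+
  moreover have "ev3 const_fun G x \<noteq> 0 \<or> ev3 const_fun H x \<noteq> 0"
    using q mem_complex_closure_iff GH by auto
  ultimately show ?thesis using that by auto
qed

end

context proper_surface
begin

lemma generically_inverse:
  "generically (\<lambda>t s. (t, s) \<in> param_dom x \<and>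
     poly3 q1 (point t s) \<noteq> 0 \<and>
     poly3 q2 (point t s) \<noteq> 0)"
  by (intro generically_conj generically_param_dom generically_nonzero_on_image q1 q2)

lemma parameters_are_quotients:
  obtains a1 c1 a2 c2 where
    "ev3 const_fun a1 x \<noteq> 0" "ev3 const_fun c1 x = t_fun * ev3 const_fun a1 x"
    "ev3 const_fun a2 x \<noteq> 0" "ev3 const_fun c2 x = s_fun * ev3 const_fun a2 x"
proof -
  have v: "val t_fun t s = t" "val s_fun t s = s" for t s :: real
    by (simp_all add: t_fun_def s_fun_def val_to_fract ev2_simps[OF hom_of_real])
  have inv: "poly3 p1 (point t s) = of_real t * poly3 q1 (point t s) \<and>
       poly3 p2 (point t s) = of_real s * poly3 q2 (point t s)"
    if "(t, s) \<in> param_dom x \<and>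
     poly3 q1 (point t s) \<noteq> 0 \<and>
     poly3 q2 (point t s) \<noteq> 0" for t s
    using left_inverse[of "(complex_of_real t, complex_of_real s)"] that by (simp add: param_dom_iff nonzero_divide_eq_eq)
  have "generically (\<lambda>t s. poly3 p1 (point t s)
      = of_real (val t_fun t s) * poly3 q1 (point t s))"
    "generically (\<lambda>t s. poly3 p2 (point t s)
      = of_real (val s_fun t s) * poly3 q2 (point t s))"
    by (rule generically_mono[OF generically_inverse],
        drule inv, simp add: v)+
  note * = this
  obtain a1 c1 where 1: "ev3 const_fun a1 x \<noteq> 0" "ev3 const_fun c1 x = t_fun * ev3 const_fun a1 x"
    by (rule coordinate_is_quotient[OF q1 *(1)])
  obtain a2 c2 where 2: "ev3 const_fun a2 x \<noteq> 0" "ev3 const_fun c2 x = s_fun * ev3 const_fun a2 x"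
    by (rule coordinate_is_quotient[OF q2 *(2)])
  show ?thesis by (rule that[OF 1 2])
qed

text \<open>
  If the normal vector vanished, some nonzero combination of the two coordinate derivations would annihilate
  the coordinates of the surface, hence also \<open>t\<close> and \<open>s\<close>, which are rational functions of these
  coordinates by properness.  But a combination that annihilates \<open>t\<close> and \<open>s\<close> is zero.
\<close>

theorem normal_vec_nonzero: "normal_vec x \<noteq> (0, 0, 0)"
proof
  assume "normal_vec x = (0, 0, 0)"
  then have c: "D_t x2 * D_s x3 = D_t x3 * D_s x2" "D_t x3 * D_s x1 = D_t x1 * D_s x3" "D_t x1 * D_s x2 = D_t x2 * D_s x1"
    by (auto simp: normal_vec_def cross_def map3_def)
  have no: "\<alpha> = 0 \<and> \<beta> = 0"
    if z: "\<alpha> * D_t x1 + \<beta> * D_s x1 = 0" "\<alpha> * D_t x2 + \<beta> * D_s x2 = 0" "\<alpha> * D_t x3 + \<beta> * D_s x3 = 0" for \<alpha> \<beta>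
  proof -
    define d where "d = (\<lambda>r. \<alpha> * D_t r + \<beta> * D_s r)"
    have d: "derivation d" unfolding d_def derivation_along_def by (simp add: D_simps algebra_simps)
    have k: "d (ev3 const_fun F x) = 0" for F
      by (rule derivation_ev3_eq_0[OF d]) (use z in \<open>simp_all add: d_def\<close>)
    obtain a1 c1 a2 c2 where ac:
      "ev3 const_fun a1 x \<noteq> 0" "ev3 const_fun c1 x = t_fun * ev3 const_fun a1 x"
      "ev3 const_fun a2 x \<noteq> 0" "ev3 const_fun c2 x = s_fun * ev3 const_fun a2 x"
      by (rule parameters_are_quotients)
    have "d t_fun * ev3 const_fun a1 x = 0" "d s_fun * ev3 const_fun a2 x = 0"
      using k[of c1] k[of c2] by (simp_all add: ac derivation_props[OF d] k)
    then have "d t_fun = 0" "d s_fun = 0" using ac by auto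
    then show ?thesis by (simp add: d_def)
  qed
  have "D_t x1 = 0" using no[of "- D_s x1" "D_t x1"] c by (simp add: algebra_simps)
  moreover have "D_t x2 = 0" using no[of "- D_s x2" "D_t x2"] c by (simp add: algebra_simps)
  moreover have "D_t x3 = 0" using no[of "- D_s x3" "D_t x3"] c by (simp add: algebra_simps)
  ultimately show False using no[of 1 0] by simp
qed

lemma normal_square_nonzero: "dot (normal_vec x) (normal_vec x) \<noteq> 0"
proof
  obtain n1 n2 n3 where n: "normal_vec x = (n1, n2, n3)" by (cases "normal_vec x")
  assume "dot (normal_vec x) (normal_vec x) = 0"
  then show False using sum_of_squares_eq_0[of n1 n2 n3] normal_vec_nonzero by (simp add: n dot_def)
qed

end

section \<open>A criterion for ruledness\<close>

instance fract :: ("{idom,ring_char_0}") field_char_0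
proof
  show "inj (of_nat :: nat \<Rightarrow> 'a fract)"
    by (rule injI) (simp add: of_nat_fract eq_fract)
qed

lemma hom_to_ac: "comm_ring_hom to_ac"
  by (rule comm_ring_homI) auto

context parametrized_surface
begin

text \<open>
  A polynomial in \<open>l\<close> that vanishes for all real \<open>l\<close> is zero.
\<close>

lemma line_in_complex_closure:
  assumes "\<And>F l. ev3 const_fun F x = 0 \<Longrightarrow>
    ev3 of_real F (P1 + of_real l * v1, P2 + of_real l * v2, P3 + of_real l * v3) = (0::complex)"
  shows "(P1 + l * v1, P2 + l * v2, P3 + l * v3) \<in> complex_closure S"
  unfolding mem_complex_closure_iff
proof (intro allI impI)
  fix F assume F: "ev3 const_fun F x = 0"
  define q where "q = ev3 (\<lambda>r. [:complex_of_real r:]) F ([:P1, v1:], [:P2, v2:], [:P3, v3:])"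
  have H: "comm_ring_hom (\<lambda>r. [:complex_of_real r:])" by (rule comm_ring_homI) (auto simp: one_pCons)
  have E: "comm_ring_hom (\<lambda>p::complex poly. poly p l)" for l by (rule comm_ring_homI) auto
  have q: "poly q l = ev3 of_real F (P1 + l * v1, P2 + l * v2, P3 + l * v3)" for l
    unfolding q_def by (simp add: hom_ev3[OF H E])
  have "range complex_of_real \<subseteq> {l. poly q l = 0}"
    using assms[OF F] by (auto simp: q)
  moreover have "infinite (range complex_of_real)"
    by (simp add: finite_image_iff inj_on_def infinite_UNIV_char_0)
  ultimately have "q = 0" using poly_roots_finite finite_subset by blast
  then show "ev3 of_real F (P1 + l * v1, P2 + l * v2, P3 + l * v3) = 0" using q[of l] by simp
qed

text \<open>
  A single line through the generic point, defined over an algebraic extension of the function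
  field, yields by specialisation a line through every point.
\<close>

lemma ruled_if_lines_over_closure:
  fixes w1 w2 w3 :: "ratfun alg_closure"
  assumes w: "(w1, w2, w3) \<noteq> (0, 0, 0)"
    and lines: "\<And>F l. ev3 const_fun F x = 0 \<Longrightarrow>
      ev3 (\<lambda>r. to_ac (const_fun r)) F (to_ac x1 + l * w1, to_ac x2 + l * w2, to_ac x3 + l * w3) = 0"
  shows "is_ruled S"
  unfolding is_ruled_def
proof
  fix P assume P: "P \<in> S"
  obtain a b c where abc: "P = (a, b, c)" by (cases P)
  let ?h = "\<lambda>r. to_ac (const_fun r)"
  have h: "comm_ring_hom ?h" by (rule comm_ring_hom_o[OF hom_const_fun hom_to_ac])
  have "ev3 of_real F (complex_of_real a, complex_of_real b, complex_of_real c) = 0"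
    if "ev3 ?h F (to_ac x1, to_ac x2, to_ac x3) = 0" for F
  proof -
    have "to_ac (ev3 const_fun F x) = 0"
      using that by (simp add: hom_ev3[OF hom_const_fun hom_to_ac])
    then have "poly3 F P = 0" using P mem_S_iff by simp
    then show ?thesis by (simp add: ev3_of_real_of_real abc)
  qed
  from specialise_direction[OF h this w] obtain v1 v2 v3 :: complex
    where v: "(v1, v2, v3) \<noteq> (0, 0, 0)"
      and vl: "\<And>F l. (\<And>l. ev3 ?h F (to_ac x1 + l * w1, to_ac x2 + l * w2, to_ac x3 + l * w3) = 0) \<Longrightarrow>
         ev3 of_real F (of_real a + of_real l * v1, of_real b + of_real l * v2, of_real c + of_real l * v3) = 0"
    by blast
  define L where "L = {(complex_of_real a + l * v1, complex_of_real b + l * v2, complex_of_real c + l * v3) |l. True}"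
  have "is_line L" unfolding is_line_def L_def using v by blast
  moreover have "map3 complex_of_real P \<in> L"
    unfolding L_def abc map3_def by (auto intro!: exI[of _ 0])
  moreover have "L \<subseteq> complex_closure S"
    unfolding L_def using line_in_complex_closure[OF vl[OF lines]] by auto
  ultimately show "(\<exists>L. is_line L \<and> P \<in> L \<and> L \<subseteq> S) \<or>
      (\<exists>L. is_line L \<and> map3 complex_of_real P \<in> L \<and> L \<subseteq> complex_closure S)" by blast
qed

lemma ruled_if_straight_derivation:
  fixes d :: "ratfun \<Rightarrow> ratfun"
  assumes d: "derivation d" and c: "\<And>r. d (const_fun r) = 0"
    and nz: "(d x1, d x2, d x3) \<noteq> (0, 0, 0)"
    and l: "d (d x1) = lam * d x1" "d (d x2) = lam * d x2" "d (d x3) = lam * d x3"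
  shows "is_ruled S"
proof (rule ruled_if_lines_over_closure)
  show "(to_ac (d x1), to_ac (d x2), to_ac (d x3)) \<noteq> (0, 0, 0)" using nz by auto
  fix F l
  assume "ev3 const_fun F x = 0"
  then show "ev3 (\<lambda>r. to_ac (const_fun r)) F
      (to_ac x1 + l * to_ac (d x1), to_ac x2 + l * to_ac (d x2), to_ac x3 + l * to_ac (d x3)) = 0"
    by (intro osculating_line[OF hom_to_ac d hom_const_fun, where A = 1 and lam = "to_ac lam"])
       (simp_all add: c l derivation_props[OF d])
qed

end

section \<open>The fundamental forms\<close>

text \<open>
  Expansion of a vector in the frame given by \<open>a\<close>, \<open>b\<close> and their cross product, followed by Lagrange's
  identity.
\<close>

lemma orthogonal_decomposition:
  fixes a1 a2 a3 b1 b2 b3 v1 v2 v3 :: "'a::comm_ring_1"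
  defines "E \<equiv> a1 * a1 + a2 * a2 + a3 * a3" and "F \<equiv> a1 * b1 + a2 * b2 + a3 * b3"
    and "G \<equiv> b1 * b1 + b2 * b2 + b3 * b3"
    and "va \<equiv> v1 * a1 + v2 * a2 + v3 * a3" and "vb \<equiv> v1 * b1 + v2 * b2 + v3 * b3"
    and "n1 \<equiv> a2 * b3 - a3 * b2" and "n2 \<equiv> a3 * b1 - a1 * b3" and "n3 \<equiv> a1 * b2 - a2 * b1"
  defines "vn \<equiv> v1 * n1 + v2 * n2 + v3 * n3"
  shows "(E * G - F ^ 2) * v1 = (G * va - F * vb) * a1 + (E * vb - F * va) * b1 + vn * n1 \<and>
      (E * G - F ^ 2) * v2 = (G * va - F * vb) * a2 + (E * vb - F * va) * b2 + vn * n2 \<and>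
      (E * G - F ^ 2) * v3 = (G * va - F * vb) * a3 + (E * vb - F * va) * b3 + vn * n3"
    and "E * G - F ^ 2 = n1 * n1 + n2 * n2 + n3 * n3"
  unfolding assms by (simp_all add: power2_eq_square algebra_simps)

context proper_surface
begin

text \<open>
  Componentwise names: \<open>a\<close> and \<open>b\<close> for the first derivatives with respect to \<open>t\<close> and \<open>s\<close>, \<open>tt\<close>, \<open>ts\<close>
  and \<open>ss\<close> for the second ones, and \<open>n\<close> for the normal vector.
\<close>

definition "a1 = D_t x1" definition "a2 = D_t x2" definition "a3 = D_t x3"
definition "b1 = D_s x1" definition "b2 = D_s x2" definition "b3 = D_s x3"
definition "tt1 = D_t a1" definition "tt2 = D_t a2" definition "tt3 = D_t a3"
definition "ts1 = D_s a1" definition "ts2 = D_s a2" definition "ts3 = D_s a3"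
definition "ss1 = D_s b1" definition "ss2 = D_s b2" definition "ss3 = D_s b3"
definition "n1 = a2 * b3 - a3 * b2" definition "n2 = a3 * b1 - a1 * b3" definition "n3 = a1 * b2 - a2 * b1"

abbreviation "e \<equiv> e_star x" abbreviation "f \<equiv> f_star x" abbreviation "g \<equiv> g_star x"
abbreviation "E \<equiv> E_coef x" abbreviation "F \<equiv> F_coef x" abbreviation "G \<equiv> G_coef x"
abbreviation "I \<equiv> I_det x"

lemmas first_derivs = a1_def[symmetric] a2_def[symmetric] a3_def[symmetric]
  b1_def[symmetric] b2_def[symmetric] b3_def[symmetric]
lemmas second_derivs = tt1_def[symmetric] tt2_def[symmetric] tt3_def[symmetric]
  ts1_def[symmetric] ts2_def[symmetric] ts3_def[symmetric] ss1_def[symmetric] ss2_def[symmetric] ss3_def[symmetric]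

lemma D_t_b: "D_t b1 = ts1" "D_t b2 = ts2" "D_t b3 = ts3"
  by (simp_all add: b1_def b2_def b3_def ts1_def ts2_def ts3_def a1_def a2_def a3_def D_t_D_s)

lemma normal_vec: "normal_vec x = (n1, n2, n3)"
  by (simp add: normal_vec_def cross_def map3_def first_derivs n1_def n2_def n3_def)

lemma second_form:
  "e = tt1 * n1 + tt2 * n2 + tt3 * n3" "f = ts1 * n1 + ts2 * n2 + ts3 * n3" "g = ss1 * n1 + ss2 * n2 + ss3 * n3"
  by (simp_all add: e_star_def f_star_def g_star_def normal_vec dot_def map3_def first_derivs second_derivs)

lemma first_form:
  "E = a1 * a1 + a2 * a2 + a3 * a3" "F = a1 * b1 + a2 * b2 + a3 * b3" "G = b1 * b1 + b2 * b2 + b3 * b3"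
  by (simp_all add: E_coef_def F_coef_def G_coef_def dot_def map3_def first_derivs)

lemma first_form_derivs:
  "D_t E = 2 * (tt1 * a1 + tt2 * a2 + tt3 * a3)" "D_s E = 2 * (ts1 * a1 + ts2 * a2 + ts3 * a3)"
  "D_t F = (tt1 * b1 + tt2 * b2 + tt3 * b3) + (ts1 * a1 + ts2 * a2 + ts3 * a3)"
  "D_s F = (ts1 * b1 + ts2 * b2 + ts3 * b3) + (ss1 * a1 + ss2 * a2 + ss3 * a3)"
  "D_t G = 2 * (ts1 * b1 + ts2 * b2 + ts3 * b3)" "D_s G = 2 * (ss1 * b1 + ss2 * b2 + ss3 * b3)"
  by (simp_all add: first_form D_simps second_derivs D_t_b)

lemma christoffel:
  "Gam_11_1 x = G * (tt1 * a1 + tt2 * a2 + tt3 * a3) - F * (tt1 * b1 + tt2 * b2 + tt3 * b3)"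
  "Gam_11_2 x = E * (tt1 * b1 + tt2 * b2 + tt3 * b3) - F * (tt1 * a1 + tt2 * a2 + tt3 * a3)"
  "Gam_12_1 x = G * (ts1 * a1 + ts2 * a2 + ts3 * a3) - F * (ts1 * b1 + ts2 * b2 + ts3 * b3)"
  "Gam_12_2 x = E * (ts1 * b1 + ts2 * b2 + ts3 * b3) - F * (ts1 * a1 + ts2 * a2 + ts3 * a3)"
  "Gam_22_1 x = G * (ss1 * a1 + ss2 * a2 + ss3 * a3) - F * (ss1 * b1 + ss2 * b2 + ss3 * b3)"
  "Gam_22_2 x = E * (ss1 * b1 + ss2 * b2 + ss3 * b3) - F * (ss1 * a1 + ss2 * a2 + ss3 * a3)"
  unfolding Gam_11_1_def Gam_11_2_def Gam_12_1_def Gam_12_2_def Gam_22_1_def Gam_22_2_def Let_def first_form_derivs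
  by (simp_all add: field_simps)

lemma I_eq: "I = E * G - F ^ 2" "I = n1 * n1 + n2 * n2 + n3 * n3"
  using orthogonal_decomposition(2)[of a1 a2 a3 b1 b2 b3]
  by (simp_all add: I_det_def first_form n1_def n2_def n3_def)

lemma I_nonzero: "I \<noteq> 0"
  using normal_square_nonzero by (simp add: normal_vec dot_def I_eq(2))

lemma normal_nonzero: "(n1, n2, n3) \<noteq> (0, 0, 0)"
  using normal_vec_nonzero by (simp add: normal_vec)

lemma decomposition:
  "I * v1 = (G * (v1 * a1 + v2 * a2 + v3 * a3) - F * (v1 * b1 + v2 * b2 + v3 * b3)) * a1
    + (E * (v1 * b1 + v2 * b2 + v3 * b3) - F * (v1 * a1 + v2 * a2 + v3 * a3)) * b1 + (v1 * n1 + v2 * n2 + v3 * n3) * n1 \<and>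
   I * v2 = (G * (v1 * a1 + v2 * a2 + v3 * a3) - F * (v1 * b1 + v2 * b2 + v3 * b3)) * a2
    + (E * (v1 * b1 + v2 * b2 + v3 * b3) - F * (v1 * a1 + v2 * a2 + v3 * a3)) * b2 + (v1 * n1 + v2 * n2 + v3 * n3) * n2 \<and>
   I * v3 = (G * (v1 * a1 + v2 * a2 + v3 * a3) - F * (v1 * b1 + v2 * b2 + v3 * b3)) * a3
    + (E * (v1 * b1 + v2 * b2 + v3 * b3) - F * (v1 * a1 + v2 * a2 + v3 * a3)) * b3 + (v1 * n1 + v2 * n2 + v3 * n3) * n3"
  using orthogonal_decomposition(1)[of a1 a2 a3 b1 b2 b3 v1 v2 v3]
  unfolding I_eq(1) first_form n1_def n2_def n3_def .

lemma eta_eq_0_iff: "eta x = 0 \<longleftrightarrow> g = 0 \<and> Gam_22_1 x = 0"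
  by (simp add: eta_def)

lemma x_s_nonzero: "(b1, b2, b3) \<noteq> (0, 0, 0)"
  using normal_nonzero by (auto simp: n1_def n2_def n3_def)

text \<open>
  The two equations \<open>g = 0\<close> and \<open>Gam_22_1 = 0\<close> say that \<open>x_ss\<close> has no component along the normal vector and none along \<open>x_t\<close>, so it is
  a multiple of \<open>x_s\<close>: the \<open>s\<close>-lines are straight.
\<close>

theorem ruled_if_eta_eq_0:
  assumes "eta x = 0"
  shows "is_ruled S"
proof -
  from assms have g: "g = 0" and Gam: "Gam_22_1 x = 0" by (auto simp: eta_eq_0_iff)
  have "I * ss1 = Gam_22_2 x * b1" "I * ss2 = Gam_22_2 x * b2" "I * ss3 = Gam_22_2 x * b3"
    using decomposition[of ss1 ss2 ss3] g Gam unfolding christoffel second_form by simp_all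
  then have "ss1 = (Gam_22_2 x / I) * b1" "ss2 = (Gam_22_2 x / I) * b2" "ss3 = (Gam_22_2 x / I) * b3"
    using I_nonzero by (simp_all add: field_simps)
  then show ?thesis
    using x_s_nonzero by (intro ruled_if_straight_derivation[OF derivation_D_s, where lam = "Gam_22_2 x / I"])
      (simp_all add: first_derivs second_derivs)
qed

subsection \<open>Parabolic points and planes\<close>

lemma normal_orthogonal: "n1 * a1 + n2 * a2 + n3 * a3 = 0" "n1 * b1 + n2 * b2 + n3 * b3 = 0"
  by (simp_all add: n1_def n2_def n3_def algebra_simps)

text \<open>
  Differentiate the orthogonality of the normal vector to the tangent plane.
\<close>

lemma weingarten:
  "D_t n1 * a1 + D_t n2 * a2 + D_t n3 * a3 = - e" "D_t n1 * b1 + D_t n2 * b2 + D_t n3 * b3 = - f"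
  "D_s n1 * a1 + D_s n2 * a2 + D_s n3 * a3 = - f" "D_s n1 * b1 + D_s n2 * b2 + D_s n3 * b3 = - g"
proof -
  have "D_t (n1 * a1 + n2 * a2 + n3 * a3) = 0" "D_t (n1 * b1 + n2 * b2 + n3 * b3) = 0"
    "D_s (n1 * a1 + n2 * a2 + n3 * a3) = 0" "D_s (n1 * b1 + n2 * b2 + n3 * b3) = 0"
    by (simp_all only: normal_orthogonal D_simps)
  then show "D_t n1 * a1 + D_t n2 * a2 + D_t n3 * a3 = - e" "D_t n1 * b1 + D_t n2 * b2 + D_t n3 * b3 = - f"
  "D_s n1 * a1 + D_s n2 * a2 + D_s n3 * a3 = - f" "D_s n1 * b1 + D_s n2 * b2 + D_s n3 * b3 = - g"
    unfolding D_simps second_form eq_neg_iff_add_eq_0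
    by (simp_all add: second_derivs D_t_b algebra_simps)
qed

lemma parallel_to_normal:
  assumes "v1 * a1 + v2 * a2 + v3 * a3 = 0" "v1 * b1 + v2 * b2 + v3 * b3 = 0"
  obtains \<nu> where "v1 = \<nu> * n1" "v2 = \<nu> * n2" "v3 = \<nu> * n3"
proof -
  have "I * v1 = (v1 * n1 + v2 * n2 + v3 * n3) * n1" "I * v2 = (v1 * n1 + v2 * n2 + v3 * n3) * n2"
    "I * v3 = (v1 * n1 + v2 * n2 + v3 * n3) * n3"
    using decomposition[of v1 v2 v3] unfolding assms by simp_all
  then show ?thesis
    using I_nonzero that[of "(v1 * n1 + v2 * n2 + v3 * n3) / I"] by (simp add: field_simps)
qed

end

lemma orthogonal_to_independent_pair:
  fixes p1 p2 p3 q1 q2 q3 w1 w2 w3 v1 v2 v3 :: "'a::field"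
  assumes ind: "(p2 * q3 - p3 * q2, p3 * q1 - p1 * q3, p1 * q2 - p2 * q1) \<noteq> (0, 0, 0)"
    and w: "p1 * w1 + p2 * w2 + p3 * w3 = 0" "q1 * w1 + q2 * w2 + q3 * w3 = 0" "(w1, w2, w3) \<noteq> (0, 0, 0)"
    and v: "p1 * v1 + p2 * v2 + p3 * v3 = 0" "q1 * v1 + q2 * v2 + q3 * v3 = 0"
  obtains lam where "v1 = lam * w1" "v2 = lam * w2" "v3 = lam * w3"
proof -
  define c1 c2 c3 where "c1 = p2 * q3 - p3 * q2" and "c2 = p3 * q1 - p1 * q3" and "c3 = p1 * q2 - p2 * q1"
  \<comment> \<open>both vectors are multiples of the cross product: their cross products with it vanish\<close>
  have par: "c1 * u2 = c2 * u1 \<and> c2 * u3 = c3 * u2 \<and> c1 * u3 = c3 * u1"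
    if u: "p1 * u1 + p2 * u2 + p3 * u3 = 0" "q1 * u1 + q2 * u2 + q3 * u3 = 0" for u1 u2 u3
  proof -
    have "c1 * u2 - c2 * u1 = q3 * (p1 * u1 + p2 * u2 + p3 * u3) - p3 * (q1 * u1 + q2 * u2 + q3 * u3)"
      "c2 * u3 - c3 * u2 = q1 * (p1 * u1 + p2 * u2 + p3 * u3) - p1 * (q1 * u1 + q2 * u2 + q3 * u3)"
      "c1 * u3 - c3 * u1 = p2 * (q1 * u1 + q2 * u2 + q3 * u3) - q2 * (p1 * u1 + p2 * u2 + p3 * u3)"
      by (simp_all add: c1_def c2_def c3_def algebra_simps)
    then show ?thesis using u by simp
  qed
  have c: "c1 \<noteq> 0 \<or> c2 \<noteq> 0 \<or> c3 \<noteq> 0" using ind by (auto simp: c1_def c2_def c3_def)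
  have ex: "\<exists>k. u1 = k * c1 \<and> u2 = k * c2 \<and> u3 = k * c3"
    if u: "p1 * u1 + p2 * u2 + p3 * u3 = 0" "q1 * u1 + q2 * u2 + q3 * u3 = 0" for u1 u2 u3
    using c
  proof (elim disjE)
    assume "c1 \<noteq> 0"
    then show ?thesis using par[OF u] by (intro exI[of _ "u1 / c1"]) (auto simp: field_simps)
  next
    assume "c2 \<noteq> 0"
    then show ?thesis using par[OF u] by (intro exI[of _ "u2 / c2"]) (auto simp: field_simps)
  next
    assume "c3 \<noteq> 0"
    then show ?thesis using par[OF u] by (intro exI[of _ "u3 / c3"]) (auto simp: field_simps)
  qed
  obtain k where k: "w1 = k * c1" "w2 = k * c2" "w3 = k * c3" using ex[OF w(1,2)] by blast
  obtain m where m: "v1 = m * c1" "v2 = m * c2" "v3 = m * c3" using ex[OF v] by blast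
  have "k \<noteq> 0" using w(3) k by auto
  then show ?thesis using that[of "m / k"] k m by simp
qed

context proper_surface
begin

text \<open>
  A null vector \<open>(\<alpha>, \<beta>)\<close> of the second fundamental form is a direction \<open>w\<close> in which the tangent plane stays
  constant: \<open>d n\<close> is a multiple of \<open>n\<close>, and \<open>w\<close> is orthogonal to \<open>n\<close> and to all derivatives of \<open>n\<close>.
  Differentiating these orthogonality relations along \<open>d\<close> shows that \<open>d w\<close> satisfies them too.  Unless the
  second fundamental form is zero, \<open>n\<close> and one of its derivatives are independent, so the relations
  determine a direction up to a factor.
\<close>

lemma null_direction_is_straight:
  assumes null: "\<alpha> * e + \<beta> * f = 0" "\<alpha> * f + \<beta> * g = 0" and nz: "(\<alpha>, \<beta>) \<noteq> (0, 0)"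
    and curved: "(e, f, g) \<noteq> (0, 0, 0)"
  defines "d \<equiv> \<lambda>r. \<alpha> * D_t r + \<beta> * D_s r"
  shows "(d x1, d x2, d x3) \<noteq> (0, 0, 0)"
    and "\<exists>lam. d (d x1) = lam * d x1 \<and> d (d x2) = lam * d x2 \<and> d (d x3) = lam * d x3"
proof -
  have d: "derivation d" unfolding d_def derivation_along_def by (simp add: D_simps algebra_simps)
  note dp = derivation_props[OF d]
  define w1 w2 w3 where "w1 = d x1" and "w2 = d x2" and "w3 = d x3"
  have w: "w1 = \<alpha> * a1 + \<beta> * b1" "w2 = \<alpha> * a2 + \<beta> * b2" "w3 = \<alpha> * a3 + \<beta> * b3"
    by (simp_all add: w1_def w2_def w3_def d_def first_derivs)
  have wnz: "(w1, w2, w3) \<noteq> (0, 0, 0)"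
  proof
    assume "(w1, w2, w3) = (0, 0, 0)"
    then have z: "w1 = 0" "w2 = 0" "w3 = 0" by auto
    have "\<alpha> * n1 = w2 * b3 - w3 * b2" "\<alpha> * n2 = w3 * b1 - w1 * b3" "\<alpha> * n3 = w1 * b2 - w2 * b1"
      "\<beta> * n1 = a2 * w3 - a3 * w2" "\<beta> * n2 = a3 * w1 - a1 * w3" "\<beta> * n3 = a1 * w2 - a2 * w1"
      unfolding w n1_def n2_def n3_def by (simp_all add: algebra_simps)
    then show False using nz normal_nonzero z by auto
  qed
  then show "(d x1, d x2, d x3) \<noteq> (0, 0, 0)" by (simp add: w1_def w2_def w3_def)
  obtain \<nu> where nu: "d n1 = \<nu> * n1" "d n2 = \<nu> * n2" "d n3 = \<nu> * n3"
  proof (rule parallel_to_normal)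
    have "d n1 * a1 + d n2 * a2 + d n3 * a3 = \<alpha> * (D_t n1 * a1 + D_t n2 * a2 + D_t n3 * a3)
        + \<beta> * (D_s n1 * a1 + D_s n2 * a2 + D_s n3 * a3)" by (simp add: d_def algebra_simps)
    also have "\<dots> = - (\<alpha> * e + \<beta> * f)" by (simp add: weingarten)
    finally show "d n1 * a1 + d n2 * a2 + d n3 * a3 = 0" using null by simp
    have "d n1 * b1 + d n2 * b2 + d n3 * b3 = \<alpha> * (D_t n1 * b1 + D_t n2 * b2 + D_t n3 * b3)
        + \<beta> * (D_s n1 * b1 + D_s n2 * b2 + D_s n3 * b3)" by (simp add: d_def algebra_simps)
    also have "\<dots> = - (\<alpha> * f + \<beta> * g)" by (simp add: weingarten)
    finally show "d n1 * b1 + d n2 * b2 + d n3 * b3 = 0" using null by simp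
  qed
  have nw: "n1 * w1 + n2 * w2 + n3 * w3 = 0"
  proof -
    have "n1 * w1 + n2 * w2 + n3 * w3 = \<alpha> * (n1 * a1 + n2 * a2 + n3 * a3) + \<beta> * (n1 * b1 + n2 * b2 + n3 * b3)"
      by (simp add: w algebra_simps)
    then show ?thesis by (simp add: normal_orthogonal)
  qed
  have kw: "\<delta> n1 * w1 + \<delta> n2 * w2 + \<delta> n3 * w3 = 0" if "\<delta> = D_t \<or> \<delta> = D_s" for \<delta>
  proof -
    have "\<delta> n1 * w1 + \<delta> n2 * w2 + \<delta> n3 * w3 = \<alpha> * (\<delta> n1 * a1 + \<delta> n2 * a2 + \<delta> n3 * a3)
       + \<beta> * (\<delta> n1 * b1 + \<delta> n2 * b2 + \<delta> n3 * b3)"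
      by (simp add: w algebra_simps)
    also have "\<dots> = - (\<alpha> * e + \<beta> * f) \<or> \<dots> = - (\<alpha> * f + \<beta> * g)"
      using that by (auto simp: weingarten)
    finally show ?thesis using null by auto
  qed
  have ndw: "n1 * d w1 + n2 * d w2 + n3 * d w3 = 0"
  proof -
    have "d (n1 * w1 + n2 * w2 + n3 * w3) = \<nu> * (n1 * w1 + n2 * w2 + n3 * w3) + (n1 * d w1 + n2 * d w2 + n3 * d w3)"
      by (simp only: dp nu) (simp add: algebra_simps)
    then show ?thesis by (simp add: nw dp)
  qed
  \<comment> \<open>the commutator of \<open>d\<close> with a coordinate derivation is a combination of the coordinate derivations,
    so it is invisible after taking the product with \<open>w\<close>\<close>
  have kdw: "\<delta> n1 * d w1 + \<delta> n2 * d w2 + \<delta> n3 * d w3 = 0" if \<delta>: "\<delta> = D_t \<or> \<delta> = D_s" for \<delta>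
  proof -
    have "derivation \<delta>" using \<delta> derivation_D_t derivation_D_s by auto
    note k = derivation_props[OF this]
    have comm: "d (\<delta> r) = \<delta> (d r) - \<delta> \<alpha> * D_t r - \<delta> \<beta> * D_s r" for r
      using \<delta> by (auto simp: d_def D_simps D_t_D_s)
    have "d (\<delta> n1 * w1 + \<delta> n2 * w2 + \<delta> n3 * w3)
      = \<delta> \<nu> * (n1 * w1 + n2 * w2 + n3 * w3) + \<nu> * (\<delta> n1 * w1 + \<delta> n2 * w2 + \<delta> n3 * w3)
        - \<delta> \<alpha> * (D_t n1 * w1 + D_t n2 * w2 + D_t n3 * w3) - \<delta> \<beta> * (D_s n1 * w1 + D_s n2 * w2 + D_s n3 * w3)
        + (\<delta> n1 * d w1 + \<delta> n2 * d w2 + \<delta> n3 * d w3)"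
      by (simp only: dp comm nu k) (simp add: algebra_simps)
    then show ?thesis by (simp add: nw kw[OF \<delta>] kw[of D_t] kw[of D_s] dp)
  qed
  have dep: "\<exists>k. ma = k * n1 \<and> mb = k * n2 \<and> mc = k * n3"
    if "(n2 * mc - n3 * mb, n3 * ma - n1 * mc, n1 * mb - n2 * ma) = (0, 0, 0)" for ma mb mc
  proof -
    from normal_nonzero consider "n1 \<noteq> 0" | "n2 \<noteq> 0" | "n3 \<noteq> 0" by auto
    then show ?thesis
    proof cases
      case 1 then show ?thesis using that by (intro exI[of _ "ma / n1"]) (auto simp: field_simps)
    next
      case 2 then show ?thesis using that by (intro exI[of _ "mb / n2"]) (auto simp: field_simps)
    next
      case 3 then show ?thesis using that by (intro exI[of _ "mc / n3"]) (auto simp: field_simps)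
    qed
  qed
  have dep0: "ma * a1 + mb * a2 + mc * a3 = 0 \<and> ma * b1 + mb * b2 + mc * b3 = 0"
    if m: "(n2 * mc - n3 * mb, n3 * ma - n1 * mc, n1 * mb - n2 * ma) = (0, 0, 0)" for ma mb mc
  proof -
    obtain k where "ma = k * n1" "mb = k * n2" "mc = k * n3" using dep[OF m] by blast
    then have "ma * a1 + mb * a2 + mc * a3 = k * (n1 * a1 + n2 * a2 + n3 * a3)"
      "ma * b1 + mb * b2 + mc * b3 = k * (n1 * b1 + n2 * b2 + n3 * b3)" by (simp_all add: algebra_simps)
    then show ?thesis by (simp add: normal_orthogonal)
  qed
  have "\<exists>lam. d w1 = lam * w1 \<and> d w2 = lam * w2 \<and> d w3 = lam * w3"
  proof (cases "(n2 * D_t n3 - n3 * D_t n2, n3 * D_t n1 - n1 * D_t n3, n1 * D_t n2 - n2 * D_t n1) = (0, 0, 0)")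
    case False
    then show ?thesis by (rule orthogonal_to_independent_pair[OF _ nw kw[OF disjI1[OF refl]] wnz ndw kdw[OF disjI1[OF refl]]]) blast
  next
    case True
    have "(n2 * D_s n3 - n3 * D_s n2, n3 * D_s n1 - n1 * D_s n3, n1 * D_s n2 - n2 * D_s n1) \<noteq> (0, 0, 0)"
      using dep0[OF True] dep0[where ma = "D_s n1" and mb = "D_s n2" and mc = "D_s n3"] weingarten curved by auto
    then show ?thesis by (rule orthogonal_to_independent_pair[OF _ nw kw[OF disjI2[OF refl]] wnz ndw kdw[OF disjI2[OF refl]]]) blast
  qed
  then show "\<exists>lam. d (d x1) = lam * d x1 \<and> d (d x2) = lam * d x2 \<and> d (d x3) = lam * d x3"
    by (simp add: w1_def w2_def w3_def)
qed

theorem ruled_if_parabolic: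
  assumes p: "e * g - f ^ 2 = 0" and curved: "(e, f, g) \<noteq> (0, 0, 0)"
  shows "is_ruled S"
proof -
  obtain \<alpha> \<beta> where ab: "\<alpha> * e + \<beta> * f = 0" "\<alpha> * f + \<beta> * g = 0" "(\<alpha>, \<beta>) \<noteq> (0, 0)"
  proof (cases "f = 0 \<and> g = 0")
    case True
    then show ?thesis using that[of 0 1] by simp
  next
    case False
    then show ?thesis using that[of "- g" f] p by (auto simp: power2_eq_square algebra_simps)
  qed
  have "derivation (\<lambda>r. \<alpha> * D_t r + \<beta> * D_s r)"
    unfolding derivation_along_def by (simp add: D_simps algebra_simps)
  note der = this
  let ?d = "\<lambda>r. \<alpha> * D_t r + \<beta> * D_s r"
  obtain lam where "?d (?d x1) = lam * ?d x1 \<and> ?d (?d x2) = lam * ?d x2 \<and> ?d (?d x3) = lam * ?d x3"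
    using null_direction_is_straight(2)[OF ab curved] by blast
  then show ?thesis
    by (intro ruled_if_straight_derivation[OF der _ null_direction_is_straight(1)[OF ab curved], where lam = lam]) auto
qed

text \<open>
  Here the null direction is that of \<open>s\<close>, so the \<open>s\<close>-lines are straight.
\<close>

theorem eta_eq_0_if_fg_zero:
  assumes "fg_zero x" and curved: "(e, f, g) \<noteq> (0, 0, 0)"
  shows "eta x = 0"
proof -
  have fg: "f = 0" "g = 0" using assms by (auto simp: fg_zero_def)
  have "\<exists>lam. ss1 = lam * b1 \<and> ss2 = lam * b2 \<and> ss3 = lam * b3"
    using null_direction_is_straight(2)[of 0 1] fg curved by (simp add: first_derivs second_derivs)
  then obtain lam where "ss1 = lam * b1" "ss2 = lam * b2" "ss3 = lam * b3" by blast
  then have "Gam_22_1 x = lam * (G * (b1 * a1 + b2 * a2 + b3 * a3) - F * (b1 * b1 + b2 * b2 + b3 * b3))"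
    unfolding christoffel by (simp add: algebra_simps)
  also have "\<dots> = 0" unfolding first_form by (simp add: algebra_simps)
  finally show ?thesis using fg by (simp add: eta_eq_0_iff)
qed

text \<open>
  If the coordinates are polynomials in two algebraically independent functions, then their relations
  hold identically in the two arguments.
\<close>

lemma vanishes_on_parametrized_set:
  assumes jac: "D_t A * D_s B - D_t B * D_s A \<noteq> 0"
    and x: "x1 = ev2 const_fun L1 A B" "x2 = ev2 const_fun L2 A B" "x3 = ev2 const_fun L3 A B"
    and H: "ev3 const_fun H x = 0"
  shows "poly3 H (poly2 L1 a b, poly2 L2 a b, poly2 L3 a b) = 0"
proof -
  define K where "K = ev3 (\<lambda>r. [:[:r:]:]) H (L1, L2, L3)"
  have c: "comm_ring_hom (\<lambda>r::real. [:[:r:]:])" by (rule comm_ring_homI) (auto simp: one_pCons)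
  have c2: "ev2 const_fun [:[:r:]:] A B = const_fun r" for r by (simp add: ev2_simps[OF hom_const_fun])
  have "ev2 const_fun K A B = ev3 const_fun H (ev2 const_fun L1 A B, ev2 const_fun L2 A B, ev2 const_fun L3 A B)"
    unfolding K_def by (subst hom_ev3[OF c comm_ring_hom_ev2[OF hom_const_fun]]) (simp add: c2)
  then have "ev2 const_fun K A B = 0" using H x by simp
  then have "K = 0" by (rule algebraically_independent_if_jacobian[OF jac])
  moreover have "poly2 K a b = poly3 H (poly2 L1 a b, poly2 L2 a b, poly2 L3 a b)"
    unfolding K_def using hom_ev3[OF c comm_ring_hom_ev2[OF comm_ring_hom_id], of H L1 L2 L3 a b]
    by (simp add: ev2_id ev3_id)
  ultimately show ?thesis by simp
qed

lemma solve_linear_equation: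
  fixes c c0 c1 c2 :: real
  assumes c: "c \<noteq> 0"
  defines "L \<equiv> [:[:c0 / c:]:] - [:[:c1 / c:]:] * [:[:0, 1:]:] - [:[:c2 / c:]:] * [:0, 1:]"
  shows "const_fun c1 * u + const_fun c2 * v + const_fun c * w = const_fun c0 \<Longrightarrow> ev2 const_fun L u v = w"
    and "c1 * a + c2 * b + c * r = c0 \<Longrightarrow> poly2 L a b = r"
proof -
  note h = hom_const_fun
  have q: "const_fun (k / c) = const_fun k / const_fun c" for k
    using c hom_props(4)[OF h, of "k / c" c] by (simp add: field_simps)
  assume "const_fun c1 * u + const_fun c2 * v + const_fun c * w = const_fun c0"
  then have "const_fun c0 - const_fun c1 * u - const_fun c2 * v = const_fun c * w" by (simp add: algebra_simps)
  moreover have "ev2 const_fun L u v = (const_fun c0 - const_fun c1 * u - const_fun c2 * v) / const_fun c"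
    unfolding L_def by (simp only: ev2_simps[OF h] q) (simp add: diff_divide_distrib)
  ultimately show "ev2 const_fun L u v = w" using c by simp
next
  assume "c1 * a + c2 * b + c * r = c0"
  then have "c0 - c1 * a - c2 * b = c * r" by (simp add: algebra_simps)
  moreover have "poly2 L a b = (c0 - c1 * a - c2 * b) / c"
    unfolding L_def by (simp only: poly2_simps) (simp add: diff_divide_distrib)
  ultimately show "poly2 L a b = r" using c by simp
qed

text \<open>
  The normal vector has constant direction, so the surface satisfies a linear equation.
  The surface is the whole plane, because two of its coordinates, chosen by a nonzero
  component of the normal vector, are algebraically independent and determine the third one.
\<close>

theorem plane_if_second_form_zero:
  assumes z: "e = 0" "f = 0" "g = 0"
  shows "is_plane S"
proof -
  have tz: "D_t n1 * a1 + D_t n2 * a2 + D_t n3 * a3 = 0" "D_t n1 * b1 + D_t n2 * b2 + D_t n3 * b3 = 0"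
    and sz: "D_s n1 * a1 + D_s n2 * a2 + D_s n3 * a3 = 0" "D_s n1 * b1 + D_s n2 * b2 + D_s n3 * b3 = 0"
    by (simp_all add: weingarten z)
  obtain \<nu> where nu: "D_t n1 = \<nu> * n1" "D_t n2 = \<nu> * n2" "D_t n3 = \<nu> * n3"
    by (rule parallel_to_normal[OF tz])
  obtain \<kappa> where ka: "D_s n1 = \<kappa> * n1" "D_s n2 = \<kappa> * n2" "D_s n3 = \<kappa> * n3"
    by (rule parallel_to_normal[OF sz])
  obtain m where m: "m \<in> {n1, n2, n3}" "m \<noteq> 0" using normal_nonzero by auto
  have par: "D_t n = \<nu> * n \<and> D_s n = \<kappa> * n" if "n \<in> {n1, n2, n3}" for n
    using that by (elim insertE emptyE) (simp_all add: nu ka)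
  have ratio: "\<exists>c. n = const_fun c * m" if n: "n \<in> {n1, n2, n3}" for n
  proof -
    define q where "q = n / m"
    have q: "n = q * m" using m by (simp add: q_def)
    have "D_t (q * m) = \<nu> * (q * m)" "D_s (q * m) = \<kappa> * (q * m)" "D_t m = \<nu> * m" "D_s m = \<kappa> * m"
      using par[OF n] par[OF m(1)] unfolding q by simp_all
    then have "D_t q * m = 0" "D_s q * m = 0" by (simp_all add: D_simps)
    then have "D_t (n / m) = 0" "D_s (n / m) = 0" using m by (auto simp: q_def)
    then obtain c where "n / m = const_fun c" by (rule constant_if_derivatives_vanish)
    then show ?thesis using m by (intro exI[of _ c]) (simp add: field_simps)
  qed
  have "\<exists>c. n1 = const_fun c * m" by (rule ratio) simp
  then obtain c1 where c1: "n1 = const_fun c1 * m" ..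
  have "\<exists>c. n2 = const_fun c * m" by (rule ratio) simp
  then obtain c2 where c2: "n2 = const_fun c2 * m" ..
  have "\<exists>c. n3 = const_fun c * m" by (rule ratio) simp
  then obtain c3 where c3: "n3 = const_fun c3 * m" ..
  note c = c1 c2 c3
  define k where "k = const_fun c1 * x1 + const_fun c2 * x2 + const_fun c3 * x3"
  have "m * D_t k = n1 * a1 + n2 * a2 + n3 * a3" "m * D_s k = n1 * b1 + n2 * b2 + n3 * b3"
  proof -
    have "D_t k = const_fun c1 * a1 + const_fun c2 * a2 + const_fun c3 * a3"
      "D_s k = const_fun c1 * b1 + const_fun c2 * b2 + const_fun c3 * b3"
      unfolding k_def D_simps first_derivs by simp_all
    then show "m * D_t k = n1 * a1 + n2 * a2 + n3 * a3" "m * D_s k = n1 * b1 + n2 * b2 + n3 * b3"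
      unfolding c by (simp_all only: ring_distribs ac_simps)
  qed
  then have "D_t k = 0" "D_s k = 0" using m by (simp_all add: normal_orthogonal)
  then obtain c0 where c0: "k = const_fun c0" by (rule constant_if_derivatives_vanish)
  note hc = hom_props[OF hom_const_fun]
  have plane: "c1 * p1 + c2 * p2 + c3 * p3 = c0" if P: "(p1, p2, p3) \<in> S" for p1 p2 p3
  proof -
    define H :: "real poly poly poly" where
      "H = [:[:[:c1:]:]:] * [:[:[:0, 1:]:]:] + [:[:[:c2:]:]:] * [:[:0, 1:]:] + [:[:[:c3:]:]:] * [:0, 1:] - [:[:[:c0:]:]:]"
    have "ev3 const_fun H x = k - const_fun c0"
      unfolding H_def k_def by (simp only: ev3_simps[OF hom_const_fun])
    then have "ev3 const_fun H x = 0" using c0 by simp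
    then have "poly3 H (p1, p2, p3) = 0" using P mem_S_iff by blast
    moreover have "poly3 H (p1, p2, p3) = c1 * p1 + c2 * p2 + c3 * p3 - c0"
      unfolding H_def by (simp only: poly3_simps poly3_gens)
    ultimately show ?thesis by simp
  qed
  have hx: "const_fun c1 * x1 + const_fun c2 * x2 + const_fun c3 * x3 = const_fun c0" using c0 by (simp add: k_def)
  have gX: "ev2 const_fun [:[:0, 1:]:] u v = u" and gY: "ev2 const_fun [:0, 1:] u v = v" for u v
    by (simp_all only: ev2_simps[OF hom_const_fun])
  have conv: "(p1, p2, p3) \<in> S" if P: "c1 * p1 + c2 * p2 + c3 * p3 = c0" for p1 p2 p3
    unfolding mem_S_iff
  proof (intro allI impI)
    fix H assume H: "ev3 const_fun H x = 0"
    from normal_nonzero consider "n3 \<noteq> 0" | "n1 \<noteq> 0" | "n2 \<noteq> 0" by auto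
    then show "poly3 H (p1, p2, p3) = 0"
    proof cases
      case 1
      then have jac: "D_t x1 * D_s x2 - D_t x2 * D_s x1 \<noteq> 0" by (simp add: n3_def first_derivs)
      have c3': "c3 \<noteq> 0" using 1 c by (auto simp: hc)
      let ?L = "[:[:c0 / c3:]:] - [:[:c1 / c3:]:] * [:[:0, 1:]:] - [:[:c2 / c3:]:] * [:0, 1:]"
      have "ev2 const_fun ?L x1 x2 = x3"
        by (rule solve_linear_equation(1)[OF c3']) (use hx in \<open>simp add: ac_simps\<close>)
      note vanish = vanishes_on_parametrized_set[OF jac gX[of x1 x2, symmetric] gY[of x1 x2, symmetric] this[symmetric] H]
      have "poly3 H (p1, p2, poly2 ?L p1 p2) = 0"
        using vanish[of p1 p2] by (simp only: poly2_simps)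
      moreover have "poly2 ?L p1 p2 = p3"
        by (rule solve_linear_equation(2)[OF c3']) (use P in \<open>simp add: ac_simps\<close>)
      ultimately show ?thesis by simp
    next
      case 2
      then have jac: "D_t x2 * D_s x3 - D_t x3 * D_s x2 \<noteq> 0" by (simp add: n1_def first_derivs)
      have c1': "c1 \<noteq> 0" using 2 c by (auto simp: hc)
      let ?L = "[:[:c0 / c1:]:] - [:[:c2 / c1:]:] * [:[:0, 1:]:] - [:[:c3 / c1:]:] * [:0, 1:]"
      have "ev2 const_fun ?L x2 x3 = x1"
        by (rule solve_linear_equation(1)[OF c1']) (use hx in \<open>simp add: ac_simps\<close>)
      note vanish = vanishes_on_parametrized_set[OF jac this[symmetric] gX[of x2 x3, symmetric] gY[of x2 x3, symmetric] H]
      have "poly3 H (poly2 ?L p2 p3, p2, p3) = 0"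
        using vanish[of p2 p3] by (simp only: poly2_simps)
      moreover have "poly2 ?L p2 p3 = p1"
        by (rule solve_linear_equation(2)[OF c1']) (use P in \<open>simp add: ac_simps\<close>)
      ultimately show ?thesis by simp
    next
      case 3
      then have jac: "D_t x3 * D_s x1 - D_t x1 * D_s x3 \<noteq> 0" by (simp add: n2_def first_derivs)
      have c2': "c2 \<noteq> 0" using 3 c by (auto simp: hc)
      let ?L = "[:[:c0 / c2:]:] - [:[:c3 / c2:]:] * [:[:0, 1:]:] - [:[:c1 / c2:]:] * [:0, 1:]"
      have "ev2 const_fun ?L x3 x1 = x2"
        by (rule solve_linear_equation(1)[OF c2']) (use hx in \<open>simp add: ac_simps\<close>)
      note vanish = vanishes_on_parametrized_set[OF jac gY[of x3 x1, symmetric] this[symmetric] gX[of x3 x1, symmetric] H]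
      have "poly3 H (p1, poly2 ?L p3 p1, p3) = 0"
        using vanish[of p3 p1] by (simp only: poly2_simps)
      moreover have "poly2 ?L p3 p1 = p2"
        by (rule solve_linear_equation(2)[OF c2']) (use P in \<open>simp add: ac_simps\<close>)
      ultimately show ?thesis by simp
    qed
  qed
  have "S = {(X1, X2, X3). c1 * X1 + c2 * X2 + c3 * X3 + (- c0) = 0}"
  proof (rule Set.set_eqI)
    fix P :: "real triple"
    show "P \<in> S \<longleftrightarrow> P \<in> {(X1, X2, X3). c1 * X1 + c2 * X2 + c3 * X3 + (- c0) = 0}"
    proof (cases P rule: prod_cases3)
      case (fields u v w)
      have "(u, v, w) \<in> S \<longleftrightarrow> c1 * u + c2 * v + c3 * w = c0" using plane[of u v w] conv[of u v w] by blast
      then show ?thesis by (simp add: fields)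
    qed
  qed
  moreover have "(c1, c2, c3) \<noteq> (0, 0, 0)" using normal_nonzero c by (auto simp: hc)
  ultimately show ?thesis unfolding is_plane_def by (intro exI conjI)
qed

end

section \<open>Asymptotic geodesics are straight lines\<close>

definition eval_ac :: "'a::field alg_closure \<Rightarrow> 'a poly \<Rightarrow> 'a alg_closure" where
  "eval_ac \<omega> p = poly (map_poly to_ac p) \<omega>"

lemma hom_eval_ac: "comm_ring_hom (eval_ac \<omega>)"
  unfolding eval_ac_def
  by (rule comm_ring_homI) (simp_all add: hom_props[OF comm_ring_hom_map_poly[OF hom_to_ac]])

lemmas eval_ac_props = hom_props[OF hom_eval_ac]

lemma eval_ac_pCons [simp]: "eval_ac \<omega> (pCons a p) = to_ac a + \<omega> * eval_ac \<omega> p"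
  by (simp add: eval_ac_def map_poly_pCons0)

lemma eval_ac_0 [simp]: "eval_ac \<omega> 0 = 0"
  by (simp add: eval_ac_def)

lemma eval_ac_smult [simp]: "eval_ac \<omega> (smult a p) = to_ac a * eval_ac \<omega> p"
  using eval_ac_props(4)[of \<omega> "[:a:]" p] by simp

text \<open>
  If \<open>d\<close> annihilates a polynomial \<open>M\<close> with simple root \<open>\<omega>\<close>, then \<open>d\<close> maps the minimal polynomial \<open>P\<close> of
  \<open>\<omega>\<close> to a multiple of \<open>P\<close>: write \<open>M = P Q\<close>, where \<open>Q\<close> does not vanish at \<open>\<omega>\<close>.  So \<open>d\<close> induces a
  derivation of the field generated by \<open>\<omega>\<close>.
\<close>

lemma derivation_preserves_kernel:
  fixes d :: "'a::field poly \<Rightarrow> 'a poly"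
  assumes d: "derivation d" and M: "d M = 0" "eval_ac \<omega> M = 0" and sep: "eval_ac \<omega> (pderiv M) \<noteq> 0"
    and h: "eval_ac \<omega> h = 0"
  shows "eval_ac \<omega> (d h) = 0"
proof -
  note [simp] = eval_ac_props derivation_props[OF d]
  define J where "J = {f. eval_ac \<omega> f = 0}"
  obtain P where P: "P \<in> J" "\<And>f. f \<in> J \<Longrightarrow> P dvd f"
    by (rule field_poly_ideal_principal[of J]) (simp_all add: J_def)
  then have P0: "eval_ac \<omega> P = 0" by (simp add: J_def)
  have "P dvd M" "P dvd h" using P(2) M h by (simp_all add: J_def)
  then obtain Q R where Q: "M = P * Q" and R: "h = P * R" by (auto elim!: dvdE)
  have "eval_ac \<omega> (pderiv P) * eval_ac \<omega> Q = eval_ac \<omega> (pderiv M)"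
    by (simp add: Q pderiv_mult P0 mult.commute)
  then have "eval_ac \<omega> Q \<noteq> 0" using sep by auto
  moreover have "eval_ac \<omega> (d P) * eval_ac \<omega> Q = eval_ac \<omega> (d M)"
    by (simp add: Q P0)
  ultimately have "eval_ac \<omega> (d P) = 0" using M by simp
  then show ?thesis by (simp add: R P0)
qed

context proper_surface
begin

abbreviation "geodesic_condition \<equiv> smult I (B_expr x) + A_expr x * geodesic_rhs x"

lemma gauss_formulas:
  "I * tt1 = Gam_11_1 x * a1 + Gam_11_2 x * b1 + e * n1 \<and>
   I * tt2 = Gam_11_1 x * a2 + Gam_11_2 x * b2 + e * n2 \<and>
   I * tt3 = Gam_11_1 x * a3 + Gam_11_2 x * b3 + e * n3"
  "I * ts1 = Gam_12_1 x * a1 + Gam_12_2 x * b1 + f * n1 \<and>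
   I * ts2 = Gam_12_1 x * a2 + Gam_12_2 x * b2 + f * n2 \<and>
   I * ts3 = Gam_12_1 x * a3 + Gam_12_2 x * b3 + f * n3"
  "I * ss1 = Gam_22_1 x * a1 + Gam_22_2 x * b1 + g * n1 \<and>
   I * ss2 = Gam_22_1 x * a2 + Gam_22_2 x * b2 + g * n2 \<and>
   I * ss3 = Gam_22_1 x * a3 + Gam_22_2 x * b3 + g * n3"
  using decomposition[of tt1 tt2 tt3] decomposition[of ts1 ts2 ts3] decomposition[of ss1 ss2 ss3]
  unfolding christoffel second_form by blast+

text \<open>
  On the roots of \<open>M_expr\<close>, its derivative \<open>A_expr\<close> is a square root of the discriminant.
\<close>

lemma A_eval_square:
  assumes "\<not> fg_zero x" "eval_ac \<omega> (M_expr x) = 0"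
  shows "eval_ac \<omega> (A_expr x) ^ 2 = 4 * to_ac (f ^ 2 - e * g)"
proof -
  have "eval_ac \<omega> (A_expr x) ^ 2 = 4 * to_ac (f ^ 2 - e * g) + 4 * to_ac g * eval_ac \<omega> (M_expr x)"
    using assms(1) by (simp add: A_expr_def M_expr_def power2_eq_square algebra_simps)
  then show ?thesis using assms(2) by simp
qed

text \<open>
  The first equation makes the direction \<open>x_t + \<omega> x_s\<close> asymptotic, and along it \<open>\<omega>\<close> has the derivative
  \<open>- B / A\<close>, as one sees by differentiating the equation.  The second equation then says that the
  tangential component of the acceleration is parallel to the direction.  So the acceleration
  is a multiple of the direction, and the curve is straight.
\<close>

theorem ruled_if_common_root:
  assumes fg: "\<not> fg_zero x" and hyp: "e * g - f ^ 2 \<noteq> 0"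
    and M: "eval_ac \<omega> (M_expr x) = 0" and N: "eval_ac \<omega> geodesic_condition = 0"
  shows "is_ruled S"
proof -
  let ?A = "A_expr x" and ?B = "B_expr x" and ?M = "M_expr x"
  let ?e = "eval_ac \<omega>"
  note ep = eval_ac_props
  have A: "?A = [:2 * f, 2 * g:]" using fg by (simp add: A_expr_def)
  have B: "?B = [:D_t e, 2 * D_t f + D_s e, 2 * D_s f + D_t g, D_s g:]" using fg by (simp add: B_expr_def Let_def)
  have A0: "?e ?A \<noteq> 0"
  proof
    assume "?e ?A = 0"
    then have "to_ac (f ^ 2 - e * g) = 0" using A_eval_square[OF fg M] by simp
    then have "f ^ 2 - e * g = 0" by (rule to_ac_eq_0_iff[THEN iffD1])
    then show False using hyp by simp
  qed
  \<comment> \<open>\<open>?A\<close> times the derivation \<open>d/dt\<close> along a curve whose direction \<open>\<omega>\<close> satisfies the equation \<open>?M = 0\<close>\<close>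
  define d where "d = (\<lambda>h. ?A * (map_poly D_t h + [:0, 1:] * map_poly D_s h) - ?B * pderiv h)"
  have dts: "derivation (map_poly D_t)" "derivation (map_poly D_s)"
    by (simp_all add: derivation_map_poly derivation_D_t derivation_D_s)
  have d: "derivation d"
    unfolding derivation_along_def d_def
    by (simp add: derivation_props[OF dts(1)] derivation_props[OF dts(2)] pderiv_add pderiv_mult algebra_simps)
  note mp = map_poly_pCons0[of D_t] map_poly_pCons0[of D_s]
  have dM: "d ?M = 0"
  proof -
    have "map_poly D_t ?M + [:0, 1:] * map_poly D_s ?M = ?B"
      unfolding B M_expr_def by (simp add: mp D_simps)
    moreover have "pderiv ?M = ?A" unfolding A M_expr_def by (simp add: pderiv_pCons)
    ultimately show ?thesis by (simp add: d_def)
  qed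
  have ker: "?e (d h) = 0" if "?e h = 0" for h
  proof (rule derivation_preserves_kernel[OF d dM M _ that])
    have "pderiv ?M = ?A" unfolding A M_expr_def by (simp add: pderiv_pCons)
    then show "?e (pderiv ?M) \<noteq> 0" using A0 by simp
  qed
  define c where "c = (\<lambda>r. [:const_fun r:])"
  have c: "comm_ring_hom c"
    unfolding c_def by (rule comm_ring_homI) (simp_all add: hom_props[OF hom_const_fun] one_pCons)
  have dc: "d (c r) = 0" for r by (simp add: d_def c_def mp D_simps pderiv_pCons)
  have dx: "?e (d [:y:]) = ?e ?A * ?e [:D_t y, D_s y:]" for y
    by (simp add: d_def ep mp D_simps pderiv_pCons algebra_simps)
  let ?U = "to_ac (Gam_11_1 x) + 2 * \<omega> * to_ac (Gam_12_1 x) + \<omega> ^ 2 * to_ac (Gam_22_1 x)"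
  let ?V = "to_ac (Gam_11_2 x) + 2 * \<omega> * to_ac (Gam_12_2 x) + \<omega> ^ 2 * to_ac (Gam_22_2 x)"
  have N': "?e ?A * ?V - to_ac I * ?e ?B = ?e ?A * ?U * \<omega>"
  proof -
    have "?e (geodesic_rhs x) = \<omega> * ?U - ?V"
      by (simp add: geodesic_rhs_def algebra_simps power2_eq_square)
    moreover have "?e geodesic_condition = to_ac I * ?e ?B + ?e ?A * ?e (geodesic_rhs x)"
      by (simp add: ep)
    ultimately have "to_ac I * ?e ?B + ?e ?A * (\<omega> * ?U - ?V) = 0" using N by simp
    then show ?thesis by (simp add: algebra_simps)
  qed
  have M': "to_ac e + 2 * \<omega> * to_ac f + \<omega> ^ 2 * to_ac g = 0"
    using M by (simp add: M_expr_def algebra_simps power2_eq_square)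
  have I0: "to_ac I \<noteq> 0" using I_nonzero by simp
  have dw: "?e (d [:a, b:]) = (?e ?A * ?U / to_ac I) * ?e [:a, b:]"
    if "I * D_t a = Gam_11_1 x * a + Gam_11_2 x * b + e * n" "I * D_s a = Gam_12_1 x * a + Gam_12_2 x * b + f * n"
      "I * D_s b = Gam_22_1 x * a + Gam_22_2 x * b + g * n" "D_t b = D_s a" for a b n
  proof -
    have k: "to_ac I * to_ac (D_t a) = to_ac (Gam_11_1 x) * to_ac a + to_ac (Gam_11_2 x) * to_ac b + to_ac e * to_ac n"
      "to_ac I * to_ac (D_s a) = to_ac (Gam_12_1 x) * to_ac a + to_ac (Gam_12_2 x) * to_ac b + to_ac f * to_ac n"
      "to_ac I * to_ac (D_s b) = to_ac (Gam_22_1 x) * to_ac a + to_ac (Gam_22_2 x) * to_ac b + to_ac g * to_ac n"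
      by (simp_all only: to_ac_mult[symmetric] to_ac_add[symmetric] that)
    have ed: "?e (d [:a, b:]) = ?e ?A * (to_ac (D_t a) + 2 * \<omega> * to_ac (D_s a) + \<omega> ^ 2 * to_ac (D_s b)) - ?e ?B * to_ac b"
      by (simp add: d_def ep mp D_simps pderiv_pCons that(4) algebra_simps power2_eq_square)
    have "to_ac I * ?e (d [:a, b:]) = ?e ?A * (to_ac I * to_ac (D_t a) + 2 * \<omega> * (to_ac I * to_ac (D_s a))
        + \<omega> ^ 2 * (to_ac I * to_ac (D_s b))) - to_ac I * ?e ?B * to_ac b"
      unfolding ed by (simp add: algebra_simps)
    also have "\<dots> = ?e ?A * ?U * to_ac a + (?e ?A * ?V - to_ac I * ?e ?B) * to_ac b
        + ?e ?A * to_ac n * (to_ac e + 2 * \<omega> * to_ac f + \<omega> ^ 2 * to_ac g)"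
      unfolding k by (simp add: algebra_simps)
    also have "\<dots> = ?e ?A * ?U * ?e [:a, b:]" unfolding N' M' by (simp add: algebra_simps)
    finally show ?thesis using I0 by (simp add: field_simps)
  qed
  have ec: "?e (c r) = to_ac (const_fun r)" for r by (simp add: c_def)
  have w: "?e [:a, b:] = to_ac a + \<omega> * to_ac b" for a b by simp
  show ?thesis
  proof (rule ruled_if_lines_over_closure)
    show "(?e [:a1, b1:], ?e [:a2, b2:], ?e [:a3, b3:]) \<noteq> (0, 0, 0)"
    proof
      assume "(?e [:a1, b1:], ?e [:a2, b2:], ?e [:a3, b3:]) = (0, 0, 0)"
      then have "to_ac a1 = - \<omega> * to_ac b1" "to_ac a2 = - \<omega> * to_ac b2" "to_ac a3 = - \<omega> * to_ac b3"
        by (simp_all add: eq_neg_iff_add_eq_0)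
      then have "to_ac n1 = 0" "to_ac n2 = 0" "to_ac n3 = 0"
        unfolding n1_def n2_def n3_def by (simp_all only: to_ac_diff to_ac_mult) simp_all
      then show False using normal_nonzero by simp
    qed
    fix H l
    assume H: "ev3 const_fun H x = 0"
    have pc: "comm_ring_hom (\<lambda>r::ratfun. [:r:])" by (rule comm_ring_homI) (auto simp: one_pCons)
    have H': "?e (ev3 c H ([:x1:], [:x2:], [:x3:])) = 0"
      using hom_ev3[OF hom_const_fun pc, of H x1 x2 x3, symmetric] H by (simp add: c_def)
    have "ev3 (\<lambda>r. ?e (c r)) H (?e [:x1:] + l * ?e [:a1, b1:], ?e [:x2:] + l * ?e [:a2, b2:], ?e [:x3:] + l * ?e [:a3, b3:]) = 0"
    proof (rule osculating_line[OF hom_eval_ac d c ker dc _ _ _ _ _ _ A0 H'])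
      show "?e (d [:x1:]) = ?e ?A * ?e [:a1, b1:]" "?e (d [:x2:]) = ?e ?A * ?e [:a2, b2:]"
        "?e (d [:x3:]) = ?e ?A * ?e [:a3, b3:]"
        using dx[of x1] dx[of x2] dx[of x3] unfolding first_derivs .
      show "?e (d [:a1, b1:]) = (?e ?A * ?U / to_ac I) * ?e [:a1, b1:]"
        by (rule dw[of _ _ n1]) (use gauss_formulas in \<open>simp_all add: second_derivs D_t_b\<close>)
      show "?e (d [:a2, b2:]) = (?e ?A * ?U / to_ac I) * ?e [:a2, b2:]"
        by (rule dw[of _ _ n2]) (use gauss_formulas in \<open>simp_all add: second_derivs D_t_b\<close>)
      show "?e (d [:a3, b3:]) = (?e ?A * ?U / to_ac I) * ?e [:a3, b3:]"
        by (rule dw[of _ _ n3]) (use gauss_formulas in \<open>simp_all add: second_derivs D_t_b\<close>)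
    qed
    then show "ev3 (\<lambda>r. to_ac (const_fun r)) H
        (to_ac x1 + l * ?e [:a1, b1:], to_ac x2 + l * ?e [:a2, b2:], to_ac x3 + l * ?e [:a3, b3:]) = 0"
      by (simp add: ec)
  qed
qed

end

section \<open>The vanishing of \<open>\<mu>\<close>\<close>

text \<open>
  Over a factorial ring a vanishing resultant means a common factor of positive degree, which is a
  common root over the algebraic closure of the fraction field.
\<close>

lemma resultant_eq_0_iff_common_root:
  fixes p q :: "real poly poly poly"
  assumes p: "p \<noteq> 0"
  shows "resultant p q = 0 \<longleftrightarrow> (\<exists>\<omega>. eval_ac \<omega> (fract_poly p) = 0 \<and> eval_ac \<omega> (fract_poly q) = 0)"
proof -
  define H where "H = (\<lambda>c :: real poly poly. to_ac (to_fract c))"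
  have H: "comm_ring_hom H" unfolding H_def by (rule comm_ring_hom_o[OF hom_to_fract hom_to_ac])
  have inj: "inj H" by (rule injI) (simp add: H_def)
  interpret H: comm_ring_hom H by (rule H)
  interpret H: inj_comm_ring_hom H
    by unfold_locales (auto simp: H_def)
  have ev: "eval_ac \<omega> (fract_poly r) = poly (map_poly H r) \<omega>" for \<omega> r
    by (simp add: eval_ac_def H_def map_poly_map_poly o_def)
  have deg: "degree (map_poly H r) = degree r" for r
    by (rule degree_map_poly) (simp add: H_def)
  have Hm: "map_poly H (r * s) = map_poly H r * map_poly H s" for r s
    using hom_props(4)[OF comm_ring_hom_map_poly[OF H]] .
  show ?thesis
  proof
    assume "resultant p q = 0"
    then have "degree (gcd p q) \<noteq> 0" by (simp add: resultant_0_gcd)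
    then obtain \<omega> where w: "poly (map_poly H (gcd p q)) \<omega> = 0"
      using alg_closed_imp_poly_has_root[of "map_poly H (gcd p q)"] deg by auto
    have root: "poly (map_poly H r) \<omega> = 0" if "gcd p q dvd r" for r
    proof -
      from that obtain s where "r = gcd p q * s" by (rule dvdE)
      then show ?thesis using w by (simp add: Hm)
    qed
    show "\<exists>\<omega>. eval_ac \<omega> (fract_poly p) = 0 \<and> eval_ac \<omega> (fract_poly q) = 0"
      unfolding ev using root by (intro exI[of _ \<omega>]) simp
  next
    assume "\<exists>\<omega>. eval_ac \<omega> (fract_poly p) = 0 \<and> eval_ac \<omega> (fract_poly q) = 0"
    then obtain \<omega> where "[:- \<omega>, 1:] dvd map_poly H p" "[:- \<omega>, 1:] dvd map_poly H q"
      unfolding ev poly_eq_0_iff_dvd by blast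
    then have "[:- \<omega>, 1:] dvd gcd (map_poly H p) (map_poly H q)" by simp
    moreover have "map_poly H p \<noteq> 0" using p by (simp add: H_def)
    then have "gcd (map_poly H p) (map_poly H q) \<noteq> 0" by simp
    ultimately have "degree [:- \<omega>, 1:] \<le> degree (gcd (map_poly H p) (map_poly H q))" by (rule dvd_imp_degree_le)
    then have "resultant (map_poly H p) (map_poly H q) = 0" by (simp add: resultant_0_gcd)
    then have "H (resultant p q) = 0" by (simp add: H.resultant_hom)
    then show "resultant p q = 0" by (simp add: H_def)
  qed
qed

text \<open>
  The embedding of \<open>\<real>(t,s)\<close> into \<open>\<real>(t,s,\<omega>)\<close> that \<open>to_ratfun3\<close> uses on coefficients.
\<close>

definition const_ratfun3 :: "ratfun \<Rightarrow> ratfun3" where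
  "const_ratfun3 r = Fract [:numer r:] [:denom r:]"

lemma const_ratfun3_Fract:
  assumes "q \<noteq> 0"
  shows "const_ratfun3 (Fract p q) = Fract [:p:] [:q:]"
  unfolding const_ratfun3_def using assms numer_denom_Fract[OF assms, of p]
  by (simp add: eq_fract mult.commute)

lemma hom_const_ratfun3: "comm_ring_hom const_ratfun3"
proof (rule comm_ring_homI)
  show "const_ratfun3 1 = 1"
    using const_ratfun3_Fract[of 1 1] by (simp add: One_fract_def[symmetric] one_pCons[symmetric])
  fix a b :: ratfun
  obtain p q where a: "a = Fract p q" "q \<noteq> 0" by (cases a)
  obtain r s where b: "b = Fract r s" "s \<noteq> 0" by (cases b)
  show "const_ratfun3 (a + b) = const_ratfun3 a + const_ratfun3 b"
    using a b by (simp add: const_ratfun3_Fract mult.commute)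
  show "const_ratfun3 (a * b) = const_ratfun3 a * const_ratfun3 b"
    using a b by (simp add: const_ratfun3_Fract mult.commute)
qed

lemma to_ratfun3_eq: "to_ratfun3 p = poly (map_poly const_ratfun3 p) (to_fract [:0, 1:])"
  by (simp add: to_ratfun3_def const_ratfun3_def[abs_def])

lemma hom_to_ratfun3: "comm_ring_hom to_ratfun3"
  unfolding to_ratfun3_eq[abs_def]
  by (rule comm_ring_homI) (simp_all add: hom_props[OF comm_ring_hom_map_poly[OF hom_const_ratfun3]])

lemmas to_ratfun3_props = hom_props[OF hom_to_ratfun3]

lemma to_ratfun3_const: "to_ratfun3 [:r:] = const_ratfun3 r"
  by (simp add: to_ratfun3_eq map_poly_pCons0 hom_props[OF hom_const_ratfun3])

lemma to_ratfun3_fract_poly: "to_ratfun3 (fract_poly q) = to_fract q"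
proof (induction q)
  case (pCons a q)
  have "const_ratfun3 (to_fract a) = to_fract [:a:]"
    using const_ratfun3_Fract[of 1 a] by (simp add: to_fract_def one_pCons)
  moreover have "to_ratfun3 (pCons (to_fract a) (fract_poly q)) = const_ratfun3 (to_fract a) + to_fract [:0, 1:] * to_ratfun3 (fract_poly q)"
    by (simp add: to_ratfun3_eq map_poly_pCons0 hom_props[OF hom_const_ratfun3])
  moreover have "to_fract (pCons a q) = to_fract [:a:] + to_fract [:0, 1:] * to_fract q"
    unfolding to_fract_add[symmetric] to_fract_mult[symmetric] by simp
  ultimately show ?case using pCons.IH by (simp only: map_poly_pCons0[of to_fract] to_fract_0)
qed (simp add: to_ratfun3_props)

text \<open>
  Clearing denominators and dividing by the content.
\<close>

lemma ratfun_poly_cases: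
  fixes p :: "ratfun poly"
  obtains k q where "p = smult k (fract_poly q)" "k \<noteq> 0"
proof (cases "p = 0")
  case True
  then show ?thesis using that[of 1 0] by simp
next
  case False
  have "p = smult (fract_content p) (fract_poly (primitive_part_fract p))"
    by (rule content_times_primitive_part_fract[symmetric])
  then show ?thesis by (rule that) (simp add: False)
qed

lemma to_ratfun3_smult: "to_ratfun3 (smult k p) = const_ratfun3 k * to_ratfun3 p"
  using to_ratfun3_props(4)[of "[:k:]" p] by (simp add: to_ratfun3_const)

lemma const_ratfun3_eq_0_iff: "const_ratfun3 k = 0 \<longleftrightarrow> k = 0"
  by (simp add: const_ratfun3_def Zero_fract_def eq_fract)

lemma to_ratfun3_eq_0_iff: "to_ratfun3 p = 0 \<longleftrightarrow> p = 0"
proof -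
  obtain k q where p: "p = smult k (fract_poly q)" "k \<noteq> 0" by (rule ratfun_poly_cases)
  then show ?thesis by (simp add: to_ratfun3_smult to_ratfun3_fract_poly const_ratfun3_eq_0_iff)
qed

lemma to_fract_numer_eq: "to_fract (numer r) = r * to_fract (denom r)"
proof -
  have 1: "to_fract (numer r) / to_fract (denom r) = r"
    unfolding Fract_conv_to_fract[symmetric] by (rule Fract_numer_denom)
  have 2: "to_fract (denom r) \<noteq> 0" by simp
  show ?thesis using 1 unfolding nonzero_divide_eq_eq[OF 2] .
qed

lemma denom_to_ratfun3_dvd:
  fixes p :: "ratfun poly" and a b :: "ratfun poly"
  assumes b: "b \<noteq> 0"
  shows "fract_poly (denom (to_ratfun3 a / to_ratfun3 b)) dvd b"
proof -
  obtain k p where p: "a = smult k (fract_poly p)" "k \<noteq> 0" by (rule ratfun_poly_cases)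
  obtain l q where q: "b = smult l (fract_poly q)" "l \<noteq> 0" by (rule ratfun_poly_cases)
  have q0: "q \<noteq> 0" using b q by auto
  have "k / l = to_fract (numer (k / l)) / to_fract (denom (k / l))" by (rule ratfun_quotient)
  have cd: "const_ratfun3 k / const_ratfun3 l = const_ratfun3 (k / l)"
    using hom_props(4)[OF hom_const_ratfun3, of "k / l" l] q(2)
    by (simp add: const_ratfun3_eq_0_iff field_simps)
  have "to_ratfun3 a / to_ratfun3 b = (const_ratfun3 k / const_ratfun3 l) * (to_fract p / to_fract q)"
    by (simp add: p q to_ratfun3_smult to_ratfun3_fract_poly)
  also have "\<dots> = Fract ([:numer (k / l):] * p) ([:denom (k / l):] * q)"
    unfolding cd by (simp add: const_ratfun3_def Fract_conv_to_fract[symmetric])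
  finally have "denom (to_ratfun3 a / to_ratfun3 b) dvd [:denom (k / l):] * q"
    using denom_Fract_dvd[of "[:denom (k / l):] * q"] q0 by simp
  then have "fract_poly (denom (to_ratfun3 a / to_ratfun3 b)) dvd fract_poly (smult (denom (k / l)) q)"
    by (intro fract_poly_dvd) simp
  then have "fract_poly (denom (to_ratfun3 a / to_ratfun3 b)) dvd smult (to_fract (denom (k / l))) (fract_poly q)"
    by simp
  then have "fract_poly (denom (to_ratfun3 a / to_ratfun3 b)) dvd fract_poly q"
    by (simp add: dvd_smult_iff)
  then show ?thesis using q by (simp add: dvd_smult)
qed

lemma numer_denom_to_ratfun3_quotient:
  assumes b: "b \<noteq> 0"
  shows "fract_poly (numer (to_ratfun3 a / to_ratfun3 b)) * b = fract_poly (denom (to_ratfun3 a / to_ratfun3 b)) * a"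
proof -
  let ?r = "to_ratfun3 a / to_ratfun3 b"
  have "to_ratfun3 (fract_poly (numer ?r) * b - fract_poly (denom ?r) * a) = 0"
    using b to_fract_numer_eq[of ?r] by (simp add: to_ratfun3_props to_ratfun3_fract_poly to_ratfun3_eq_0_iff)
  then show ?thesis unfolding to_ratfun3_eq_0_iff by simp
qed

text \<open>
  Writing a quotient in lowest terms may cancel a common factor, but it divides \<open>b\<close>; so roots at which \<open>b\<close>
  does not vanish are not affected.
\<close>

lemma root_numer_quotient_iff:
  assumes b: "eval_ac \<omega> b \<noteq> 0"
  shows "eval_ac \<omega> (fract_poly (numer (to_ratfun3 a / to_ratfun3 b))) = 0 \<longleftrightarrow> eval_ac \<omega> a = 0"
proof -
  let ?r = "to_ratfun3 a / to_ratfun3 b"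
  have b0: "b \<noteq> 0" using b by auto
  obtain c where "b = fract_poly (denom ?r) * c" using denom_to_ratfun3_dvd[OF b0] by (rule dvdE)
  then have "eval_ac \<omega> b = eval_ac \<omega> (fract_poly (denom ?r) * c)" by (rule arg_cong)
  then have "eval_ac \<omega> b = eval_ac \<omega> (fract_poly (denom ?r)) * eval_ac \<omega> c" by (simp only: eval_ac_props)
  then have d: "eval_ac \<omega> (fract_poly (denom ?r)) \<noteq> 0" using b by auto
  have "eval_ac \<omega> (fract_poly (numer ?r)) * eval_ac \<omega> b = eval_ac \<omega> (fract_poly (denom ?r)) * eval_ac \<omega> a"
    using arg_cong[OF numer_denom_to_ratfun3_quotient[OF b0, of a], of "eval_ac \<omega>"] by (simp only: eval_ac_props)
  then show ?thesis using b d by auto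
qed

lemma root_primitive_part_iff:
  assumes "p \<noteq> 0"
  shows "eval_ac \<omega> (fract_poly (primitive_part p)) = 0 \<longleftrightarrow> eval_ac \<omega> (fract_poly p) = 0"
proof -
  have "fract_poly p = smult (to_fract (content p)) (fract_poly (primitive_part p))"
    unfolding fract_poly_smult[symmetric] content_times_primitive_part ..
  then show ?thesis using assms by simp
qed

lemma zero_notin_prime_factors: "(0::real poly poly) \<notin># prime_factorization p"
proof
  assume "0 \<in># prime_factorization p"
  from in_prime_factors_imp_prime[OF this] show False by simp
qed

lemma sqfree_part_eq_0_iff: "sqfree_part p = 0 \<longleftrightarrow> p = 0"
proof -
  have "\<Prod>(prime_factors p) \<noteq> 0"
    unfolding prod_zero_iff[OF finite_set_mset] using zero_notin_prime_factors[of p] by simp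
  then show ?thesis by (simp add: sqfree_part_def)
qed

lemma remove_factors_eq_0_iff: "remove_factors D p = 0 \<longleftrightarrow> p = 0"
proof -
  have "prod_mset (filter_mset (\<lambda>q. \<not> (\<exists>d \<in> D. q dvd d)) (prime_factorization p)) \<noteq> 0"
    unfolding prod_mset_zero_iff using zero_notin_prime_factors[of p] by simp
  then show ?thesis unfolding remove_factors_def by simp
qed

context proper_surface
begin

text \<open>
  Contents, primitive parts, removed factors and the passage to the square-free part only change nonzero
  factors, and \<open>A_expr\<close> and the normal vector are not zero.  What remains of \<open>\<mu>\<close> is the discriminant of
  \<open>M_expr\<close> and the resultant.  In the nonparabolic case \<open>A_expr\<close> does not vanish at the roots of
  \<open>M_expr\<close>, so that substituting \<open>- B / A\<close> and clearing denominators neither creates nor loses common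
  roots.
\<close>

lemma mu_eq_0_iff:
  assumes fg: "\<not> fg_zero x"
  shows "mu x = 0 \<longleftrightarrow> e * g - f ^ 2 = 0 \<or>
    (\<exists>\<omega>. eval_ac \<omega> (M_expr x) = 0 \<and> eval_ac \<omega> geodesic_condition = 0)"
proof (cases "e * g - f ^ 2 = 0")
  case True
  then show ?thesis using fg by (simp add: mu_def delta3_def sqfree_part_eq_0_iff)
next
  case False
  have A: "A_expr x = [:2 * f, 2 * g:]" using fg by (simp add: A_expr_def)
  have fg0: "f \<noteq> 0 \<or> g \<noteq> 0" using fg by (simp add: fg_zero_def)
  have A0: "A_expr x \<noteq> 0" using fg0 by (auto simp: A)
  have Mnz: "M_expr x \<noteq> 0" using fg0 by (auto simp: M_expr_def)
  have degM: "degree (M_expr x) \<noteq> 0" using fg0 by (auto simp: M_expr_def)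
  have Aroot: "eval_ac \<omega> (A_expr x) \<noteq> 0" if "eval_ac \<omega> (M_expr x) = 0" for \<omega>
  proof
    assume "eval_ac \<omega> (A_expr x) = 0"
    then have "to_ac (f ^ 2 - e * g) = 0" using A_eval_square[OF fg that] by simp
    then have "f ^ 2 - e * g = 0" by (rule to_ac_eq_0_iff[THEN iffD1])
    then show False using False by simp
  qed
  have Mt: "M_tilde x \<noteq> 0" using Mnz by (simp add: M_tilde_def to_ratfun3_eq_0_iff)
  have Mroot: "eval_ac \<omega> (fract_poly (M_tilde x)) = 0 \<longleftrightarrow> eval_ac \<omega> (M_expr x) = 0" for \<omega>
    using root_numer_quotient_iff[of \<omega> 1 "M_expr x"] by (simp add: M_tilde_def to_ratfun3_props eval_ac_props)
  have Nt: "N_tilde x = numer (to_ratfun3 (- geodesic_condition) / to_ratfun3 (A_expr x))"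
  proof -
    have "to_ratfun3 [:I:] * - (to_ratfun3 (B_expr x) / to_ratfun3 (A_expr x)) - to_ratfun3 (geodesic_rhs x)
      = to_ratfun3 (- geodesic_condition) / to_ratfun3 (A_expr x)"
      using A0 by (simp add: to_ratfun3_props to_ratfun3_smult to_ratfun3_const to_ratfun3_eq_0_iff field_simps)
    then show ?thesis by (simp add: N_tilde_def Let_def)
  qed
  have Nroot: "eval_ac \<omega> (fract_poly (N_tilde x)) = 0 \<longleftrightarrow> eval_ac \<omega> geodesic_condition = 0"
    if "eval_ac \<omega> (M_expr x) = 0" for \<omega>
    unfolding Nt root_numer_quotient_iff[OF Aroot[OF that]] by (simp only: eval_ac_props(6)) simp
  have "mu x = 0 \<longleftrightarrow> xi_tilde x = 0 \<or> N_tilde x = 0"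
    using fg False Mt A0 normal_square_nonzero
    by (auto simp: mu_def sqfree_part_eq_0_iff xi_def remove_factors_eq_0_iff delta1_def delta2_def delta3_def delta4_def
        to_ratfun3_eq_0_iff)
  also have "\<dots> \<longleftrightarrow> (\<exists>\<omega>. eval_ac \<omega> (M_expr x) = 0 \<and> eval_ac \<omega> geodesic_condition = 0)"
  proof (cases "N_tilde x = 0")
    case True
    obtain \<omega> where w: "eval_ac \<omega> (M_expr x) = 0"
      using alg_closed_imp_poly_has_root[of "map_poly to_ac (M_expr x)"] degM
      by (auto simp: eval_ac_def degree_map_poly)
    then show ?thesis using Nroot[OF w] True by auto
  next
    case Nnz: False
    have "xi_tilde x = 0 \<longleftrightarrow> resultant (primitive_part (M_tilde x)) (primitive_part (N_tilde x)) = 0"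
      using Nnz by (simp add: xi_tilde_def Let_def)
    also have "\<dots> \<longleftrightarrow> (\<exists>\<omega>. eval_ac \<omega> (M_expr x) = 0 \<and> eval_ac \<omega> geodesic_condition = 0)"
      using Mt Nnz resultant_eq_0_iff_common_root[of "primitive_part (M_tilde x)" "primitive_part (N_tilde x)"] Nroot
      by (auto simp: root_primitive_part_iff Mroot)
    finally show ?thesis using Nnz by simp
  qed
  finally show ?thesis using False by blast
qed

end

section \<open>Polynomials over the rational functions at a point\<close>

text \<open>
  Coefficients of this identity can be evaluated at a point, while a statement about roots in the algebraic
  closure cannot.
\<close>

lemma bezout_if_no_common_root:
  fixes p q :: "'a::field poly"
  assumes "\<And>\<omega>. eval_ac \<omega> p = 0 \<Longrightarrow> eval_ac \<omega> q \<noteq> 0"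
  obtains u v where "u * p + v * q = 1"
proof -
  define J where "J = {u * p + v * q |u v. True}"
  have J: "u * p + v * q \<in> J" for u v by (auto simp: J_def)
  have J0: "0 \<in> J" using J[of 0 0] by simp
  have Jadd: "f + g \<in> J" if fg: "f \<in> J" "g \<in> J" for f g
  proof -
    obtain u v u' v' where "f = u * p + v * q" "g = u' * p + v' * q" using fg unfolding J_def by blast
    then have "f + g = (u + u') * p + (v + v') * q" by (simp add: algebra_simps)
    then show ?thesis using J by simp
  qed
  have Jmult: "f * g \<in> J" if g: "g \<in> J" for f g
  proof -
    obtain u' v' where "g = u' * p + v' * q" using g unfolding J_def by blast
    then have "f * g = (f * u') * p + (f * v') * q" by (simp add: algebra_simps)
    then show ?thesis using J by simp
  qed
  obtain d where d: "d \<in> J" and dvd: "\<And>f. f \<in> J \<Longrightarrow> d dvd f"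
    by (rule field_poly_ideal_principal[of J, OF J0 Jadd Jmult]) auto
  have root: "eval_ac \<omega> p = 0 \<and> eval_ac \<omega> q = 0" if "eval_ac \<omega> d = 0" for \<omega>
  proof -
    have "d dvd p" "d dvd q" using dvd J[of 1 0] J[of 0 1] by simp_all
    then show ?thesis using that by (auto elim!: dvdE simp: eval_ac_props)
  qed
  then have no: "eval_ac \<omega> d \<noteq> 0" for \<omega> using assms by blast
  have "degree d = 0"
  proof (rule ccontr)
    assume "degree d \<noteq> 0"
    then have "degree (map_poly to_ac d) > 0" by (simp add: degree_map_poly)
    then show False using alg_closed_imp_poly_has_root no by (auto simp: eval_ac_def)
  qed
  then obtain k where k: "d = [:k:]" by (rule degree_eq_zeroE)
  have "k \<noteq> 0" using no[of 0] k by simp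
  then have one: "[:1 / k:] * d = 1" by (simp add: k one_pCons)
  obtain u v where "d = u * p + v * q" using d unfolding J_def by blast
  then have "([:1 / k:] * u) * p + ([:1 / k:] * v) * q = 1" using one by (simp add: algebra_simps)
  then show ?thesis by (rule that)
qed

definition coeffs_regular :: "ratfun poly \<Rightarrow> 'a::real_field \<Rightarrow> 'a \<Rightarrow> bool" where
  "coeffs_regular p t s \<longleftrightarrow> (\<forall>i. regular (coeff p i) t s)"

definition poly_at :: "'a::real_field \<Rightarrow> 'a \<Rightarrow> ratfun poly \<Rightarrow> 'a poly" where
  "poly_at t s p = map_poly (\<lambda>r. val r t s) p"

lemma coeffs_regular_0 [simp]: "coeffs_regular 0 t s"
  by (simp add: coeffs_regular_def)

lemma coeffs_regular_pCons [simp]: "coeffs_regular (pCons a p) t s \<longleftrightarrow> regular a t s \<and> coeffs_regular p t s"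
proof
  assume "coeffs_regular (pCons a p) t s"
  then have c: "regular (coeff (pCons a p) i) t s" for i by (simp add: coeffs_regular_def)
  show "regular a t s \<and> coeffs_regular p t s"
    using c[of 0] c[of "Suc _"] by (simp add: coeffs_regular_def)
next
  assume "regular a t s \<and> coeffs_regular p t s"
  then show "coeffs_regular (pCons a p) t s"
    by (auto simp: coeffs_regular_def coeff_pCons split: nat.splits)
qed

lemma coeffs_regular_add [simp]: "coeffs_regular p t s \<Longrightarrow> coeffs_regular q t s \<Longrightarrow> coeffs_regular (p + q) t s"
  by (simp add: coeffs_regular_def)

lemma coeffs_regular_smult [simp]: "regular a t s \<Longrightarrow> coeffs_regular p t s \<Longrightarrow> coeffs_regular (smult a p) t s"
  by (simp add: coeffs_regular_def)

lemma coeffs_regular_mult [simp]: "coeffs_regular p t s \<Longrightarrow> coeffs_regular q t s \<Longrightarrow> coeffs_regular (p * q) t s"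
  by (induction p) simp_all

lemma poly_at_0 [simp]: "poly_at t s 0 = 0"
  by (simp add: poly_at_def)

lemma poly_at_pCons [simp]: "poly_at t s (pCons a p) = pCons (val a t s) (poly_at t s p)"
  by (simp add: poly_at_def map_poly_pCons0)

lemma poly_at_add:
  "coeffs_regular p t s \<Longrightarrow> coeffs_regular q t s \<Longrightarrow> poly_at t s (p + q) = poly_at t s p + poly_at t s q"
  by (rule poly_eqI) (simp add: poly_at_def coeff_map_poly coeffs_regular_def val_add)

lemma poly_at_smult:
  "regular a t s \<Longrightarrow> coeffs_regular p t s \<Longrightarrow> poly_at t s (smult a p) = smult (val a t s) (poly_at t s p)"
  by (rule poly_eqI) (simp add: poly_at_def coeff_map_poly coeffs_regular_def val_mult)

lemma poly_at_mult:
  "coeffs_regular p t s \<Longrightarrow> coeffs_regular q t s \<Longrightarrow> poly_at t s (p * q) = poly_at t s p * poly_at t s q"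
  by (induction p) (simp_all add: poly_at_add poly_at_smult)

lemma generically_coeffs_regular: "generically (\<lambda>t s. coeffs_regular p (complex_of_real t) (complex_of_real s))"
proof (induction p)
  case 0
  have "generically (\<lambda>t s. True)" using generically_mono[OF generically_regular[of 0]] by simp
  then show ?case by simp
next
  case (pCons a p)
  then show ?case using generically_conj[OF generically_regular[of a] pCons.IH] by simp
qed

section \<open>Lines on a ruled surface are asymptotic geodesics\<close>

lemma has_field_derivative_ev2:
  fixes T V :: "complex \<Rightarrow> complex"
  assumes T: "(T has_field_derivative T') (at l)" and V: "(V has_field_derivative V') (at l)"
  shows "((\<lambda>l. ev2 of_real p (T l) (V l)) has_field_derivative
    ev2 of_real (map_poly pderiv p) (T l) (V l) * T' + ev2 of_real (pderiv p) (T l) (V l) * V') (at l)"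
proof -
  note h = ev2_simps[OF hom_of_real]
  note dp = derivation_props[OF derivation_pderiv] derivation_props[OF derivation_map_poly[OF derivation_pderiv]]
  have e1: "ev2 of_real [:1:] a b = (1::complex)" for a b by (simp add: one_pCons[symmetric] h)
  show ?thesis
  proof (induction p rule: poly2_induct)
    case (const r)
    show ?case by (simp add: h map_poly_pCons0 pderiv_pCons)
  next
    case X
    show ?case using T by (simp add: h map_poly_pCons0 pderiv_pCons)
  next
    case Y
    show ?case using V by (simp add: h map_poly_pCons0 pderiv_pCons e1)
  next
    case (add p q)
    show ?case unfolding h dp by (rule DERIV_cong[OF DERIV_add[OF add]]) (simp add: algebra_simps)
  next
    case (mult p q)
    show ?case unfolding h dp by (rule DERIV_cong[OF DERIV_mult[OF mult]]) (simp add: algebra_simps)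
  qed
qed

lemma has_field_derivative_val:
  fixes T V :: "complex \<Rightarrow> complex"
  assumes T: "(T has_field_derivative T') (at l)" and V: "(V has_field_derivative V') (at l)"
    and r: "regular r (T l) (V l)"
  shows "((\<lambda>l. val r (T l) (V l)) has_field_derivative
    val (D_t r) (T l) (V l) * T' + val (D_s r) (T l) (V l) * V') (at l)"
proof -
  note h = ev2_simps[OF hom_of_real]
  let ?n = "numer r" and ?d = "denom r"
  let ?E = "\<lambda>p. ev2 of_real p (T l) (V l)"
  have d: "?E ?d \<noteq> 0" using r by (simp add: ev_den_ev2)
  then have d2: "?E (?d ^ 2) \<noteq> 0" by (simp add: h power2_eq_square)
  have D: "val (fract_deriv D r) (T l) (V l) = (?E (D ?n) * ?E ?d - ?E ?n * ?E (D ?d)) / (?E ?d * ?E ?d)" for D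
    unfolding fract_deriv_def using regular_val_Fract[OF d2] by (simp add: h power2_eq_square)
  show ?thesis
    unfolding val_def[of r] ev_num_ev2 ev_den_ev2 D_t_def D_s_def D
    by (rule DERIV_cong[OF DERIV_divide[OF has_field_derivative_ev2[OF T V] has_field_derivative_ev2[OF T V] d]])
       (use d in \<open>simp add: field_simps\<close>)
qed

lemma poly3_along_line:
  fixes F :: "complex poly poly poly"
  shows "\<exists>q. \<forall>l. poly3 F (X1 + l * d1, X2 + l * d2, X3 + l * d3) = poly q l"
proof -
  have c: "comm_ring_hom (\<lambda>c::complex. [:c:])" by (rule comm_ring_homI) (auto simp: one_pCons)
  have E: "comm_ring_hom (\<lambda>p::complex poly. poly p l)" for l by (rule comm_ring_homI) auto
  show ?thesis
    by (rule exI[of _ "ev3 (\<lambda>c. [:c:]) F ([:X1, d1:], [:X2, d2:], [:X3, d3:])"])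
       (simp add: hom_ev3[OF c E] ev3_id)
qed

context parametrized_surface
begin

text \<open>
  The complexification of a real line in the surface lies in the complexified surface.
\<close>

lemma ruled_imp_complex_line:
  assumes ruled: "is_ruled S" and P: "(a, b, c) \<in> S"
  obtains d1 d2 d3 :: complex where "(d1, d2, d3) \<noteq> (0, 0, 0)"
    "\<And>l. (of_real a + l * d1, of_real b + l * d2, of_real c + l * d3) \<in> complex_closure S"
proof -
  from ruled P consider (real) L where "is_line L" "(a, b, c) \<in> L" "L \<subseteq> S"
    | (complex) L where "is_line L" "(complex_of_real a, complex_of_real b, complex_of_real c) \<in> L" "L \<subseteq> complex_closure S"
    unfolding is_ruled_def map3_def by fastforce
  then show ?thesis
  proof cases
    case real
    then obtain a' b' c' u v w where uvw: "(u, v, w) \<noteq> (0, 0, 0)"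
      and L: "L = {(a' + l * u, b' + l * v, c' + l * w) |l. True}"
      unfolding is_line_def by blast
    obtain l0 where l0: "a = a' + l0 * u" "b = b' + l0 * v" "c = c' + l0 * w" using real(2) L by auto
    have inS: "(a + l * u, b + l * v, c + l * w) \<in> S" for l
    proof -
      have "(a + l * u, b + l * v, c + l * w) = (a' + (l0 + l) * u, b' + (l0 + l) * v, c' + (l0 + l) * w)"
        by (simp add: l0 algebra_simps)
      then show ?thesis using real(3) L by blast
    qed
    show ?thesis
    proof (rule that[of "of_real u" "of_real v" "of_real w"])
      show "(complex_of_real u, complex_of_real v, complex_of_real w) \<noteq> (0, 0, 0)" using uvw by simp
      show "(of_real a + l * of_real u, of_real b + l * of_real v, of_real c + l * of_real w) \<in> complex_closure S" for l
      proof (rule line_in_complex_closure)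
        fix F l assume "ev3 const_fun F x = 0"
        then have "poly3 F (a + l * u, b + l * v, c + l * w) = 0" using inS mem_S_iff by blast
        then have "complex_of_real (poly3 F (a + l * u, b + l * v, c + l * w)) = 0" by simp
        then show "ev3 of_real F (of_real a + of_real l * of_real u, of_real b + of_real l * of_real v,
            of_real c + of_real l * of_real w) = (0::complex)"
          unfolding ev3_of_real_of_real[symmetric] by simp
      qed
    qed
  next
    case complex
    then obtain a' b' c' u v w where uvw: "(u, v, w) \<noteq> (0, 0, 0)"
      and L: "L = {(a' + l * u, b' + l * v, c' + l * w) |l. True}"
      unfolding is_line_def by blast
    obtain l0 where l0: "complex_of_real a = a' + l0 * u" "complex_of_real b = b' + l0 * v" "complex_of_real c = c' + l0 * w"
      using complex(2) L by auto
    show ?thesis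
    proof (rule that[OF uvw])
      fix l
      have "(of_real a + l * u, of_real b + l * v, of_real c + l * w) = (a' + (l0 + l) * u, b' + (l0 + l) * v, c' + (l0 + l) * w)"
        unfolding l0 by (simp add: algebra_simps)
      then show "(of_real a + l * u, of_real b + l * v, of_real c + l * w) \<in> complex_closure S"
        using complex(3) L by blast
    qed
  qed
qed

end

context proper_surface
begin

text \<open>
  The birational inverse lifts a line through a generic point to a holomorphic curve in the parameter
  plane.
\<close>

lemma curve_over_line:
  fixes t0 s0 d1 d2 d3 :: complex
  assumes dom: "(t0, s0) \<in> param_dom x"
    and q: "poly3 q1 (param_map x (t0, s0)) \<noteq> 0" "poly3 q2 (param_map x (t0, s0)) \<noteq> 0"
    and line: "\<And>l. (val x1 t0 s0 + l * d1, val x2 t0 s0 + l * d2, val x3 t0 s0 + l * d3) \<in> complex_closure S"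
  obtains U T V where "open U" "0 \<in> U" "T holomorphic_on U" "V holomorphic_on U" "T 0 = t0" "V 0 = s0"
    "\<And>l. l \<in> U \<Longrightarrow> regular x1 (T l) (V l) \<and> regular x2 (T l) (V l) \<and> regular x3 (T l) (V l)"
    "\<And>l. l \<in> U \<Longrightarrow> val x1 (T l) (V l) = val x1 t0 s0 + l * d1 \<and> val x2 (T l) (V l) = val x2 t0 s0 + l * d2
       \<and> val x3 (T l) (V l) = val x3 t0 s0 + l * d3"
proof -
  define Q where "Q = (\<lambda>l. (val x1 t0 s0 + l * d1, val x2 t0 s0 + l * d2, val x3 t0 s0 + l * d3))"
  obtain P1 where P1: "\<And>l. poly3 p1 (Q l) = poly P1 l" unfolding Q_def using poly3_along_line by blast
  obtain P2 where P2: "\<And>l. poly3 p2 (Q l) = poly P2 l" unfolding Q_def using poly3_along_line by blast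
  obtain Q1 where Q1: "\<And>l. poly3 q1 (Q l) = poly Q1 l" unfolding Q_def using poly3_along_line by blast
  obtain Q2 where Q2: "\<And>l. poly3 q2 (Q l) = poly Q2 l" unfolding Q_def using poly3_along_line by blast
  define T where "T = (\<lambda>l. poly P1 l / poly Q1 l)"
  define V where "V = (\<lambda>l. poly P2 l / poly Q2 l)"
  define W where "W = {l. poly Q1 l * poly Q2 l \<noteq> 0}"
  have oW: "open W" unfolding W_def by (intro open_Collect_neq continuous_intros)
  have TW: "T holomorphic_on W" "V holomorphic_on W"
    unfolding T_def V_def W_def by (auto intro!: holomorphic_intros)
  define den where "den = (\<lambda>l. ev_den x1 (T l) (V l) * ev_den x2 (T l) (V l) * ev_den x3 (T l) (V l))"
  have den: "continuous_on W (\<lambda>l. ev_den r (T l) (V l))" for r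
  proof (rule continuous_at_imp_continuous_on, rule ballI)
    fix l assume l: "l \<in> W"
    obtain T' V' where "(T has_field_derivative T') (at l)" "(V has_field_derivative V') (at l)"
      using TW l oW by (meson holomorphic_on_open)
    from has_field_derivative_ev2[OF this, of "denom r"]
    show "isCont (\<lambda>l. ev_den r (T l) (V l)) l" unfolding ev_den_ev2 by (rule DERIV_isCont)
  qed
  define U where "U = W \<inter> den -` (- {0})"
  have "continuous_on W den" unfolding den_def by (intro continuous_intros den)
  then have oU: "open U" unfolding U_def using oW by (intro continuous_open_preimage) auto
  have Q0: "Q 0 = param_map x (t0, s0)" by (simp add: Q_def param_map_val)
  have TV0: "T 0 = t0" "V 0 = s0"
    using left_inverse[OF dom q] unfolding T_def V_def P1[symmetric] P2[symmetric] Q1[symmetric] Q2[symmetric] Q0 by auto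
  have U0: "0 \<in> U"
    using q dom unfolding U_def W_def Q1[symmetric] Q2[symmetric] Q0 by (simp add: den_def TV0 param_dom_iff Q0)
  have UW: "U \<subseteq> W" by (auto simp: U_def)
  have reg: "regular x1 (T l) (V l) \<and> regular x2 (T l) (V l) \<and> regular x3 (T l) (V l)" if "l \<in> U" for l
    using that by (auto simp: U_def den_def)
  have val: "val x1 (T l) (V l) = val x1 t0 s0 + l * d1 \<and> val x2 (T l) (V l) = val x2 t0 s0 + l * d2
       \<and> val x3 (T l) (V l) = val x3 t0 s0 + l * d3" if l: "l \<in> U" for l
  proof -
    have "poly3 q1 (Q l) \<noteq> 0" "poly3 q2 (Q l) \<noteq> 0" using UW l by (auto simp: W_def Q1 Q2)
    moreover have "(T l, V l) \<in> param_dom x" using reg[OF l] by (simp add: param_dom_iff)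
    moreover have "Q l \<in> complex_closure S" unfolding Q_def by (rule line)
    ultimately have "param_map x (T l, V l) = Q l"
      using right_inverse[of "Q l"] by (simp add: T_def V_def P1 P2 Q1 Q2)
    then show ?thesis by (simp add: param_map_val Q_def)
  qed
  show ?thesis
    by (rule that[OF oU U0 _ _ TV0 reg val]) (use TW UW in \<open>auto intro: holomorphic_on_subset\<close>)
qed

end

context proper_surface
begin

lemma regular_frame:
  assumes "regular x1 t s" "regular x2 t s" "regular x3 t s"
  shows "regular a1 t s" "regular a2 t s" "regular a3 t s" "regular b1 t s" "regular b2 t s" "regular b3 t s"
    "regular tt1 t s" "regular tt2 t s" "regular tt3 t s" "regular ts1 t s" "regular ts2 t s" "regular ts3 t s"
    "regular ss1 t s" "regular ss2 t s" "regular ss3 t s" "regular n1 t s" "regular n2 t s" "regular n3 t s"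
    "regular e t s" "regular f t s" "regular g t s" "regular E t s" "regular F t s" "regular G t s" "regular I t s"
    "regular (Gam_11_1 x) t s" "regular (Gam_11_2 x) t s" "regular (Gam_12_1 x) t s"
    "regular (Gam_12_2 x) t s" "regular (Gam_22_1 x) t s" "regular (Gam_22_2 x) t s"
  using assms
  by (simp_all add: christoffel second_form first_form I_eq(2) n1_def n2_def n3_def tt1_def tt2_def tt3_def
      ts1_def ts2_def ts3_def ss1_def ss2_def ss3_def a1_def a2_def a3_def b1_def b2_def b3_def)

lemma tangent_of_affine_coordinate:
  assumes U: "open U" "l \<in> U" and T: "T holomorphic_on U" "V holomorphic_on U"
    and r: "regular r (T l) (V l)" and eq: "\<And>l. l \<in> U \<Longrightarrow> val r (T l) (V l) = k + l * c"
  shows "val (D_t r) (T l) (V l) * deriv T l + val (D_s r) (T l) (V l) * deriv V l = c"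
proof -
  have "((\<lambda>l. val r (T l) (V l)) has_field_derivative
      val (D_t r) (T l) (V l) * deriv T l + val (D_s r) (T l) (V l) * deriv V l) (at l)"
    by (rule has_field_derivative_val[OF holomorphic_derivI[OF T(1) U] holomorphic_derivI[OF T(2) U] r])
  moreover have "((\<lambda>l. k + l * c) has_field_derivative c) (at l)"
    by (auto intro!: derivative_eq_intros)
  then have "((\<lambda>l. val r (T l) (V l)) has_field_derivative c) (at l)"
    by (rule DERIV_cong_ev[OF refl _ refl, THEN iffD2, rotated])
      (use U eq in \<open>auto simp: eventually_nhds intro!: exI[of _ U]\<close>)
  ultimately show ?thesis by (rule DERIV_unique)
qed

text \<open>
  \<open>(\<alpha>, \<beta>)\<close> and \<open>(\<tau>, \<sigma>)\<close> are the velocity and the acceleration, at the point, of the parameter curve of the line.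
  The second derivative of the line vanishes.  Its normal component gives the equation of asymptotic
  directions and its tangential components give the equations of geodesics.  The last equation is the
  derivative of the first one along the curve.
\<close>

lemma line_through_point:
  fixes t0 s0 :: real and d1 d2 d3 :: complex
  defines "tc \<equiv> complex_of_real t0" and "sc \<equiv> complex_of_real s0"
  defines "v \<equiv> \<lambda>r. val r tc sc"
  assumes dom: "(t0, s0) \<in> param_dom x"
    and q: "poly3 q1 (param_map x (tc, sc)) \<noteq> 0" "poly3 q2 (param_map x (tc, sc)) \<noteq> 0"
    and line: "\<And>l. (v x1 + l * d1, v x2 + l * d2, v x3 + l * d3) \<in> complex_closure S"
    and d: "(d1, d2, d3) \<noteq> (0, 0, 0)" and I: "v I \<noteq> 0"
  obtains \<alpha> \<beta> \<tau> \<sigma> :: complex where "(\<alpha>, \<beta>) \<noteq> (0, 0)"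
    "v e * \<alpha> ^ 2 + 2 * v f * \<alpha> * \<beta> + v g * \<beta> ^ 2 = 0"
    "v I * \<tau> + v (Gam_11_1 x) * \<alpha> ^ 2 + 2 * v (Gam_12_1 x) * \<alpha> * \<beta> + v (Gam_22_1 x) * \<beta> ^ 2 = 0"
    "v I * \<sigma> + v (Gam_11_2 x) * \<alpha> ^ 2 + 2 * v (Gam_12_2 x) * \<alpha> * \<beta> + v (Gam_22_2 x) * \<beta> ^ 2 = 0"
    "(v (D_t e) * \<alpha> + v (D_s e) * \<beta>) * \<alpha> ^ 2 + 2 * (v (D_t f) * \<alpha> + v (D_s f) * \<beta>) * \<alpha> * \<beta>
      + (v (D_t g) * \<alpha> + v (D_s g) * \<beta>) * \<beta> ^ 2
      + 2 * v e * \<alpha> * \<tau> + 2 * v f * (\<tau> * \<beta> + \<alpha> * \<sigma>) + 2 * v g * \<beta> * \<sigma> = 0"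
proof -
  have domc: "(tc, sc) \<in> param_dom x" using dom by (simp add: param_dom_iff tc_def sc_def)
  obtain U T V where U: "open U" "0 \<in> U" and hol: "T holomorphic_on U" "V holomorphic_on U"
    and TV0: "T 0 = tc" "V 0 = sc"
    and reg: "\<And>l. l \<in> U \<Longrightarrow> regular x1 (T l) (V l) \<and> regular x2 (T l) (V l) \<and> regular x3 (T l) (V l)"
    and xl: "\<And>l. l \<in> U \<Longrightarrow> val x1 (T l) (V l) = v x1 + l * d1 \<and> val x2 (T l) (V l) = v x2 + l * d2
       \<and> val x3 (T l) (V l) = v x3 + l * d3"
    using curve_over_line[OF domc q line[unfolded v_def]] unfolding v_def by blast
  define c where "c = (\<lambda>r l. val r (T l) (V l))"
  have c0: "c r 0 = v r" for r by (simp add: c_def v_def TV0)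
  have R: "regular x1 (T l) (V l)" "regular x2 (T l) (V l)" "regular x3 (T l) (V l)" if "l \<in> U" for l
    using reg[OF that] by auto
  note rf = regular_frame[OF R]
  have dT: "(T has_field_derivative deriv T l) (at l)" and dV: "(V has_field_derivative deriv V l) (at l)"
    and dT2: "(deriv T has_field_derivative deriv (deriv T) l) (at l)"
    and dV2: "(deriv V has_field_derivative deriv (deriv V) l) (at l)" if "l \<in> U" for l
    using holomorphic_derivI[OF hol(1) U(1) that] holomorphic_derivI[OF hol(2) U(1) that]
      holomorphic_derivI[OF holomorphic_deriv[OF hol(1) U(1)] U(1) that]
      holomorphic_derivI[OF holomorphic_deriv[OF hol(2) U(1)] U(1) that] by auto
  have dc: "(c r has_field_derivative c (D_t r) l * deriv T l + c (D_s r) l * deriv V l) (at l)"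
    if "l \<in> U" "regular r (T l) (V l)" for r l
    unfolding c_def by (rule has_field_derivative_val[OF dT[OF that(1)] dV[OF that(1)] that(2)])
  have zero_deriv: "h' = 0" if l: "l \<in> U" and z: "\<And>l. l \<in> U \<Longrightarrow> h l = k" and h': "(h has_field_derivative h') (at l)"
    for h :: "complex \<Rightarrow> complex" and h' k l
  proof -
    have "((\<lambda>_. k) has_field_derivative 0) (at l)" by simp
    then have "(h has_field_derivative 0) (at l)"
      by (rule DERIV_cong_ev[OF refl _ refl, THEN iffD2, rotated])
        (use U l z in \<open>auto simp: eventually_nhds intro!: exI[of _ U]\<close>)
    then show ?thesis using h' DERIV_unique by blast
  qed
  have first: "c a1 l * deriv T l + c b1 l * deriv V l = d1 \<and> c a2 l * deriv T l + c b2 l * deriv V l = d2 \<and>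
      c a3 l * deriv T l + c b3 l * deriv V l = d3" if l: "l \<in> U" for l
    using tangent_of_affine_coordinate[OF U(1) l hol, of x1 "v x1" d1] tangent_of_affine_coordinate[OF U(1) l hol, of x2 "v x2" d2]
      tangent_of_affine_coordinate[OF U(1) l hol, of x3 "v x3" d3] R[OF l] xl
    unfolding c_def first_derivs by blast
  have second_gen: "(c (D_t a) l * deriv T l + c (D_s a) l * deriv V l) * deriv T l + c a l * deriv (deriv T) l
      + ((c (D_t b) l * deriv T l + c (D_s b) l * deriv V l) * deriv V l + c b l * deriv (deriv V) l) = 0"
    if l: "l \<in> U" and z: "\<And>l. l \<in> U \<Longrightarrow> c a l * deriv T l + c b l * deriv V l = k"
      and ab: "regular a (T l) (V l)" "regular b (T l) (V l)" for a b k l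
    by (rule zero_deriv[OF l z], assumption)
      (rule DERIV_cong[OF DERIV_add[OF DERIV_mult[OF dc[OF l ab(1)] dT2[OF l]] DERIV_mult[OF dc[OF l ab(2)] dV2[OF l]]]],
       simp add: algebra_simps)
  have second: "c tt1 l * deriv T l ^ 2 + 2 * c ts1 l * deriv T l * deriv V l + c ss1 l * deriv V l ^ 2
        + c a1 l * deriv (deriv T) l + c b1 l * deriv (deriv V) l = 0 \<and>
      c tt2 l * deriv T l ^ 2 + 2 * c ts2 l * deriv T l * deriv V l + c ss2 l * deriv V l ^ 2
        + c a2 l * deriv (deriv T) l + c b2 l * deriv (deriv V) l = 0 \<and>
      c tt3 l * deriv T l ^ 2 + 2 * c ts3 l * deriv T l * deriv V l + c ss3 l * deriv V l ^ 2
        + c a3 l * deriv (deriv T) l + c b3 l * deriv (deriv V) l = 0" if l: "l \<in> U" for l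
    using second_gen[OF l, of a1 b1 d1] second_gen[OF l, of a2 b2 d2] second_gen[OF l, of a3 b3 d3] first rf[OF l l l]
    by (simp add: second_derivs D_t_b algebra_simps power2_eq_square)
  have val_n: "c n1 l = c a2 l * c b3 l - c a3 l * c b2 l" "c n2 l = c a3 l * c b1 l - c a1 l * c b3 l"
    "c n3 l = c a1 l * c b2 l - c a2 l * c b1 l" if l: "l \<in> U" for l
    using rf[OF l l l] unfolding c_def n1_def n2_def n3_def by (simp_all add: val_simps)
  have val_efg: "c e l = c tt1 l * c n1 l + c tt2 l * c n2 l + c tt3 l * c n3 l"
    "c f l = c ts1 l * c n1 l + c ts2 l * c n2 l + c ts3 l * c n3 l"
    "c g l = c ss1 l * c n1 l + c ss2 l * c n2 l + c ss3 l * c n3 l" if l: "l \<in> U" for l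
    using rf[OF l l l] unfolding c_def second_form by (simp_all add: val_simps)
  have asym: "c e l * deriv T l ^ 2 + 2 * (c f l * deriv T l * deriv V l) + c g l * deriv V l ^ 2 = 0" if l: "l \<in> U" for l
  proof -
    let ?T = "deriv T l" and ?V = "deriv V l" and ?T2 = "deriv (deriv T) l" and ?V2 = "deriv (deriv V) l"
    have "c e l * ?T ^ 2 + 2 * (c f l * ?T * ?V) + c g l * ?V ^ 2
      = c n1 l * (c tt1 l * ?T ^ 2 + 2 * c ts1 l * ?T * ?V + c ss1 l * ?V ^ 2 + c a1 l * ?T2 + c b1 l * ?V2)
      + c n2 l * (c tt2 l * ?T ^ 2 + 2 * c ts2 l * ?T * ?V + c ss2 l * ?V ^ 2 + c a2 l * ?T2 + c b2 l * ?V2)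
      + c n3 l * (c tt3 l * ?T ^ 2 + 2 * c ts3 l * ?T * ?V + c ss3 l * ?V ^ 2 + c a3 l * ?T2 + c b3 l * ?V2)
      - (c n1 l * c a1 l + c n2 l * c a2 l + c n3 l * c a3 l) * ?T2
      - (c n1 l * c b1 l + c n2 l * c b2 l + c n3 l * c b3 l) * ?V2"
      unfolding val_efg[OF l] by (simp add: algebra_simps)
    moreover have "c n1 l * c a1 l + c n2 l * c a2 l + c n3 l * c a3 l = 0"
      "c n1 l * c b1 l + c n2 l * c b2 l + c n3 l * c b3 l = 0"
      unfolding val_n[OF l] by (simp_all add: algebra_simps)
    ultimately show ?thesis using second[OF l] by simp
  qed
  have third: "(c (D_t e) l * deriv T l + c (D_s e) l * deriv V l) * deriv T l ^ 2
      + 2 * (c (D_t f) l * deriv T l + c (D_s f) l * deriv V l) * deriv T l * deriv V l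
      + (c (D_t g) l * deriv T l + c (D_s g) l * deriv V l) * deriv V l ^ 2
      + 2 * c e l * deriv T l * deriv (deriv T) l
      + 2 * c f l * (deriv (deriv T) l * deriv V l + deriv T l * deriv (deriv V) l)
      + 2 * c g l * deriv V l * deriv (deriv V) l = 0" if l: "l \<in> U" for l
  proof (rule zero_deriv[OF l asym])
    have e: "(c e has_field_derivative c (D_t e) l * deriv T l + c (D_s e) l * deriv V l) (at l)"
      "(c f has_field_derivative c (D_t f) l * deriv T l + c (D_s f) l * deriv V l) (at l)"
      "(c g has_field_derivative c (D_t g) l * deriv T l + c (D_s g) l * deriv V l) (at l)"
      using rf[OF l l l] by (auto intro!: dc l)
    note [derivative_intros] = e dT2[OF l] dV2[OF l]
    show "((\<lambda>l. c e l * deriv T l ^ 2 + 2 * (c f l * deriv T l * deriv V l) + c g l * deriv V l ^ 2)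
      has_field_derivative (c (D_t e) l * deriv T l + c (D_s e) l * deriv V l) * deriv T l ^ 2
      + 2 * (c (D_t f) l * deriv T l + c (D_s f) l * deriv V l) * deriv T l * deriv V l
      + (c (D_t g) l * deriv T l + c (D_s g) l * deriv V l) * deriv V l ^ 2
      + 2 * c e l * deriv T l * deriv (deriv T) l
      + 2 * c f l * (deriv (deriv T) l * deriv V l + deriv T l * deriv (deriv V) l)
      + 2 * c g l * deriv V l * deriv (deriv V) l) (at l)"
      by (auto intro!: derivative_eq_intros e dT2[OF l] dV2[OF l] simp: algebra_simps power2_eq_square)
  qed
  let ?\<alpha> = "deriv T 0" and ?\<beta> = "deriv V 0" and ?\<tau> = "deriv (deriv T) 0" and ?\<sigma> = "deriv (deriv V) 0"
  define p q where "p = v I * ?\<tau> + v (Gam_11_1 x) * ?\<alpha> ^ 2 + 2 * v (Gam_12_1 x) * ?\<alpha> * ?\<beta> + v (Gam_22_1 x) * ?\<beta> ^ 2"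
    and "q = v I * ?\<sigma> + v (Gam_11_2 x) * ?\<alpha> ^ 2 + 2 * v (Gam_12_2 x) * ?\<alpha> * ?\<beta> + v (Gam_22_2 x) * ?\<beta> ^ 2"
  note rf0 = rf[OF U(2) U(2) U(2), unfolded TV0]
  \<comment> \<open>insert the Gauss formulas, multiplied by \<open>I\<close>, into the vanishing second derivative; the normal part is
    the asymptotic equation\<close>
  have comb: "p * v a + q * v b = 0"
    if ga: "I * tt = Gam_11_1 x * a + Gam_11_2 x * b + e * n"
        "I * ts = Gam_12_1 x * a + Gam_12_2 x * b + f * n" "I * ss = Gam_22_1 x * a + Gam_22_2 x * b + g * n"
      and rg: "regular a tc sc" "regular b tc sc" "regular tt tc sc" "regular ts tc sc" "regular ss tc sc" "regular n tc sc"
      and sec: "v tt * ?\<alpha> ^ 2 + 2 * v ts * ?\<alpha> * ?\<beta> + v ss * ?\<beta> ^ 2 + v a * ?\<tau> + v b * ?\<sigma> = 0"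
    for a b tt ts ss n
  proof -
    have k: "v I * v tt = v (Gam_11_1 x) * v a + v (Gam_11_2 x) * v b + v e * v n"
      "v I * v ts = v (Gam_12_1 x) * v a + v (Gam_12_2 x) * v b + v f * v n"
      "v I * v ss = v (Gam_22_1 x) * v a + v (Gam_22_2 x) * v b + v g * v n"
      using arg_cong[OF ga(1), of v] arg_cong[OF ga(2), of v] arg_cong[OF ga(3), of v] rg rf0
      unfolding v_def by (simp_all add: val_simps)
    have "0 = v I * (v tt * ?\<alpha> ^ 2 + 2 * v ts * ?\<alpha> * ?\<beta> + v ss * ?\<beta> ^ 2 + v a * ?\<tau> + v b * ?\<sigma>)" by (simp add: sec)
    also have "\<dots> = (v I * v tt) * ?\<alpha> ^ 2 + 2 * (v I * v ts) * ?\<alpha> * ?\<beta> + (v I * v ss) * ?\<beta> ^ 2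
        + v I * v a * ?\<tau> + v I * v b * ?\<sigma>" by (simp add: algebra_simps)
    also have "\<dots> = p * v a + q * v b + v n * (v e * ?\<alpha> ^ 2 + 2 * (v f * ?\<alpha> * ?\<beta>) + v g * ?\<beta> ^ 2)"
      unfolding k p_def q_def by (simp add: algebra_simps)
    finally show ?thesis using asym[OF U(2)] by (simp add: c0)
  qed
  have combs: "p * v a1 + q * v b1 = 0" "p * v a2 + q * v b2 = 0" "p * v a3 + q * v b3 = 0"
    using second[OF U(2)] gauss_formulas rf0 unfolding c0
    by (auto intro!: comb[of tt1 a1 b1 n1 ts1 ss1] comb[of tt2 a2 b2 n2 ts2 ss2] comb[of tt3 a3 b3 n3 ts3 ss3])
  have nv: "v n1 = v a2 * v b3 - v a3 * v b2" "v n2 = v a3 * v b1 - v a1 * v b3" "v n3 = v a1 * v b2 - v a2 * v b1"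
    using val_n[OF U(2)] by (simp_all add: c0)
  have In: "v I = v n1 * v n1 + v n2 * v n2 + v n3 * v n3"
    using rf0 unfolding v_def I_eq(2) by (simp add: val_simps)
  have "p * v n1 = (p * v a2 + q * v b2) * v b3 - (p * v a3 + q * v b3) * v b2"
    "p * v n2 = (p * v a3 + q * v b3) * v b1 - (p * v a1 + q * v b1) * v b3"
    "p * v n3 = (p * v a1 + q * v b1) * v b2 - (p * v a2 + q * v b2) * v b1"
    "q * v n1 = (p * v a3 + q * v b3) * v a2 - (p * v a2 + q * v b2) * v a3"
    "q * v n2 = (p * v a1 + q * v b1) * v a3 - (p * v a3 + q * v b3) * v a1"
    "q * v n3 = (p * v a2 + q * v b2) * v a1 - (p * v a1 + q * v b1) * v a2"
    unfolding nv by (simp_all add: algebra_simps)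
  then have "p * v n1 = 0" "p * v n2 = 0" "p * v n3 = 0" "q * v n1 = 0" "q * v n2 = 0" "q * v n3 = 0"
    unfolding combs by simp_all
  moreover have "p * v I = p * v n1 * v n1 + p * v n2 * v n2 + p * v n3 * v n3"
    "q * v I = q * v n1 * v n1 + q * v n2 * v n2 + q * v n3 * v n3" unfolding In by (simp_all add: algebra_simps)
  ultimately have "p * v I = 0" "q * v I = 0" by auto
  then have pq: "p = 0" "q = 0" using I by auto
  show ?thesis
  proof (rule that[of ?\<alpha> ?\<beta> ?\<tau> ?\<sigma>])
    show "(?\<alpha>, ?\<beta>) \<noteq> (0, 0)" using first[OF U(2)] d by auto
    show "v e * ?\<alpha> ^ 2 + 2 * v f * ?\<alpha> * ?\<beta> + v g * ?\<beta> ^ 2 = 0" using asym[OF U(2)] by (simp add: c0 mult.assoc)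
  qed (use pq third[OF U(2)] in \<open>simp_all add: p_def q_def c0\<close>)
qed

end

context proper_surface
begin

lemma coeffs_regular_exprs:
  assumes r: "regular x1 t s" "regular x2 t s" "regular x3 t s"
  shows "coeffs_regular (M_expr x) t s" "coeffs_regular (A_expr x) t s" "coeffs_regular (B_expr x) t s"
    "coeffs_regular (geodesic_rhs x) t s"
  using regular_frame[OF r] by (simp_all add: M_expr_def A_expr_def B_expr_def geodesic_rhs_def Let_def)

text \<open>
  If \<open>\<mu>\<close> is not zero, \<open>M_expr\<close> and the geodesic condition satisfy a Bezout identity, so they have no
  common root at a generic point of the parameter plane.  A line through this point with velocity
  \<open>(\<alpha>, \<beta>)\<close>, \<open>\<alpha> \<noteq> 0\<close>, would provide the common root \<open>\<beta> / \<alpha>\<close>.  So \<open>\<alpha> = 0\<close>, and the equation of asymptotic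
  directions becomes \<open>g = 0\<close>.  At a single point this leaves the acceleration \<open>\<tau>\<close> free; but \<open>g\<close> now
  vanishes identically, the derived equation reduces to \<open>f \<tau> \<beta> = 0\<close> with \<open>f \<noteq> 0\<close>, and then
  the geodesic equation gives the vanishing of the Christoffel symbol.
\<close>

theorem eta_eq_0_if_ruled:
  assumes ruled: "is_ruled S" and fg: "\<not> fg_zero x" and mu: "mu x \<noteq> 0"
  shows "eta x = 0"
proof -
  from mu have "eval_ac \<omega> geodesic_condition \<noteq> 0" if "eval_ac \<omega> (M_expr x) = 0" for \<omega>
    using that by (auto simp: mu_eq_0_iff[OF fg])
  then obtain u w where uw: "u * M_expr x + w * geodesic_condition = 1"
    using bezout_if_no_common_root by blast
  \<comment> \<open>a coefficient of \<open>M_expr\<close> that must not vanish at the chosen point: \<open>g\<close> excludes \<open>\<alpha> = 0\<close>, and if \<open>g\<close> is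
    zero, \<open>f\<close> excludes a nonzero acceleration \<open>\<tau>\<close>\<close>
  define h where "h = (if g = 0 then f else g)"
  have h: "h \<noteq> 0" using fg by (auto simp: h_def fg_zero_def)
  let ?Q = "\<lambda>t s. ((t, s) \<in> param_dom x \<and>
       poly3 q1 (point t s) \<noteq> 0 \<and>
       poly3 q2 (point t s) \<noteq> 0) \<and>
     (regular I t s \<and> val I t s \<noteq> 0) \<and> (regular h t s \<and> val h t s \<noteq> 0) \<and>
     coeffs_regular u (complex_of_real t) (complex_of_real s) \<and>
     coeffs_regular w (complex_of_real t) (complex_of_real s)"
  have gen: "generically ?Q"
    by (intro generically_conj generically_inverse generically_val_nonzero I_nonzero h generically_coeffs_regular)
  have concl: "generically (\<lambda>t s. g = 0 \<and> val (Gam_22_1 x) t s = 0)"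
  proof (rule generically_mono[OF gen])
    fix t s :: real
    define tc sc where "tc = complex_of_real t" and "sc = complex_of_real s"
    assume *: "?Q t s"
    define v where "v r = val r tc sc" for r
    have v: "v r = of_real (val r t s)" for r by (simp add: v_def tc_def sc_def val_of_real)
    have dom: "(t, s) \<in> param_dom x" using * by blast
    then have reg: "regular x1 tc sc" "regular x2 tc sc" "regular x3 tc sc"
      by (simp_all add: param_dom_iff tc_def sc_def)
    note rf = regular_frame[OF reg]
    have "(val x1 t s, val x2 t s, val x3 t s) \<in> S"
      using image_subset_S[OF dom] by (simp add: param_map_val)
    from ruled_imp_complex_line[OF ruled this] obtain d1 d2 d3 where d: "(d1, d2, d3) \<noteq> (0, 0, 0)"
      and line: "\<And>l. (v x1 + l * d1, v x2 + l * d2, v x3 + l * d3) \<in> complex_closure S"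
      unfolding v by blast
    have q: "poly3 q1 (param_map x (tc, sc)) \<noteq> 0" "poly3 q2 (param_map x (tc, sc)) \<noteq> 0"
      using * by (simp_all add: tc_def sc_def)
    have I: "v I \<noteq> 0" and hv: "v h \<noteq> 0" using * by (simp_all add: v)
    obtain \<alpha> \<beta> \<tau> \<sigma> where ab: "(\<alpha>, \<beta>) \<noteq> (0, 0)"
      and asym: "v e * \<alpha> ^ 2 + 2 * v f * \<alpha> * \<beta> + v g * \<beta> ^ 2 = 0"
      and geo1: "v I * \<tau> + v (Gam_11_1 x) * \<alpha> ^ 2 + 2 * v (Gam_12_1 x) * \<alpha> * \<beta> + v (Gam_22_1 x) * \<beta> ^ 2 = 0"
      and geo2: "v I * \<sigma> + v (Gam_11_2 x) * \<alpha> ^ 2 + 2 * v (Gam_12_2 x) * \<alpha> * \<beta> + v (Gam_22_2 x) * \<beta> ^ 2 = 0"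
      and third: "(v (D_t e) * \<alpha> + v (D_s e) * \<beta>) * \<alpha> ^ 2 + 2 * (v (D_t f) * \<alpha> + v (D_s f) * \<beta>) * \<alpha> * \<beta>
        + (v (D_t g) * \<alpha> + v (D_s g) * \<beta>) * \<beta> ^ 2
        + 2 * v e * \<alpha> * \<tau> + 2 * v f * (\<tau> * \<beta> + \<alpha> * \<sigma>) + 2 * v g * \<beta> * \<sigma> = 0"
      by (rule line_through_point[OF dom q[unfolded tc_def sc_def] line[unfolded v_def tc_def sc_def] d
            I[unfolded v_def tc_def sc_def], folded tc_def sc_def, folded v_def])
    have "\<alpha> = 0"
    proof (rule ccontr)
      assume a0: "\<alpha> \<noteq> 0"
      define \<omega> where "\<omega> = \<beta> / \<alpha>"
      have b: "\<beta> = \<omega> * \<alpha>" using a0 by (simp add: \<omega>_def)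
      have "\<alpha> ^ 2 * (v e + 2 * v f * \<omega> + v g * \<omega> ^ 2) = 0"
        using asym unfolding b by (simp add: algebra_simps power2_eq_square)
      then have m: "v e + 2 * v f * \<omega> + v g * \<omega> ^ 2 = 0" using a0 by simp
      let ?U = "v (Gam_11_1 x) + 2 * v (Gam_12_1 x) * \<omega> + v (Gam_22_1 x) * \<omega> ^ 2"
      let ?V = "v (Gam_11_2 x) + 2 * v (Gam_12_2 x) * \<omega> + v (Gam_22_2 x) * \<omega> ^ 2"
      let ?A = "2 * (v f + v g * \<omega>)"
      let ?B = "v (D_t e) + (2 * v (D_t f) + v (D_s e)) * \<omega> + (2 * v (D_s f) + v (D_t g)) * \<omega> ^ 2 + v (D_s g) * \<omega> ^ 3"
      have t: "v I * \<tau> = - (\<alpha> ^ 2 * ?U)"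
        using geo1 unfolding b eq_neg_iff_add_eq_0 by (simp add: algebra_simps power2_eq_square)
      have sg: "v I * \<sigma> = - (\<alpha> ^ 2 * ?V)"
        using geo2 unfolding b eq_neg_iff_add_eq_0 by (simp add: algebra_simps power2_eq_square)
      have "0 = v I * ((v (D_t e) * \<alpha> + v (D_s e) * \<beta>) * \<alpha> ^ 2 + 2 * (v (D_t f) * \<alpha> + v (D_s f) * \<beta>) * \<alpha> * \<beta>
        + (v (D_t g) * \<alpha> + v (D_s g) * \<beta>) * \<beta> ^ 2
        + 2 * v e * \<alpha> * \<tau> + 2 * v f * (\<tau> * \<beta> + \<alpha> * \<sigma>) + 2 * v g * \<beta> * \<sigma>)" by (simp only: third mult_zero_right)
      also have "\<dots> = \<alpha> ^ 3 * v I * ?B + 2 * \<alpha> * (v e + 2 * v f * \<omega> + v g * \<omega> ^ 2) * (v I * \<tau>)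
          + \<alpha> * ?A * (v I * \<sigma> - \<omega> * (v I * \<tau>))"
        unfolding b by (simp add: algebra_simps power2_eq_square power3_eq_cube)
      also have "\<dots> = \<alpha> ^ 3 * (v I * ?B + ?A * (\<omega> * ?U - ?V))"
        unfolding m t sg by (simp add: algebra_simps power2_eq_square power3_eq_cube)
      finally have n: "v I * ?B + ?A * (\<omega> * ?U - ?V) = 0" using a0 by simp
      note cr = coeffs_regular_exprs[OF reg]
      have crg: "coeffs_regular geodesic_condition tc sc" using cr rf by simp
      have cu: "coeffs_regular u tc sc" "coeffs_regular w tc sc" using * by (simp_all add: tc_def sc_def)
      have pM: "poly (poly_at tc sc (M_expr x)) \<omega> = 0"
        using m rf by (simp add: M_expr_def v_def val_simps algebra_simps power2_eq_square)
      have pA: "poly (poly_at tc sc (A_expr x)) \<omega> = ?A"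
        using fg rf by (simp add: A_expr_def v_def val_simps algebra_simps)
      have pB: "poly (poly_at tc sc (B_expr x)) \<omega> = ?B"
        using fg rf by (simp add: B_expr_def Let_def v_def val_simps algebra_simps power2_eq_square power3_eq_cube)
      have pr: "poly (poly_at tc sc (geodesic_rhs x)) \<omega> = \<omega> * ?U - ?V"
        using rf by (simp add: geodesic_rhs_def v_def val_simps algebra_simps power2_eq_square)
      have "poly (poly_at tc sc geodesic_condition) \<omega> = v I * ?B + ?A * (\<omega> * ?U - ?V)"
        using cr rf by (simp add: poly_at_add poly_at_smult poly_at_mult pA pB pr) (simp add: v_def)
      then have pN: "poly (poly_at tc sc geodesic_condition) \<omega> = 0" using n by simp
      have "poly (poly_at tc sc (u * M_expr x + w * geodesic_condition)) \<omega>
        = poly (poly_at tc sc u) \<omega> * poly (poly_at tc sc (M_expr x)) \<omega>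
          + poly (poly_at tc sc w) \<omega> * poly (poly_at tc sc geodesic_condition) \<omega>"
        using cr(1) crg cu by (simp only: poly_at_add poly_at_mult coeffs_regular_mult poly_add poly_mult)
      then show False unfolding uw pM pN by (simp add: one_pCons)
    qed
    then have b0: "\<beta> \<noteq> 0" and "v g = 0" using ab asym by auto
    then have g: "g = 0" using hv by (cases "g = 0") (simp_all add: h_def)
    then have "2 * v f * \<tau> * \<beta> = 0" using third \<open>\<alpha> = 0\<close> \<open>v g = 0\<close> by (simp add: v_def D_simps)
    then have "\<tau> = 0" using b0 hv g by (simp add: h_def)
    then have "v (Gam_22_1 x) = 0" using geo1 \<open>\<alpha> = 0\<close> b0 by simp
    then show "g = 0 \<and> val (Gam_22_1 x) t s = 0" using g by (simp add: v)
  qed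
  have "g = 0" using generically_ex[OF concl] by blast
  moreover have "Gam_22_1 x = 0" by (rule ratfun_eq_0I[OF generically_mono[OF concl]]) simp
  ultimately show ?thesis by (simp add: eta_eq_0_iff)
qed

theorem ruled_iff:
  assumes "\<not> is_plane S"
  shows "is_ruled S \<longleftrightarrow> mu x = 0 \<or> eta x = 0"
proof (cases "fg_zero x")
  case True
  have curved: "(e, f, g) \<noteq> (0, 0, 0)" using plane_if_second_form_zero assms by auto
  then have "eta x = 0" using True by (intro eta_eq_0_if_fg_zero)
  then show ?thesis using ruled_if_eta_eq_0 by blast
next
  case False
  then have curved: "(e, f, g) \<noteq> (0, 0, 0)" by (auto simp: fg_zero_def)
  have "is_ruled S" if mu: "mu x = 0"
  proof (cases "e * g - f ^ 2 = 0")
    case True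
    then show ?thesis using curved by (rule ruled_if_parabolic)
  next
    case hyperbolic: False
    then obtain \<omega> where "eval_ac \<omega> (M_expr x) = 0" "eval_ac \<omega> geodesic_condition = 0"
      using mu mu_eq_0_iff[OF False] by blast
    then show ?thesis by (rule ruled_if_common_root[OF False hyperbolic])
  qed
  then show ?thesis using ruled_if_eta_eq_0 eta_eq_0_if_ruled[OF _ False] by blast
qed

end

theorem theorem9:
  fixes S :: "(real \<times> real \<times> real) set" and x :: "ratfun triple"
  assumes "properly_parametrizes x S" and "\<not> is_plane S"
  shows "is_ruled S \<longleftrightarrow> mu x = 0 \<or> eta x = 0"
proof -
  obtain x1 x2 x3 where x: "x = (x1, x2, x3)" by (cases x)
  obtain p1 q1 p2 q2 where "proper_surface S x1 x2 x3 p1 q1 p2 q2"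
    using properly_parametrizes_imp_proper_surface assms(1) unfolding x by blast
  then interpret proper_surface S x1 x2 x3 p1 q1 p2 q2 .
  show ?thesis unfolding x by (rule ruled_iff[OF assms(2)])
qed

end
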